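(* Let $\boldsymbol{\mu}$ be an admissible scheduling process and $\mathbf{y}$ an $\mathbb{R}^{n_y}$-valued process. Let $\mathcal{S}=(\{A_i,K_i\}_{i=1}^{n_\mu},C,I_{n_y},\mathbf{e})$ be an asLPV-SSA which is a realization of $(\mathbf{y},\boldsymbol{\mu})$ in innovation form. Assume that $(\mathbf{y},\boldsymbol{\mu})$ is full rank and that $\mathbf{y}$ is SII w.r.t. $\boldsymbol{\mu}$. Then $\mathcal{S}$ is a minimal realization of $(\mathbf{y},\boldsymbol{\mu})$ if and only if the dLPV-SSA $\mathcal{D}_{\mathcal{S}}=(\{A_i,K_i\}_{i=1}^{n_\mu},C,I_{n_y})$ is minimal.
   Context: All random variables live on a fixed probability space; all processes are discrete-time with time axis $\mathbb{Z}$. Words. $\Sigma=\{1,\dots,n_\mu\}$; $\Sigma^+$ is the set of nonempty finite words over $\Sigma$, $\epsilon$ is the empty word, $\Sigma^*=\Sigma^+\cup\{\epsilon\}$, $|w|$ is the length of $w$, and $vw$ denotes concatenation. Scheduling products. $\boldsymbol{\mu}=[\boldsymbol{\mu}_1,\dots,\boldsymbol{\mu}_{n_\mu}]^T$ is a real vector-valued process. For $w=\sigma_1\cdots\sigma_k\in\Sigma^+$, $\boldsymbol{\mu}_w(t)=\boldsymbol{\mu}_{\sigma_1}(t-k+1)\boldsymbol{\mu}_{\sigma_2}(t-k+2)\cdots\boldsymbol{\mu}_{\sigma_k}(t)$, and $\boldsymbol{\mu}_\epsilon(t)=1$. Admissible scheduling. $\boldsymbol{\mu}$ is admissible if: (i)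 with $\mathscr{F}_t^{\boldsymbol{\mu},-}$ the $\sigma$-algebra generated by $\{\boldsymbol{\mu}(k)\}_{k<t}$, there are positive numbers $\{p_\sigma\}_{\sigma\in\Sigma}$ such that for all $w,v\in\Sigma^+$, $\sigma,\sigma'\in\Sigma$, $t\in\mathbb{Z}$: $E[\boldsymbol{\mu}_{w\sigma}(t)\boldsymbol{\mu}_{v\sigma'}(t)\mid\mathscr{F}_t^{\boldsymbol{\mu},-}]$ equals $p_\sigma\boldsymbol{\mu}_w(t-1)\boldsymbol{\mu}_v(t-1)$ if $\sigma=\sigma'$ and $0$ otherwise; $E[\boldsymbol{\mu}_{w\sigma}(t)\boldsymbol{\mu}_{\sigma'}(t)\mid\mathscr{F}_t^{\boldsymbol{\mu},-}]$ equals $p_\sigma\boldsymbol{\mu}_w(t-1)$ if $\sigma=\sigma'$ and $0$ otherwise; $E[\boldsymbol{\mu}_\sigma(t)\boldsymbol{\mu}_{\sigma'}(t)\mid\mathscr{F}_t^{\boldsymbol{\mu},-}]=0$ if $\sigma\neq\sigma'$; (ii) there are real numbers $\{\alpha_\sigma\}_{\sigma\in\Sigma}$ with $\sum_{\sigma\in\Sigma}\alpha_\sigma\boldsymbol{\mu}_\sigma(t)=1$ for all $t$; (iii) for all $w,v\in\Sigma^+$ the process $[\boldsymbol{\mu}_w,\boldsymbol{\mu}_v]^T$ is wide-sense stationary. The scheduling process is assumed admissible throughout; it determines $\{p_\sigma\}$. Put $p_w=p_{\sigma_1}\cdots p_{\sigma_k}$ for $w=\sigma_1\cdots\sigma_k$,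 $p_\epsilon=1$. For a process $\mathbf{r}$ and $w\in\Sigma^*$, $\mathbf{z}^{\mathbf{r}}_w(t)=\mathbf{r}(t-|w|)\,\boldsymbol{\mu}_w(t-1)\frac{1}{\sqrt{p_w}}$ (so $\mathbf{z}^{\mathbf r}_\epsilon=\mathbf{r}$). ZMWSII. $\mathbf{r}$ is ZMWSII w.r.t. $\boldsymbol{\mu}$ if (1) for all $t$, the $\sigma$-algebras generated by $\{\mathbf{r}(k)\}_{k\le t}$ and by $\{\boldsymbol{\mu}_\sigma(k)\}_{k\ge t,\sigma\in\Sigma}$ are conditionally independent given the one generated by $\{\boldsymbol{\mu}_\sigma(k)\}_{k<t,\sigma\in\Sigma}$; (2) $\mathbf{r}$ and $\mathbf{z}^{\mathbf{r}}_w$, $w\in\Sigma^+$, are zero mean, square integrable and jointly wide-sense stationary: for all $t,s,k\in\mathbb{Z}$, $w,v\in\Sigma^+$, the expectations $E[\mathbf{r}(t+k)(\mathbf{z}^{\mathbf r}_w(s+k))^T]$, $E[\mathbf{r}(t+k)(\mathbf{r}(s+k))^T]$, $E[\mathbf{z}^{\mathbf r}_w(t+k)(\mathbf{z}^{\mathbf r}_v(s+k))^T]$ do not depend on $k$. SII. $\mathbf{r}$ is SII w.r.t. $\boldsymbol{\mu}$ if for all $w\in\Sigma^*$, $t\in\mathbb{Z}$ the random variable $\mathbf{r}(t+|w|)\boldsymbol{\mu}_w(t+|w|-1)\frac{1}{\sqrt{p_w}}$ is square integrable. asLPV-SSA. A stationary autonomous stochastic LPV-SSA (asLPV-SSA),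 written $\mathcal{S}=(\{A_\sigma,K_\sigma\}_{\sigma=1}^{n_\mu},C,F,\mathbf{v})$, is a system $\mathbf{x}(t+1)=\sum_{i=1}^{n_\mu}(A_i\mathbf{x}(t)+K_i\mathbf{v}(t))\boldsymbol{\mu}_i(t)$, $\mathbf{y}(t)=C\mathbf{x}(t)+F\mathbf{v}(t)$, $t\in\mathbb{Z}$, with $A_\sigma\in\mathbb{R}^{n_x\times n_x}$, $K_\sigma\in\mathbb{R}^{n_x\times m}$, $C\in\mathbb{R}^{n_y\times n_x}$, $F\in\mathbb{R}^{n_y\times m}$, state process $\mathbf{x}$, noise process $\mathbf{v}$, output process $\mathbf{y}$, such that (1) $[\mathbf{x}^T,\mathbf{v}^T]^T$ is ZMWSII w.r.t. $\boldsymbol\mu$ and $E[\mathbf{z}^{\mathbf x}_\sigma(t)(\mathbf{z}^{\mathbf v}_\sigma(t))^T]=0$, $E[\mathbf{v}(t)(\mathbf{z}^{\mathbf x}_w(t))^T]=0$ for all $\sigma\in\Sigma$, $w\in\Sigma^+$; (2) $\mathbf{v}$ is ZMWSII w.r.t. $\boldsymbol\mu$ and $E[\mathbf{v}(t)(\mathbf{z}^{\mathbf v}_w(t))^T]=0$ for all $w\in\Sigma^+$; (3) all eigenvalues of $\sum_{\sigma\in\Sigma}p_\sigma A_\sigma\otimes A_\sigma$ are inside the open unit disk. $\mathcal{S}$ is a realization of $(\tilde{\mathbf y},\tilde{\boldsymbol\mu})$ if its output and scheduling processes equal $\tilde{\mathbf y}$ and $\tilde{\boldsymbol\mu}$. The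 dimension of $\mathcal{S}$ is $n_x$; a realization of $(\mathbf{y},\boldsymbol\mu)$ is minimal if no asLPV-SSA realization of $(\mathbf{y},\boldsymbol\mu)$ has smaller dimension. Innovation. $\mathbf{e}(t)=\mathbf{y}(t)-E_l[\mathbf{y}(t)\mid\{\mathbf{z}^{\mathbf y}_w(t)\}_{w\in\Sigma^+}]$, where $E_l[\mathbf{z}\mid\mathfrak{S}]$ is the componentwise orthogonal projection, in the Hilbert space of real square-integrable random variables with inner product $E[\mathbf{z}_1\mathbf{z}_2]$, onto the smallest closed subspace containing all coordinates of the elements of $\mathfrak{S}$. An asLPV-SSA realization of $(\mathbf{y},\boldsymbol\mu)$ is in innovation form if $F=I_{n_y}$ and $\mathbf{v}=\mathbf{e}$. $(\mathbf{y},\boldsymbol\mu)$ is full rank if $Q_i=E[\mathbf{e}(t)(\mathbf{e}(t))^T\boldsymbol{\mu}_i^2(t)]$ is invertible for all $i=1,\dots,n_\mu$. Deterministic systems. A dLPV-SSA $\mathscr{S}=(\{\mathcal{A}_i,\mathcal{B}_i\}_{i=1}^{n_\mu},\mathcal{C},\mathcal{D})$ is a deterministic system $\mathrm{x}(t+1)=\sum_{i=1}^{n_\mu}(\mathcal{A}_i\mathrm{x}(t)+\mathcal{B}_i\mathrm{u}(t))\mu_i(t)$, $\mathrm{y}(t)=\mathcal{C}\mathrm{x}(t)+\mathcal{D}\mathrm{u}(t)$; its dimension is the dimension of its state-space. Its sub-Markov function $M_{\mathscr S}$ on $\Sigma^*$ is $M_{\mathscr S}(\epsilon)=\mathcal{D}$,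 $M_{\mathscr S}(\sigma s)=\mathcal{C}\mathcal{A}_s\mathcal{B}_\sigma$ for $\sigma\in\Sigma$, $s\in\Sigma^*$, where $\mathcal{A}_s=\mathcal{A}_{\sigma_k}\mathcal{A}_{\sigma_{k-1}}\cdots\mathcal{A}_{\sigma_1}$ for $s=\sigma_1\cdots\sigma_k$ and $\mathcal{A}_\epsilon=I$. A dLPV-SSA is minimal if no dLPV-SSA with the same sub-Markov function has smaller dimension. *)

theory Defs
  imports "HOL-Probability.Probability" "Jordan_Normal_Form.Char_Poly"
begin

text \<open>
  Dimensions vary inside the notion of minimality, so vectors and matrices are the
  dimension-carrying ones of \<^theory>\<open>Jordan_Normal_Form.Matrix\<close> (indices start at 0) rather than
  the type-indexed ones of \<^theory>\<open>HOL-Analysis.Finite_Cartesian_Product\<close>.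
  The alphabet is a finite type \<open>'s\<close>, and words are lists over it. Equalities between random
  variables hold almost surely.
\<close>

unbundle no vec_syntax
no_notation inner (infix \<open>\<bullet>\<close> 70)
hide_type (open) Finite_Cartesian_Product.vec
hide_const (open) Finite_Cartesian_Product.vec Finite_Cartesian_Product.mat Determinants.det

type_synonym ('s, 'a) scheduling = "'s \<Rightarrow> int \<Rightarrow> 'a \<Rightarrow> real"
type_synonym 'a vprocess = "int \<Rightarrow> 'a \<Rightarrow> real vec"


subsection \<open>Random variables and generated sigma-algebras\<close>

definition sq_int :: "'a measure \<Rightarrow> ('a \<Rightarrow> real) set" where
  "sq_int M = {f \<in> borel_measurable M. integrable M (\<lambda>\<omega>. (f \<omega>)\<^sup>2)}"

definition vec_process :: "'a measure \<Rightarrow> nat \<Rightarrow> 'a vprocess \<Rightarrow> bool" where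
  "vec_process M n r \<longleftrightarrow>
     (\<forall>t. (\<forall>\<omega>\<in>space M. r t \<omega> \<in> carrier_vec n) \<and>
          (\<forall>i<n. (\<lambda>\<omega>. r t \<omega> $ i) \<in> borel_measurable M))"

definition generated_alg :: "'a measure \<Rightarrow> ('a \<Rightarrow> real) set \<Rightarrow> 'a measure" where
  "generated_alg M Xs = sigma (space M) {X -` B \<inter> space M |X B. X \<in> Xs \<and> B \<in> sets borel}"

definition cond_indep :: "'a measure \<Rightarrow> 'a measure \<Rightarrow> 'a measure \<Rightarrow> 'a measure \<Rightarrow> bool" where
  "cond_indep M F\<^sub>1 F\<^sub>2 G \<longleftrightarrow>
     (\<forall>A\<in>sets F\<^sub>1. \<forall>B\<in>sets F\<^sub>2. AE \<omega> in M.
        real_cond_exp M G (indicator (A \<inter> B)) \<omega>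
          = real_cond_exp M G (indicator A) \<omega> * real_cond_exp M G (indicator B) \<omega>)"

text \<open>The matrix \<open>E[X Y\<^sup>T]\<close> for random vectors of dimensions \<open>n\<close> and \<open>m\<close>.\<close>

definition cross_moment ::
    "'a measure \<Rightarrow> nat \<Rightarrow> nat \<Rightarrow> ('a \<Rightarrow> real vec) \<Rightarrow> ('a \<Rightarrow> real vec) \<Rightarrow> real mat" where
  "cross_moment M n m X Y = mat n m (\<lambda>(i, j). \<integral>\<omega>. X \<omega> $ i * Y \<omega> $ j \<partial>M)"

text \<open>Wide-sense stationarity of the vector process with the given components.\<close>

definition wide_sense_stationary :: "'a measure \<Rightarrow> (int \<Rightarrow> 'a \<Rightarrow> real) set \<Rightarrow> bool" where
  "wide_sense_stationary M Xs \<longleftrightarrow>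
     (\<forall>X\<in>Xs. \<forall>t. X t \<in> sq_int M) \<and>
     (\<forall>X\<in>Xs. \<forall>t k. (\<integral>\<omega>. X (t + k) \<omega> \<partial>M) = (\<integral>\<omega>. X t \<omega> \<partial>M)) \<and>
     (\<forall>X\<in>Xs. \<forall>Y\<in>Xs. \<forall>t s k.
        (\<integral>\<omega>. X (t + k) \<omega> * Y (s + k) \<omega> \<partial>M) = (\<integral>\<omega>. X t \<omega> * Y s \<omega> \<partial>M))"


subsection \<open>Admissible scheduling processes\<close>

definition sched_word :: "('s, 'a) scheduling \<Rightarrow> 's list \<Rightarrow> int \<Rightarrow> 'a \<Rightarrow> real" where
  "sched_word \<mu> w t \<omega> = (\<Prod>i<length w. \<mu> (w ! i) (t - int (length w) + 1 + int i) \<omega>)"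

definition past_alg :: "'a measure \<Rightarrow> ('s, 'a) scheduling \<Rightarrow> int \<Rightarrow> 'a measure" where
  "past_alg M \<mu> t = generated_alg M {\<mu> \<sigma> k |\<sigma> k. k < t}"

definition future_alg :: "'a measure \<Rightarrow> ('s, 'a) scheduling \<Rightarrow> int \<Rightarrow> 'a measure" where
  "future_alg M \<mu> t = generated_alg M {\<mu> \<sigma> k |\<sigma> k. k \<ge> t}"

text \<open>The numbers \<open>p \<sigma>\<close> are an argument of the predicate; admissibility determines them uniquely.\<close>

definition admissible ::
    "'a measure \<Rightarrow> ('s::finite, 'a) scheduling \<Rightarrow> ('s \<Rightarrow> real) \<Rightarrow> bool" where
  "admissible M \<mu> p \<longleftrightarrow>
     (\<forall>\<sigma> t. \<mu> \<sigma> t \<in> borel_measurable M) \<and>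
     (\<forall>\<sigma>. p \<sigma> > 0) \<and>
     (\<forall>w v \<sigma> \<sigma>' t. w \<noteq> [] \<and> v \<noteq> [] \<longrightarrow>
        (AE \<omega> in M. real_cond_exp M (past_alg M \<mu> t)
             (\<lambda>\<omega>. sched_word \<mu> (w @ [\<sigma>]) t \<omega> * sched_word \<mu> (v @ [\<sigma>']) t \<omega>) \<omega>
           = (if \<sigma> = \<sigma>' then p \<sigma> * sched_word \<mu> w (t - 1) \<omega> * sched_word \<mu> v (t - 1) \<omega> else 0))) \<and>
     (\<forall>w \<sigma> \<sigma>' t. w \<noteq> [] \<longrightarrow>
        (AE \<omega> in M. real_cond_exp M (past_alg M \<mu> t)
             (\<lambda>\<omega>. sched_word \<mu> (w @ [\<sigma>]) t \<omega> * \<mu> \<sigma>' t \<omega>) \<omega>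
           = (if \<sigma> = \<sigma>' then p \<sigma> * sched_word \<mu> w (t - 1) \<omega> else 0))) \<and>
     (\<forall>\<sigma> \<sigma>' t. \<sigma> \<noteq> \<sigma>' \<longrightarrow>
        (AE \<omega> in M. real_cond_exp M (past_alg M \<mu> t) (\<lambda>\<omega>. \<mu> \<sigma> t \<omega> * \<mu> \<sigma>' t \<omega>) \<omega> = 0)) \<and>
     (\<exists>\<alpha>. \<forall>t. AE \<omega> in M. (\<Sum>\<sigma>\<in>UNIV. \<alpha> \<sigma> * \<mu> \<sigma> t \<omega>) = 1) \<and>
     (\<forall>w v. w \<noteq> [] \<and> v \<noteq> [] \<longrightarrow>
        wide_sense_stationary M {sched_word \<mu> w, sched_word \<mu> v})"

definition word_weight :: "('s \<Rightarrow> real) \<Rightarrow> 's list \<Rightarrow> real" where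
  "word_weight p w = prod_list (map p w)"


subsection \<open>ZMWSII and SII processes\<close>

definition zproc ::
    "('s, 'a) scheduling \<Rightarrow> ('s \<Rightarrow> real) \<Rightarrow> 'a vprocess \<Rightarrow> 's list \<Rightarrow> 'a vprocess" where
  "zproc \<mu> p r w t \<omega> =
     (sched_word \<mu> w (t - 1) \<omega> * (1 / sqrt (word_weight p w))) \<cdot>\<^sub>v r (t - int (length w)) \<omega>"

definition ZMWSII ::
    "'a measure \<Rightarrow> ('s, 'a) scheduling \<Rightarrow> ('s \<Rightarrow> real) \<Rightarrow> nat \<Rightarrow> 'a vprocess \<Rightarrow> bool" where
  "ZMWSII M \<mu> p n r \<longleftrightarrow>
     vec_process M n r \<and>
     (\<forall>t. cond_indep M (generated_alg M {(\<lambda>\<omega>. r k \<omega> $ i) |k i. k \<le> t \<and> i < n})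
            (future_alg M \<mu> t) (past_alg M \<mu> t)) \<and>
     (\<forall>t. \<forall>i<n. (\<lambda>\<omega>. r t \<omega> $ i) \<in> sq_int M \<and> (\<integral>\<omega>. r t \<omega> $ i \<partial>M) = 0) \<and>
     (\<forall>w t. w \<noteq> [] \<longrightarrow> (\<forall>i<n.
        (\<lambda>\<omega>. zproc \<mu> p r w t \<omega> $ i) \<in> sq_int M \<and> (\<integral>\<omega>. zproc \<mu> p r w t \<omega> $ i \<partial>M) = 0)) \<and>
     (\<forall>t s k w. w \<noteq> [] \<longrightarrow>
        cross_moment M n n (r (t + k)) (zproc \<mu> p r w (s + k))
          = cross_moment M n n (r t) (zproc \<mu> p r w s)) \<and>
     (\<forall>t s k. cross_moment M n n (r (t + k)) (r (s + k)) = cross_moment M n n (r t) (r s)) \<and>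
     (\<forall>t s k w v. w \<noteq> [] \<and> v \<noteq> [] \<longrightarrow>
        cross_moment M n n (zproc \<mu> p r w (t + k)) (zproc \<mu> p r v (s + k))
          = cross_moment M n n (zproc \<mu> p r w t) (zproc \<mu> p r v s))"

text \<open>In contrast to \<^const>\<open>zproc\<close>, the time shift \<open>+ |w|\<close> applies to the process as well.\<close>

definition SII ::
    "'a measure \<Rightarrow> ('s, 'a) scheduling \<Rightarrow> ('s \<Rightarrow> real) \<Rightarrow> nat \<Rightarrow> 'a vprocess \<Rightarrow> bool" where
  "SII M \<mu> p n r \<longleftrightarrow>
     (\<forall>w t. \<forall>i<n.
        (\<lambda>\<omega>. r (t + int (length w)) \<omega> $ i * sched_word \<mu> w (t + int (length w) - 1) \<omega>
               * (1 / sqrt (word_weight p w))) \<in> sq_int M)"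


subsection \<open>Stationary autonomous stochastic LPV-SSA\<close>

definition lpv_carrier ::
    "nat \<Rightarrow> nat \<Rightarrow> nat \<Rightarrow> ('s \<Rightarrow> real mat) \<Rightarrow> ('s \<Rightarrow> real mat) \<Rightarrow> real mat \<Rightarrow> real mat \<Rightarrow> bool" where
  "lpv_carrier nx m ny A B C D \<longleftrightarrow>
     (\<forall>\<sigma>. A \<sigma> \<in> carrier_mat nx nx \<and> B \<sigma> \<in> carrier_mat nx m) \<and>
     C \<in> carrier_mat ny nx \<and> D \<in> carrier_mat ny m"

definition kronecker :: "'b::semiring_0 mat \<Rightarrow> 'b mat \<Rightarrow> 'b mat" (infixl \<open>\<otimes>\<^sub>K\<close> 70) where
  "A \<otimes>\<^sub>K B = mat (dim_row A * dim_row B) (dim_col A * dim_col B)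
     (\<lambda>(i, j). A $$ (i div dim_row B, j div dim_col B) * B $$ (i mod dim_row B, j mod dim_col B))"

definition stability_matrix :: "('s::finite \<Rightarrow> real) \<Rightarrow> nat \<Rightarrow> ('s \<Rightarrow> real mat) \<Rightarrow> real mat" where
  "stability_matrix p nx A =
     mat (nx * nx) (nx * nx) (\<lambda>ij. \<Sum>\<sigma>\<in>UNIV. p \<sigma> * (A \<sigma> \<otimes>\<^sub>K A \<sigma>) $$ ij)"

text \<open>Here \<open>x\<close>, \<open>v\<close> and \<open>y\<close> are the state, noise and output processes, with values in dimensions
  \<open>nx\<close>, \<open>m\<close> and \<open>ny\<close>.\<close>

definition asLPV_SSA ::
    "'a measure \<Rightarrow> ('s::finite, 'a) scheduling \<Rightarrow> ('s \<Rightarrow> real) \<Rightarrow> nat \<Rightarrow> nat \<Rightarrow> nat \<Rightarrow>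
     ('s \<Rightarrow> real mat) \<Rightarrow> ('s \<Rightarrow> real mat) \<Rightarrow> real mat \<Rightarrow> real mat \<Rightarrow>
     'a vprocess \<Rightarrow> 'a vprocess \<Rightarrow> 'a vprocess \<Rightarrow> bool" where
  "asLPV_SSA M \<mu> p nx m ny A K C F v x y \<longleftrightarrow>
     lpv_carrier nx m ny A K C F \<and>
     vec_process M nx x \<and> vec_process M m v \<and> vec_process M ny y \<and>
     (\<forall>t. AE \<omega> in M. x (t + 1) \<omega> =
        vec nx (\<lambda>j. \<Sum>\<sigma>\<in>UNIV. (A \<sigma> *\<^sub>v x t \<omega> + K \<sigma> *\<^sub>v v t \<omega>) $ j * \<mu> \<sigma> t \<omega>)) \<and>
     (\<forall>t. AE \<omega> in M. y t \<omega> = C *\<^sub>v x t \<omega> + F *\<^sub>v v t \<omega>) \<and>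
     ZMWSII M \<mu> p (nx + m) (\<lambda>t \<omega>. x t \<omega> @\<^sub>v v t \<omega>) \<and>
     (\<forall>\<sigma> t. cross_moment M nx m (zproc \<mu> p x [\<sigma>] t) (zproc \<mu> p v [\<sigma>] t) = 0\<^sub>m nx m) \<and>
     (\<forall>w t. w \<noteq> [] \<longrightarrow> cross_moment M m nx (v t) (zproc \<mu> p x w t) = 0\<^sub>m m nx) \<and>
     ZMWSII M \<mu> p m v \<and>
     (\<forall>w t. w \<noteq> [] \<longrightarrow> cross_moment M m m (v t) (zproc \<mu> p v w t) = 0\<^sub>m m m) \<and>
     (\<forall>c. eigenvalue (map_mat complex_of_real (stability_matrix p nx A)) c \<longrightarrow> norm c < 1)"

definition asLPV_realization ::
    "'a measure \<Rightarrow> ('s::finite, 'a) scheduling \<Rightarrow> ('s \<Rightarrow> real) \<Rightarrow> nat \<Rightarrow> 'a vprocess \<Rightarrow>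
     nat \<Rightarrow> nat \<Rightarrow> ('s \<Rightarrow> real mat) \<Rightarrow> ('s \<Rightarrow> real mat) \<Rightarrow> real mat \<Rightarrow> real mat \<Rightarrow>
     'a vprocess \<Rightarrow> bool" where
  "asLPV_realization M \<mu> p ny y nx m A K C F v \<longleftrightarrow>
     (\<exists>x. asLPV_SSA M \<mu> p nx m ny A K C F v x y)"

text \<open>The competing realizations may have a noise process of any dimension.\<close>

definition minimal_asLPV_realization ::
    "'a measure \<Rightarrow> ('s::finite, 'a) scheduling \<Rightarrow> ('s \<Rightarrow> real) \<Rightarrow> nat \<Rightarrow> 'a vprocess \<Rightarrow>
     nat \<Rightarrow> nat \<Rightarrow> ('s \<Rightarrow> real mat) \<Rightarrow> ('s \<Rightarrow> real mat) \<Rightarrow> real mat \<Rightarrow> real mat \<Rightarrow>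
     'a vprocess \<Rightarrow> bool" where
  "minimal_asLPV_realization M \<mu> p ny y nx m A K C F v \<longleftrightarrow>
     asLPV_realization M \<mu> p ny y nx m A K C F v \<and>
     (\<forall>nx' m' A' K' C' F' v'.
        asLPV_realization M \<mu> p ny y nx' m' A' K' C' F' v' \<longrightarrow> nx \<le> nx')"


subsection \<open>Innovation process\<close>

text \<open>Elements of the Hilbert space are represented by functions; closure under limits in mean
  square makes a closed subspace closed under almost sure equality.\<close>

definition closed_sq_subspace :: "'a measure \<Rightarrow> ('a \<Rightarrow> real) set \<Rightarrow> bool" where
  "closed_sq_subspace M V \<longleftrightarrow>
     V \<subseteq> sq_int M \<and>
     (\<lambda>_. 0) \<in> V \<and>
     (\<forall>f\<in>V. \<forall>g\<in>V. (\<lambda>\<omega>. f \<omega> + g \<omega>) \<in> V) \<and>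
     (\<forall>c. \<forall>f\<in>V. (\<lambda>\<omega>. c * f \<omega>) \<in> V) \<and>
     (\<forall>f g. (\<forall>n::nat. f n \<in> V) \<and> g \<in> sq_int M \<and>
            (\<lambda>n. \<integral>\<omega>. (f n \<omega> - g \<omega>)\<^sup>2 \<partial>M) \<longlonglongrightarrow> 0 \<longrightarrow> g \<in> V)"

definition closed_span :: "'a measure \<Rightarrow> ('a \<Rightarrow> real) set \<Rightarrow> ('a \<Rightarrow> real) set" where
  "closed_span M S = \<Inter>{V. closed_sq_subspace M V \<and> S \<subseteq> V}"

definition orth_projection ::
    "'a measure \<Rightarrow> ('a \<Rightarrow> real) set \<Rightarrow> ('a \<Rightarrow> real) \<Rightarrow> ('a \<Rightarrow> real) \<Rightarrow> bool" where
  "orth_projection M V f g \<longleftrightarrow>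
     g \<in> V \<and> (\<forall>h\<in>V. (\<integral>\<omega>. (f \<omega> - g \<omega>) * h \<omega> \<partial>M) = 0)"

text \<open>\<open>e\<close> is (a version of) the innovation process of \<open>y\<close>; it is unique up to almost sure
  equality.\<close>

definition innovation_process ::
    "'a measure \<Rightarrow> ('s, 'a) scheduling \<Rightarrow> ('s \<Rightarrow> real) \<Rightarrow> nat \<Rightarrow> 'a vprocess \<Rightarrow> 'a vprocess \<Rightarrow> bool" where
  "innovation_process M \<mu> p ny y e \<longleftrightarrow>
     vec_process M ny e \<and>
     (\<forall>t. \<forall>i<ny. \<exists>g.
        orth_projection M
          (closed_span M {(\<lambda>\<omega>. zproc \<mu> p y w t \<omega> $ j) |w j. w \<noteq> [] \<and> j < ny})
          (\<lambda>\<omega>. y t \<omega> $ i) g \<and>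
        (AE \<omega> in M. e t \<omega> $ i = y t \<omega> $ i - g \<omega>))"

definition innovation_form ::
    "'a measure \<Rightarrow> ('s::finite, 'a) scheduling \<Rightarrow> ('s \<Rightarrow> real) \<Rightarrow> nat \<Rightarrow> 'a vprocess \<Rightarrow>
     nat \<Rightarrow> nat \<Rightarrow> ('s \<Rightarrow> real mat) \<Rightarrow> ('s \<Rightarrow> real mat) \<Rightarrow> real mat \<Rightarrow> real mat \<Rightarrow>
     'a vprocess \<Rightarrow> bool" where
  "innovation_form M \<mu> p ny y nx m A K C F v \<longleftrightarrow>
     asLPV_realization M \<mu> p ny y nx m A K C F v \<and>
     m = ny \<and> F = 1\<^sub>m ny \<and> innovation_process M \<mu> p ny y v"

definition full_rank ::
    "'a measure \<Rightarrow> ('s, 'a) scheduling \<Rightarrow> ('s \<Rightarrow> real) \<Rightarrow> nat \<Rightarrow> 'a vprocess \<Rightarrow> bool" where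
  "full_rank M \<mu> p ny y \<longleftrightarrow>
     (\<exists>e. innovation_process M \<mu> p ny y e \<and>
        (\<forall>\<sigma> t. invertible_mat
           (mat ny ny (\<lambda>(i, j). \<integral>\<omega>. e t \<omega> $ i * e t \<omega> $ j * (\<mu> \<sigma> t \<omega>)\<^sup>2 \<partial>M))))"


subsection \<open>Deterministic LPV-SSA\<close>

text \<open>The product is in reverse order: \<open>A\<^sub>s = A\<^sub>\<sigma>\<^sub>k \<cdots> A\<^sub>\<sigma>\<^sub>1\<close> for \<open>s = \<sigma>\<^sub>1 \<cdots> \<sigma>\<^sub>k\<close>.\<close>

primrec word_mat :: "nat \<Rightarrow> ('s \<Rightarrow> real mat) \<Rightarrow> 's list \<Rightarrow> real mat" where
  "word_mat nx A [] = 1\<^sub>m nx"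
| "word_mat nx A (\<sigma> # s) = word_mat nx A s * A \<sigma>"

primrec sub_markov ::
    "nat \<Rightarrow> ('s \<Rightarrow> real mat) \<Rightarrow> ('s \<Rightarrow> real mat) \<Rightarrow> real mat \<Rightarrow> real mat \<Rightarrow> 's list \<Rightarrow> real mat" where
  "sub_markov nx A B C D [] = D"
| "sub_markov nx A B C D (\<sigma> # s) = C * word_mat nx A s * B \<sigma>"

definition minimal_dLPV_SSA ::
    "nat \<Rightarrow> nat \<Rightarrow> nat \<Rightarrow> ('s \<Rightarrow> real mat) \<Rightarrow> ('s \<Rightarrow> real mat) \<Rightarrow> real mat \<Rightarrow> real mat \<Rightarrow> bool" where
  "minimal_dLPV_SSA nx m ny A B C D \<longleftrightarrow>
     lpv_carrier nx m ny A B C D \<and>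
     (\<forall>nx' A' B' C' D'.
        lpv_carrier nx' m ny A' B' C' D' \<and>
        sub_markov nx' A' B' C' D' = sub_markov nx A B C D \<longrightarrow> nx \<le> nx')"

end

theory Submission
  imports Defs "Jordan_Normal_Form.Spectral_Radius" "Jordan_Normal_Form.Jordan_Normal_Form_Existence"
begin

text \<open>
  Both sides of the equivalence are governed by the matrices \<open>C A\<^sub>s K\<^sub>\<sigma>\<close>. On the deterministic side they are the
  sub-Markov function. On the stochastic side they are visible in the output: for a realization in innovation form the
  covariance of \<open>y(t)\<close> with \<open>e(t - |w|) \<mu>\<^sub>w(t - 1)\<close>, for \<open>w = \<sigma>s\<close>, is a positive multiple of \<open>C A\<^sub>s K\<^sub>\<sigma> Q\<close> with
  \<open>Q = E[e e\<^sup>T]\<close>, and full rank makes \<open>Q\<close> invertible.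

  The probabilistic tool is one identity: \<open>E[f h \<mu>\<^sub>\<sigma>(t) \<mu>\<^sub>\<tau>(t)]\<close> is \<open>p\<^sub>\<sigma> E[f h]\<close> for \<open>\<sigma> = \<tau>\<close> and \<open>0\<close> otherwise, whenever
  \<open>f\<close> and \<open>h\<close> depend on the history of a ZMWSII process up to time \<open>t\<close> and on the scheduling before \<open>t\<close> (lemma
  \<open>moment\<close>). It follows from conditional independence, since \<open>E[\<mu>\<^sub>\<sigma>(t) \<mu>\<^sub>\<tau>(t)]\<close> conditional
  on the past of the scheduling has the value \<open>p\<^sub>\<sigma>\<close> for \<open>\<sigma> = \<tau>\<close> and \<open>0\<close> otherwise. Hence multiplication by
  \<open>\<mu>\<^sub>\<sigma>(t)\<close> is a multiple of an isometry, it respects closed spans, and moments of the state can be propagated along words.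

  If the deterministic system is minimal, consider any realization of \<open>y\<close>, of dimension \<open>n'\<close>. The innovation lies in
  the closed span of present and past outputs, hence in the span generated by the competing realization
  (\<open>innovation_present\<close>). The covariances above, computed in the competing realization (\<open>output_moment_word\<close>),
  therefore have the form \<open>C' A'\<^sub>u X\<close> with a vector \<open>X\<close> of length \<open>n'\<close> that does not depend on \<open>u\<close>. A minimal system is
  reachable and observable, so its Hankel matrix contains an invertible \<open>n \<times> n\<close> block, and this block factors
  through dimension \<open>n'\<close>. So \<open>n \<le> n'\<close> (\<open>dim_le_of_minimal_dLPV\<close>).

  Conversely, take a deterministic system of least dimension with the sub-Markov function of the given one. Being reachable
  and observable, it satisfies \<open>A'\<^sub>s = U A\<^sub>s W\<close> for all words \<open>s\<close> with fixed matrices \<open>U\<close> and \<open>W\<close>, and so inherits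
  stability. The process \<open>U x\<close> obeys its state equation: \<open>U A\<^sub>\<sigma>\<close> and \<open>A'\<^sub>\<sigma> U\<close> agree on the reachable subspace, and by
  stability the state lies there almost surely (\<open>state_in_reachable_space\<close>). This gives an asLPV-SSA realization with
  that dimension (\<open>realization_of_minimal_dLPV\<close>), so a minimal realization cannot have a larger one.
\<close>

section \<open>Linear algebra of reachability and observability\<close>

text \<open>
  Padded with zeros to square matrices, \<open>L\<close> and \<open>T\<close> would be inverse to each other for \<open>r > n\<close>, although the padded \<open>T\<close>
  has a zero row.
\<close>

lemma dim_le_of_left_inverse:
  fixes L T :: "real mat"
  assumes T: "T \<in> carrier_mat n r" and L: "L \<in> carrier_mat r n" and LT: "L * T = 1\<^sub>m r"
  shows "r \<le> n"
proof (rule ccontr)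
  assume "\<not> r \<le> n"
  hence nr: "n < r" by simp
  define T' where "T' = mat r r (\<lambda>(i, j). if i < n then T $$ (i, j) else 0)"
  define L' where "L' = mat r r (\<lambda>(i, j). if j < n then L $$ (i, j) else 0)"
  have "L' * T' = 1\<^sub>m r"
  proof (rule eq_matI)
    fix i j assume ij: "i < dim_row (1\<^sub>m r :: real mat)" "j < dim_col (1\<^sub>m r :: real mat)"
    have "(L' * T') $$ (i, j) = (\<Sum>k<r. L' $$ (i, k) * T' $$ (k, j))"
      using ij by (simp add: L'_def T'_def scalar_prod_def atLeast0LessThan)
    also have "\<dots> = (\<Sum>k<n. L $$ (i, k) * T $$ (k, j))"
      using ij nr by (intro sum.mono_neutral_cong_right) (auto simp: L'_def T'_def)
    also have "\<dots> = (L * T) $$ (i, j)"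
      using ij T L by (simp add: scalar_prod_def atLeast0LessThan)
    finally show "(L' * T') $$ (i, j) = 1\<^sub>m r $$ (i, j)" using LT by simp
  qed (auto simp: L'_def T'_def)
  hence "T' * L' = 1\<^sub>m r"
    by (intro mat_mult_left_right_inverse[of L' r T']) (auto simp: L'_def T'_def)
  moreover have "(T' * L') $$ (n, n) = 0"
    using nr by (simp add: L'_def T'_def scalar_prod_def)
  ultimately show False using nr by simp
qed

text \<open>
  The columns of \<open>T\<close> are a basis of the span of \<open>F\<close> and \<open>T L\<close> is a projection onto that span. The basis consists of
  members of \<open>F\<close>, so its vectors keep their description by words when \<open>F\<close> is a set of columns of word products. The
  proof takes \<open>r\<close> as large as possible: a vector of \<open>F\<close> moved by \<open>T L\<close> could be added to \<open>T\<close>.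
\<close>

lemma select_basis:
  fixes F :: "real vec set"
  assumes F: "F \<subseteq> carrier_vec n"
  obtains r T L where "r \<le> n" "T \<in> carrier_mat n r" "L \<in> carrier_mat r n" "L * T = 1\<^sub>m r"
    "\<And>k. k < r \<Longrightarrow> col T k \<in> F" "\<And>f. f \<in> F \<Longrightarrow> T *\<^sub>v (L *\<^sub>v f) = f"
proof -
  define P where "P r \<longleftrightarrow> (\<exists>T L. T \<in> carrier_mat n r \<and> L \<in> carrier_mat r n \<and> L * T = 1\<^sub>m r
      \<and> (\<forall>k<r. col T k \<in> F))" for r
  have P0: "P 0" unfolding P_def
    by (intro exI[of _ "0\<^sub>m n 0"] exI[of _ "0\<^sub>m 0 n"]) auto
  have bound: "r \<le> n" if "P r" for r
    using that dim_le_of_left_inverse unfolding P_def by blast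
  obtain r where r: "P r" and max: "\<And>r'. P r' \<Longrightarrow> r' \<le> r"
    using GreatestI_nat[of P 0 n, OF P0] Greatest_le_nat[of P _ n] bound by blast
  from r obtain T L where T: "T \<in> carrier_mat n r" and L: "L \<in> carrier_mat r n"
    and LT: "L * T = 1\<^sub>m r" and colT: "\<And>k. k < r \<Longrightarrow> col T k \<in> F"
    unfolding P_def by blast
  have fix_F: "T *\<^sub>v (L *\<^sub>v f) = f" if f: "f \<in> F" for f
  proof (rule ccontr)
    assume neq: "T *\<^sub>v (L *\<^sub>v f) \<noteq> f"
    have fc: "f \<in> carrier_vec n" using f F by auto
    define E where "E = T * L"
    have E: "E \<in> carrier_mat n n" using T L by (simp add: E_def)
    have Ez: "E *\<^sub>v z = T *\<^sub>v (L *\<^sub>v z)" if "z \<in> carrier_vec n" for z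
      unfolding E_def using that T L by (simp add: assoc_mult_mat_vec)
    define g where "g = f - E *\<^sub>v f"
    have g: "g \<in> carrier_vec n" using fc E by (simp add: g_def)
    have "g \<noteq> 0\<^sub>v n"
    proof
      assume g0: "g = 0\<^sub>v n"
      have "f $ i = (E *\<^sub>v f) $ i" if "i < n" for i
      proof -
        have "g $ i = 0" using g0 that by simp
        thus ?thesis using that E fc by (simp add: g_def)
      qed
      hence "f = E *\<^sub>v f" using fc E by (intro eq_vecI) auto
      thus False using neq Ez[OF fc] by simp
    qed
    hence "\<exists>i<n. g $ i \<noteq> 0" using g by (metis eq_vecI carrier_vecD index_zero_vec(1,2))
    hence gg: "g \<bullet> g \<noteq> 0" using g by (auto simp: scalar_prod_def sum_nonneg_eq_0_iff)
    define c where "c = 1 / (g \<bullet> g)"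
    \<comment> \<open>A functional that vanishes on the columns of \<open>T\<close> and has value \<open>1\<close> at \<open>f\<close>; it is the row that extends \<open>L\<close>.\<close>
    define h where "h = c \<cdot>\<^sub>v (g - transpose_mat E *\<^sub>v g)"
    have h: "h \<in> carrier_vec n" using g E by (simp add: h_def)
    have hz: "h \<bullet> z = c * (g \<bullet> (z - E *\<^sub>v z))" if z: "z \<in> carrier_vec n" for z
    proof -
      have "(transpose_mat E *\<^sub>v g) \<bullet> z = g \<bullet> (E *\<^sub>v z)"
        using transpose_vec_mult_scalar[OF E z g] by simp
      thus ?thesis unfolding h_def using z g E
        by (simp add: minus_scalar_prod_distrib[of _ n] scalar_prod_minus_distrib[of _ n])
    qed
    have hT: "h \<bullet> col T k = 0" if k: "k < r" for k
    proof -
      have ct: "col T k \<in> carrier_vec n" using col_carrier_vec[OF k T] .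
      have "E *\<^sub>v col T k = T *\<^sub>v col (1\<^sub>m r) k"
        unfolding Ez[OF ct] LT[symmetric] col_mult2[OF L T k] ..
      also have "\<dots> = col T k" using col_mult2[OF T one_carrier_mat k] T by simp
      finally have "E *\<^sub>v col T k = col T k" .
      thus ?thesis using hz[OF ct] ct g by simp
    qed
    have hf: "h \<bullet> f = 1" using hz[OF fc] gg by (simp add: g_def[symmetric] c_def)
    define T' where "T' = mat n (Suc r) (\<lambda>(i, j). if j < r then T $$ (i, j) else f $ i)"
    define L' where "L' = mat (Suc r) n
      (\<lambda>(i, j). if i < r then L $$ (i, j) - (L *\<^sub>v f) $ i * h $ j else h $ j)"
    have cT: "col T' j = (if j < r then col T j else f)" if "j < Suc r" for j
      using that T fc by (intro eq_vecI) (auto simp: T'_def)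
    have rL: "row L' i = (if i < r then row L i - (L *\<^sub>v f) $ i \<cdot>\<^sub>v h else h)" if "i < Suc r" for i
      using that L h by (intro eq_vecI) (auto simp: L'_def)
    have "L' * T' = 1\<^sub>m (Suc r)"
    proof (rule eq_matI)
      fix i j assume "i < dim_row (1\<^sub>m (Suc r) :: real mat)" "j < dim_col (1\<^sub>m (Suc r) :: real mat)"
      hence ij: "i < Suc r" "j < Suc r" by auto
      have *: "(L' * T') $$ (i, j) = row L' i \<bullet> col T' j"
        using ij by (simp add: L'_def T'_def)
      have Lij: "row L i \<bullet> col T j = (if i = j then 1 else 0)" if "i < r" "j < r"
        using arg_cong[OF LT, of "\<lambda>X. X $$ (i, j)"] that L T by simp
      have sub: "(row L k - a \<cdot>\<^sub>v h) \<bullet> z = row L k \<bullet> z - a * (h \<bullet> z)" if "z \<in> carrier_vec n" "k < r" for a z k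
        using that L h minus_scalar_prod_distrib[of "row L k" n "a \<cdot>\<^sub>v h" z] by simp
      have Lf: "(L *\<^sub>v f) $ k = row L k \<bullet> f" if "k < r" for k using L that by simp
      have cc: "col T j \<in> carrier_vec n" by (rule carrier_vecI) (use T in simp)
      show "(L' * T') $$ (i, j) = 1\<^sub>m (Suc r) $$ (i, j)"
        using ij Lij cc fc hT hf by (auto simp: * rL cT sub Lf less_Suc_eq)
    qed (auto simp: L'_def T'_def)
    moreover have "\<forall>k<Suc r. col T' k \<in> F" using colT f by (auto simp: cT)
    ultimately have "P (Suc r)" unfolding P_def
      by (intro exI[of _ T'] exI[of _ L']) (auto simp: L'_def T'_def)
    thus False using max by fastforce
  qed
  show ?thesis using that[OF bound[OF r] T L LT colT fix_F] .
qed

lemma word_mat_carrier [simp]: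
  assumes "\<And>\<sigma>. A \<sigma> \<in> carrier_mat n n"
  shows "word_mat n A s \<in> carrier_mat n n"
  by (induction s) (use assms in \<open>auto simp: mult_carrier_mat[of _ n n]\<close>)

lemma word_mat_append:
  assumes A: "\<And>\<sigma>. A \<sigma> \<in> carrier_mat n n"
  shows "word_mat n A (s @ t) = word_mat n A t * word_mat n A s"
proof (induction s)
  case Nil
  show ?case using right_mult_one_mat[OF word_mat_carrier[of A n t]] A by simp
next
  case (Cons a s)
  thus ?case using A by (simp add: assoc_mult_mat[of _ n n _ n _ n])
qed

text \<open>
  Restriction of the system to an invariant subspace, the range of \<open>T\<close>, that contains the ranges of all \<open>B \<sigma>\<close>.
\<close>

lemma sub_markov_compress_reachable:
  assumes T: "T \<in> carrier_mat n r" and L: "L \<in> carrier_mat r n"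
    and car: "lpv_carrier n m ny A B C D"
    and inv: "\<And>\<sigma>. T * (L * A \<sigma> * T) = A \<sigma> * T" "\<And>\<sigma>. T * (L * B \<sigma>) = B \<sigma>"
  shows "sub_markov r (\<lambda>\<sigma>. L * A \<sigma> * T) (\<lambda>\<sigma>. L * B \<sigma>) (C * T) D = sub_markov n A B C D"
proof
  fix w
  have A: "\<And>\<sigma>. A \<sigma> \<in> carrier_mat n n" and B: "\<And>\<sigma>. B \<sigma> \<in> carrier_mat n m"
    and C: "C \<in> carrier_mat ny n" using car by (auto simp: lpv_carrier_def)
  let ?A = "\<lambda>\<sigma>. L * A \<sigma> * T"
  have A': "?A \<sigma> \<in> carrier_mat r r" for \<sigma> using T L A by (meson mult_carrier_mat)
  have W: "word_mat r ?A s \<in> carrier_mat r r" for s using word_mat_carrier[of ?A r s] A' by simp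
  have W': "word_mat n A s \<in> carrier_mat n n" for s using word_mat_carrier[of A n s] A by simp
  have TW: "T * word_mat r ?A s = word_mat n A s * T" for s
  proof (induction s)
    case Nil show ?case using T by simp
  next
    case (Cons a s)
    have "T * word_mat r ?A (a # s) = (T * word_mat r ?A s) * ?A a"
      using T W[of s] A'[of a] by simp
    also have "\<dots> = word_mat n A s * (T * ?A a)" unfolding Cons
      using W'[of s] T A'[of a] by simp
    also have "\<dots> = word_mat n A s * A a * T" unfolding inv using W'[of s] T A[of a] by simp
    finally show ?case by simp
  qed
  show "sub_markov r ?A (\<lambda>\<sigma>. L * B \<sigma>) (C * T) D w = sub_markov n A B C D w"
  proof (cases w)
    case (Cons a s)
    have LB: "L * B a \<in> carrier_mat r m" using L B by simp
    have "C * T * word_mat r ?A s * (L * B a) = C * (T * word_mat r ?A s) * (L * B a)"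
      using C T W[of s] by simp
    also have "\<dots> = C * word_mat n A s * (T * (L * B a))" unfolding TW
      using C T W'[of s] LB by (simp add: assoc_mult_mat[of _ ny n _ n _ r] assoc_mult_mat[of _ ny n _ r _ m] assoc_mult_mat[of _ n n _ r _ m] assoc_mult_mat[of _ ny n _ n _ m])
    finally show ?thesis using Cons inv by simp
  qed simp
qed

text \<open>
  The quotient of the system by an invariant subspace, the kernel of \<open>L\<close>, on which \<open>C\<close> vanishes.
\<close>

lemma sub_markov_compress_observable:
  assumes T: "T \<in> carrier_mat n r" and L: "L \<in> carrier_mat r n"
    and car: "lpv_carrier n m ny A B C D"
    and inv: "\<And>\<sigma>. (L * A \<sigma> * T) * L = L * A \<sigma>" "(C * T) * L = C"
  shows "sub_markov r (\<lambda>\<sigma>. L * A \<sigma> * T) (\<lambda>\<sigma>. L * B \<sigma>) (C * T) D = sub_markov n A B C D"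
proof
  fix w
  have A: "\<And>\<sigma>. A \<sigma> \<in> carrier_mat n n" and B: "\<And>\<sigma>. B \<sigma> \<in> carrier_mat n m"
    and C: "C \<in> carrier_mat ny n" using car by (auto simp: lpv_carrier_def)
  let ?A = "\<lambda>\<sigma>. L * A \<sigma> * T"
  have A': "?A \<sigma> \<in> carrier_mat r r" for \<sigma> using T L A by (meson mult_carrier_mat)
  have W: "word_mat r ?A s \<in> carrier_mat r r" for s using word_mat_carrier[of ?A r s] A' by simp
  have W': "word_mat n A s \<in> carrier_mat n n" for s using word_mat_carrier[of A n s] A by simp
  have LW: "word_mat r ?A s * L = L * word_mat n A s" for s
  proof (induction s)
    case Nil show ?case using L by simp
  next
    case (Cons a s)
    have "word_mat r ?A (a # s) * L = word_mat r ?A s * (?A a * L)"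
      using L W[of s] A'[of a] by simp
    also have "\<dots> = (word_mat r ?A s * L) * A a" unfolding inv
      using W[of s] L A[of a] by simp
    also have "\<dots> = L * (word_mat n A s * A a)" unfolding Cons using W'[of s] L A[of a] by simp
    finally show ?case by simp
  qed
  show "sub_markov r ?A (\<lambda>\<sigma>. L * B \<sigma>) (C * T) D w = sub_markov n A B C D w"
  proof (cases w)
    case (Cons a s)
    have CT: "C * T \<in> carrier_mat ny r" using C T by simp
    have "C * T * word_mat r ?A s * (L * B a) = C * T * (word_mat r ?A s * L) * B a"
      using CT W[of s] L B[of a] by (simp add: assoc_mult_mat[of _ ny r _ r _ m] assoc_mult_mat[of _ r r _ n _ m] assoc_mult_mat[of _ ny r _ r _ n] assoc_mult_mat[of _ ny r _ n _ m])
    also have "\<dots> = (C * T * L) * word_mat n A s * B a" unfolding LW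
      using CT W'[of s] L B[of a] by simp
    finally show ?thesis using Cons inv by simp
  qed simp
qed

text \<open>
  If the columns of the matrices \<open>A\<^sub>s B\<^sub>\<sigma>\<close> spanned a proper subspace, the system could be restricted to it. The lemma
  returns the words, letters and indices of a basis among these columns: the same selection can then be made in another
  system and compared entry by entry.
\<close>

lemma minimal_dLPV_reachable:
  assumes min: "minimal_dLPV_SSA n m ny A B C D"
  obtains T Ti and sg :: "nat \<Rightarrow> 's" and wd :: "nat \<Rightarrow> 's list" and ix :: "nat \<Rightarrow> nat"
  where "T \<in> carrier_mat n n" "Ti \<in> carrier_mat n n" "T * Ti = 1\<^sub>m n"
    "\<And>k. k < n \<Longrightarrow> ix k < m"
    "\<And>k. k < n \<Longrightarrow> col T k = col (word_mat n A (wd k) * B (sg k)) (ix k)"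
proof -
  have car: "lpv_carrier n m ny A B C D" using min by (simp add: minimal_dLPV_SSA_def)
  have A: "\<And>\<sigma>. A \<sigma> \<in> carrier_mat n n" and B: "\<And>\<sigma>. B \<sigma> \<in> carrier_mat n m"
    and C: "C \<in> carrier_mat ny n" and D: "D \<in> carrier_mat ny m" using car by (auto simp: lpv_carrier_def)
  have W: "word_mat n A s \<in> carrier_mat n n" for s using word_mat_carrier[of A n s] A by simp
  have WB: "word_mat n A s * B \<sigma> \<in> carrier_mat n m" for s \<sigma> using W[of s] B[of \<sigma>] by simp
  define F where "F = {col (word_mat n A s * B \<sigma>) j |s \<sigma> j. j < m}"
  have "F \<subseteq> carrier_vec n" unfolding F_def using WB col_carrier_vec by blast
  then obtain r T L where r: "r \<le> n" and T: "T \<in> carrier_mat n r" and L: "L \<in> carrier_mat r n"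
    and LT: "L * T = 1\<^sub>m r" and colT: "\<And>k. k < r \<Longrightarrow> col T k \<in> F"
    and fixF: "\<And>f. f \<in> F \<Longrightarrow> T *\<^sub>v (L *\<^sub>v f) = f"
    by (rule select_basis) blast
  have fixM: "T * (L * X) = X" if X: "X \<in> carrier_mat n q" and c: "\<And>j. j < q \<Longrightarrow> col X j \<in> F" for X q
  proof (rule eq_matI)
    fix i j assume ij: "i < dim_row X" "j < dim_col X"
    have "col (L * X) j = L *\<^sub>v col X j" using ij X by (intro col_mult2[OF L X]) auto
    moreover have "col (T * (L * X)) j = T *\<^sub>v col (L * X) j"
      using ij X L by (intro col_mult2[OF T]) auto
    ultimately have "col (T * (L * X)) j = T *\<^sub>v (L *\<^sub>v col X j)" by simp
    also have "\<dots> = col X j" using fixF[OF c] ij X by simp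
    finally have "col (T * (L * X)) j $ i = col X j $ i" by simp
    thus "(T * (L * X)) $$ (i, j) = X $$ (i, j)" using ij X T L by simp
  qed (use X T L in auto)
  have inv2: "T * (L * B \<sigma>) = B \<sigma>" for \<sigma>
  proof (rule fixM[OF B])
    fix j assume "j < m"
    moreover have "word_mat n A [] * B \<sigma> = B \<sigma>" using B[of \<sigma>] by simp
    ultimately show "col (B \<sigma>) j \<in> F" unfolding F_def by (metis (mono_tags, lifting) mem_Collect_eq)
  qed
  have AF: "A \<sigma> *\<^sub>v f \<in> F" if f: "f \<in> F" for f \<sigma>
  proof -
    obtain s \<tau> j where f': "f = col (word_mat n A s * B \<tau>) j" "j < m" using f by (auto simp: F_def)
    have "A \<sigma> *\<^sub>v f = col (A \<sigma> * (word_mat n A s * B \<tau>)) j"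
      unfolding f' using f'(2) A WB by (simp add: col_mult2[of _ n n _ m])
    also have "A \<sigma> * (word_mat n A s * B \<tau>) = word_mat n A (s @ [\<sigma>]) * B \<tau>"
      using A[of \<sigma>] W[of s] B[of \<tau>] by (simp add: word_mat_append[of A n, OF A])
    finally show ?thesis using f' unfolding F_def by blast
  qed
  have inv1: "T * (L * A \<sigma> * T) = A \<sigma> * T" for \<sigma>
  proof -
    have "T * (L * (A \<sigma> * T)) = A \<sigma> * T"
    proof (rule fixM)
      show "A \<sigma> * T \<in> carrier_mat n r" by (rule mult_carrier_mat[OF A T])
      fix j assume "j < r"
      thus "col (A \<sigma> * T) j \<in> F" using AF[OF colT] A T by (simp add: col_mult2[of _ n n _ r])
    qed
    thus ?thesis using L A[of \<sigma>] T by simp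
  qed
  have "lpv_carrier r m ny (\<lambda>\<sigma>. L * A \<sigma> * T) (\<lambda>\<sigma>. L * B \<sigma>) (C * T) D"
    unfolding lpv_carrier_def using A B C D T L by (auto intro!: mult_carrier_mat)
  hence "n \<le> r"
    using min sub_markov_compress_reachable[OF T L car inv1 inv2] unfolding minimal_dLPV_SSA_def by blast
  hence rn: "r = n" using r by simp
  have "\<forall>k. \<exists>s \<sigma> j. k < n \<longrightarrow> j < m \<and> col T k = col (word_mat n A s * B \<sigma>) j"
    using colT rn unfolding F_def by blast
  then obtain wd sg ix where "\<And>k. k < n \<Longrightarrow> ix k < m \<and> col T k = col (word_mat n A (wd k) * B (sg k)) (ix k)"
    by metis
  moreover have "T * L = 1\<^sub>m n" using mat_mult_left_right_inverse[of L n T] L T LT rn by simp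
  ultimately show ?thesis using that[of T L ix wd sg] T L rn by simp
qed

text \<open>
  The dual statement: were the rows of the matrices \<open>C A\<^sub>s\<close> to span a proper subspace, the quotient by their common
  kernel would be a smaller system.
\<close>

lemma minimal_dLPV_observable:
  assumes min: "minimal_dLPV_SSA n m ny A B C D"
  obtains P Pi and wd :: "nat \<Rightarrow> 's list" and ix :: "nat \<Rightarrow> nat"
  where "P \<in> carrier_mat n n" "Pi \<in> carrier_mat n n" "Pi * P = 1\<^sub>m n"
    "\<And>k. k < n \<Longrightarrow> ix k < ny"
    "\<And>k. k < n \<Longrightarrow> row P k = row (C * word_mat n A (wd k)) (ix k)"
proof -
  have car: "lpv_carrier n m ny A B C D" using min by (simp add: minimal_dLPV_SSA_def)
  have A: "\<And>\<sigma>. A \<sigma> \<in> carrier_mat n n" and B: "\<And>\<sigma>. B \<sigma> \<in> carrier_mat n m"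
    and C: "C \<in> carrier_mat ny n" and D: "D \<in> carrier_mat ny m" using car by (auto simp: lpv_carrier_def)
  have W: "word_mat n A s \<in> carrier_mat n n" for s using word_mat_carrier[of A n s] A by simp
  have CW: "C * word_mat n A s \<in> carrier_mat ny n" for s using W[of s] C by simp
  define F where "F = {row (C * word_mat n A s) i |s i. i < ny}"
  have "F \<subseteq> carrier_vec n" unfolding F_def using CW row_carrier_vec by blast
  then obtain r P' L' where r: "r \<le> n" and P': "P' \<in> carrier_mat n r" and L': "L' \<in> carrier_mat r n"
    and LP': "L' * P' = 1\<^sub>m r" and colP': "\<And>k. k < r \<Longrightarrow> col P' k \<in> F"
    and fixF: "\<And>f. f \<in> F \<Longrightarrow> P' *\<^sub>v (L' *\<^sub>v f) = f"
    by (rule select_basis) blast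
  define L where "L = transpose_mat P'"
  define T where "T = transpose_mat L'"
  have L: "L \<in> carrier_mat r n" and T: "T \<in> carrier_mat n r" using P' L' by (auto simp: L_def T_def)
  have LT: "L * T = 1\<^sub>m r"
    unfolding L_def T_def using transpose_mult[OF L' P'] LP' by simp
  have rowL: "row L k \<in> F" if "k < r" for k using colP'[OF that] that P' by (simp add: L_def)
  have fixM: "(X * T) * L = X" if X: "X \<in> carrier_mat q n" and c: "\<And>j. j < q \<Longrightarrow> row X j \<in> F" for X q
  proof -
    have "P' * (L' * transpose_mat X) = transpose_mat X"
    proof (rule eq_matI)
      fix i j assume ij: "i < dim_row (transpose_mat X)" "j < dim_col (transpose_mat X)"
      have Xt: "transpose_mat X \<in> carrier_mat n q" using X by simp
      have "col (L' * transpose_mat X) j = L' *\<^sub>v col (transpose_mat X) j"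
        using ij X by (intro col_mult2[OF L' Xt]) auto
      moreover have "col (P' * (L' * transpose_mat X)) j = P' *\<^sub>v col (L' * transpose_mat X) j"
        using ij X L' by (intro col_mult2[OF P']) auto
      ultimately have "col (P' * (L' * transpose_mat X)) j = P' *\<^sub>v (L' *\<^sub>v col (transpose_mat X) j)"
        by simp
      also have "\<dots> = col (transpose_mat X) j" using fixF[OF c] ij X by simp
      finally have "col (P' * (L' * transpose_mat X)) j $ i = col (transpose_mat X) j $ i" by simp
      thus "(P' * (L' * transpose_mat X)) $$ (i, j) = transpose_mat X $$ (i, j)" using ij X P' L' by simp
    qed (use X P' L' in auto)
    moreover have "P' * (L' * transpose_mat X) = transpose_mat ((X * T) * L)"
    proof -
      have "transpose_mat ((X * T) * L) = transpose_mat L * transpose_mat (X * T)"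
        using X T L by (intro transpose_mult[of _ q r _ n]) auto
      also have "transpose_mat (X * T) = transpose_mat T * transpose_mat X"
        using X T by (intro transpose_mult[of _ q n _ r]) auto
      finally show ?thesis by (simp add: L_def T_def)
    qed
    ultimately show ?thesis using transpose_transpose by metis
  qed
  have inv2: "(C * T) * L = C"
  proof (rule fixM[OF C])
    fix j assume "j < ny"
    moreover have "C * word_mat n A [] = C" using C by simp
    ultimately show "row C j \<in> F" unfolding F_def by (metis (mono_tags, lifting) mem_Collect_eq)
  qed
  have inv1: "(L * A \<sigma> * T) * L = L * A \<sigma>" for \<sigma>
  proof (rule fixM)
    show "L * A \<sigma> \<in> carrier_mat r n" using A L by simp
    fix k assume k: "k < r"
    obtain s i where f': "row L k = row (C * word_mat n A s) i" "i < ny"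
      using rowL[OF k] by (auto simp: F_def)
    have "row (L * A \<sigma>) k = row (C * word_mat n A s * A \<sigma>) i"
      using k f' L A[of \<sigma>] CW[of s] by (intro eq_vecI) auto
    also have "C * word_mat n A s * A \<sigma> = C * word_mat n A (\<sigma> # s)"
      using A[of \<sigma>] W[of s] C by simp
    finally show "row (L * A \<sigma>) k \<in> F" using f' unfolding F_def by blast
  qed
  have "lpv_carrier r m ny (\<lambda>\<sigma>. L * A \<sigma> * T) (\<lambda>\<sigma>. L * B \<sigma>) (C * T) D"
    unfolding lpv_carrier_def using A B C D T L by (auto intro!: mult_carrier_mat)
  hence "n \<le> r"
    using min sub_markov_compress_observable[OF T L car inv1 inv2] unfolding minimal_dLPV_SSA_def by blast
  hence rn: "r = n" using r by simp
  have "\<forall>k. \<exists>s j. k < n \<longrightarrow> j < ny \<and> row L k = row (C * word_mat n A s) j"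
    using rowL rn unfolding F_def by blast
  then obtain wd ix where "\<And>k. k < n \<Longrightarrow> ix k < ny \<and> row L k = row (C * word_mat n A (wd k)) (ix k)"
    by metis
  moreover have "T * L = 1\<^sub>m n" using mat_mult_left_right_inverse[of L n T] L T LT rn by simp
  ultimately show ?thesis using that[of L T ix wd] T L rn by simp
qed

section \<open>Stability in terms of word products\<close>

lemma sum_lessThan_square:
  fixes f :: "nat \<Rightarrow> 'b::comm_monoid_add"
  shows "(\<Sum>a<n * n. f a) = (\<Sum>i<n. \<Sum>j<n. f (i * n + j))"
proof -
  have "sum f {i * n..<i * n + n} = (\<Sum>j<n. f (i * n + j))" for i
    by (subst sum.atLeastLessThan_shift_0) (simp add: atLeast0LessThan comp_def)
  thus ?thesis by (simp add: sum.nat_group[symmetric])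
qed

lemma stability_matrix_carrier [simp]: "stability_matrix p n A \<in> carrier_mat (n * n) (n * n)"
  by (simp add: stability_matrix_def)

lemma pair_index_less: "i < n \<Longrightarrow> j < n \<Longrightarrow> i * n + j < n * (n::nat)"
proof -
  assume "i < n" "j < n"
  hence "i * n + j < Suc i * n" by simp
  also have "\<dots> \<le> n * n" using \<open>i < n\<close> by (intro mult_le_mono1) simp
  finally show ?thesis .
qed

lemma stability_matrix_entry:
  assumes A: "\<And>\<sigma>. A \<sigma> \<in> carrier_mat n n" and ij: "i < n" "j < n" "k < n" "l < n"
  shows "stability_matrix p n A $$ (i * n + j, k * n + l) = (\<Sum>\<sigma>\<in>UNIV. p \<sigma> * A \<sigma> $$ (i, k) * A \<sigma> $$ (j, l))"
proof -
  have "i * n + j < n * n" "k * n + l < n * n" using ij by (auto intro: pair_index_less)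
  moreover have "(A \<sigma> \<otimes>\<^sub>K A \<sigma>) $$ (i * n + j, k * n + l) = A \<sigma> $$ (i, k) * A \<sigma> $$ (j, l)" for \<sigma>
    using A[of \<sigma>] ij calculation by (simp add: kronecker_def)
  ultimately show ?thesis by (simp add: stability_matrix_def mult.assoc)
qed

lemma sum_words_Suc:
  fixes f :: "'s::finite list \<Rightarrow> 'b::comm_monoid_add"
  shows "(\<Sum>w | length w = Suc N. f w) = (\<Sum>\<sigma>\<in>UNIV. \<Sum>w | length w = N. f (\<sigma> # w))"
proof -
  have "(\<Sum>w | length w = Suc N. f w) = (\<Sum>(\<sigma>, w)\<in>UNIV \<times> {w. length w = N}. f (\<sigma> # w))"
    by (rule sum.reindex_bij_witness[of _ "\<lambda>(\<sigma>, w). \<sigma> # w" "\<lambda>w. (hd w, tl w)"])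
       (auto simp: length_Suc_conv)
  thus ?thesis by (simp add: sum.cartesian_product)
qed

lemma sum_swap_pairs:
  fixes g :: "_ \<Rightarrow> _ \<Rightarrow> _ \<Rightarrow> _ \<Rightarrow> 'b::comm_monoid_add"
  shows "(\<Sum>a\<in>A. \<Sum>b\<in>B. \<Sum>c\<in>C. \<Sum>d\<in>D. g a b c d) = (\<Sum>c\<in>C. \<Sum>d\<in>D. \<Sum>a\<in>A. \<Sum>b\<in>B. g a b c d)"
proof -
  have "(\<Sum>x\<in>A \<times> B. \<Sum>y\<in>C \<times> D. g (fst x) (snd x) (fst y) (snd y))
      = (\<Sum>y\<in>C \<times> D. \<Sum>x\<in>A \<times> B. g (fst x) (snd x) (fst y) (snd y))" by (rule sum.swap)
  thus ?thesis unfolding sum.cartesian_product' by simp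
qed

text \<open>
  Kronecker products multiply factor by factor, so the \<open>N\<close>-th power is the sum of \<open>p\<^sub>w A\<^sub>w \<otimes> A\<^sub>w\<close> over the words of
  length \<open>N\<close>.
\<close>

lemma stability_matrix_power:
  assumes A: "\<And>\<sigma>. A \<sigma> \<in> carrier_mat n n" and ij: "i < n" "j < n"
  shows "k < n \<Longrightarrow> l < n \<Longrightarrow> (stability_matrix p n A ^\<^sub>m N) $$ (i * n + j, k * n + l)
    = (\<Sum>w | length w = N. word_weight p w * word_mat n A w $$ (i, k) * word_mat n A w $$ (j, l))"
proof (induction N arbitrary: k l)
  case 0
  have "i * n + j = k * n + l \<longleftrightarrow> i = k \<and> j = l"
  proof
    assume eq: "i * n + j = k * n + l"
    have "(i * n + j) div n = i" "(k * n + l) div n = k" "(i * n + j) mod n = j" "(k * n + l) mod n = l"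
      using ij 0 by auto
    thus "i = k \<and> j = l" unfolding eq by simp
  qed auto
  moreover have "{w :: 's list. w = []} = {[]}" by auto
  ultimately show ?case using ij 0 pair_index_less[of i n j] pair_index_less[of k n l]
    by (auto simp: word_weight_def stability_matrix_def)
next
  case (Suc N)
  let ?S = "stability_matrix p n A"
  let ?W = "word_mat n A"
  have W: "?W s \<in> carrier_mat n n" for s using word_mat_carrier[of A n s] A by simp
  have SN: "?S ^\<^sub>m N \<in> carrier_mat (n * n) (n * n)" by (rule pow_carrier_mat) simp
  have "(?S ^\<^sub>m Suc N) $$ (i * n + j, k * n + l)
      = (\<Sum>a<n * n. (?S ^\<^sub>m N) $$ (i * n + j, a) * ?S $$ (a, k * n + l))"
    using SN ij Suc.prems pair_index_less[of i n j] pair_index_less[of k n l] stability_matrix_carrier[of p n A]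
    by (simp add: scalar_prod_def atLeast0LessThan del: stability_matrix_carrier)
  also have "\<dots> = (\<Sum>i'<n. \<Sum>j'<n. (?S ^\<^sub>m N) $$ (i * n + j, i' * n + j') * ?S $$ (i' * n + j', k * n + l))"
    by (rule sum_lessThan_square)
  also have "\<dots> = (\<Sum>i'<n. \<Sum>j'<n. (\<Sum>w | length w = N. word_weight p w * ?W w $$ (i, i') * ?W w $$ (j, j'))
       * (\<Sum>\<sigma>\<in>UNIV. p \<sigma> * A \<sigma> $$ (i', k) * A \<sigma> $$ (j', l)))"
    using Suc by (intro sum.cong refl arg_cong2[where f = times] Suc.IH stability_matrix_entry[OF A]) auto
  also have "\<dots> = (\<Sum>i'<n. \<Sum>j'<n. \<Sum>\<sigma>\<in>UNIV. \<Sum>w | length w = N.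
       word_weight p (\<sigma> # w) * ((?W w $$ (i, i') * A \<sigma> $$ (i', k)) * (?W w $$ (j, j') * A \<sigma> $$ (j', l))))"
    by (subst sum_product, subst sum.swap) (simp add: word_weight_def algebra_simps)
  also have "\<dots> = (\<Sum>\<sigma>\<in>UNIV. \<Sum>w | length w = N. \<Sum>i'<n. \<Sum>j'<n.
       word_weight p (\<sigma> # w) * ((?W w $$ (i, i') * A \<sigma> $$ (i', k)) * (?W w $$ (j, j') * A \<sigma> $$ (j', l))))"
    by (rule sum_swap_pairs)
  also have "\<dots> = (\<Sum>\<sigma>\<in>UNIV. \<Sum>w | length w = N. word_weight p (\<sigma> # w) *
       (\<Sum>i'<n. ?W w $$ (i, i') * A \<sigma> $$ (i', k)) * (\<Sum>j'<n. ?W w $$ (j, j') * A \<sigma> $$ (j', l)))"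
    by (simp only: mult.assoc[of "word_weight _ _"] sum_product) (simp only: sum_distrib_left)
  also have "\<dots> = (\<Sum>\<sigma>\<in>UNIV. \<Sum>w | length w = N. word_weight p (\<sigma> # w) *
       ?W (\<sigma> # w) $$ (i, k) * ?W (\<sigma> # w) $$ (j, l))"
  proof (intro sum.cong refl, goal_cases)
    case (1 \<sigma> w)
    have "?W (\<sigma> # w) $$ (a, b) = (\<Sum>i'<n. ?W w $$ (a, i') * A \<sigma> $$ (i', b))" if "a < n" "b < n" for a b
      using that W[of w] A[of \<sigma>] by (simp add: scalar_prod_def atLeast0LessThan)
    thus ?case using ij Suc.prems by simp
  qed
  also have "\<dots> = (\<Sum>w | length w = Suc N. word_weight p w * ?W w $$ (i, k) * ?W w $$ (j, l))"
    by (rule sum_words_Suc[symmetric])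
  finally show ?case .
qed

text \<open>
  Matrices with spectral radius below \<open>1\<close> have bounded powers by the Jordan normal form. Applied to \<open>S / q\<close>, with \<open>q\<close>
  between the spectral radius and \<open>1\<close>, this bounds the powers of \<open>S\<close> by a geometric sequence.
\<close>

lemma power_tendsto_0_of_eigenvalues:
  fixes S :: "complex mat"
  assumes S: "S \<in> carrier_mat N N" and ev: "\<And>c. eigenvalue S c \<Longrightarrow> norm c < 1"
    and ab: "a < N" "b < N"
  shows "(\<lambda>k. (S ^\<^sub>m k) $$ (a, b)) \<longlonglongrightarrow> 0"
proof -
  have N: "N > 0" using ab by simp
  have "spectral_radius S \<in> norm ` spectrum S" by (rule spectral_radius_mem_max(1)[OF S N])
  hence \<rho>1: "spectral_radius S < 1" and \<rho>0: "spectral_radius S \<ge> 0" using ev by (auto simp: spectrum_def)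
  obtain q where q: "spectral_radius S < q" "q < 1" using dense[OF \<rho>1] by blast
  have q0: "q > 0" using q \<rho>0 by simp
  define c where "c = complex_of_real (1 / q)"
  have c0: "c \<noteq> 0" using q0 by (simp add: c_def)
  have cS: "c \<cdot>\<^sub>m S \<in> carrier_mat N N" using S by simp
  have pow: "(c \<cdot>\<^sub>m S) ^\<^sub>m k = c ^ k \<cdot>\<^sub>m (S ^\<^sub>m k)" for k
  proof (induction k)
    case 0 show ?case using S by (intro eq_matI) auto
  next
    case (Suc k)
    have Sk: "S ^\<^sub>m k \<in> carrier_mat N N" using S by simp
    have "(c \<cdot>\<^sub>m S) ^\<^sub>m Suc k = (c ^ k \<cdot>\<^sub>m (S ^\<^sub>m k)) * (c \<cdot>\<^sub>m S)" using Suc by simp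
    also have "\<dots> = c ^ k \<cdot>\<^sub>m ((S ^\<^sub>m k) * (c \<cdot>\<^sub>m S))" using Sk S by (intro mult_smult_assoc_mat) auto
    also have "(S ^\<^sub>m k) * (c \<cdot>\<^sub>m S) = c \<cdot>\<^sub>m ((S ^\<^sub>m k) * S)" using Sk S by (intro mult_smult_distrib) auto
    finally show ?case using Sk S by (intro eq_matI) auto
  qed
  have "spectral_radius (c \<cdot>\<^sub>m S) \<in> norm ` spectrum (c \<cdot>\<^sub>m S)" by (rule spectral_radius_mem_max(1)[OF cS N])
  then obtain d where d: "eigenvalue (c \<cdot>\<^sub>m S) d" "spectral_radius (c \<cdot>\<^sub>m S) = norm d" by (auto simp: spectrum_def)
  then obtain z where z: "z \<in> carrier_vec N" "z \<noteq> 0\<^sub>v N" "(c \<cdot>\<^sub>m S) *\<^sub>v z = d \<cdot>\<^sub>v z"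
    using S by (auto simp: eigenvalue_def eigenvector_def)
  have "S *\<^sub>v z = (d / c) \<cdot>\<^sub>v z"
  proof (rule eq_vecI)
    fix i assume "i < dim_vec ((d / c) \<cdot>\<^sub>v z)"
    hence i: "i < N" using z by simp
    have "c * (S *\<^sub>v z) $ i = d * z $ i"
      using arg_cong[OF z(3), of "\<lambda>v. v $ i"] i S z(1) by simp
    thus "(S *\<^sub>v z) $ i = ((d / c) \<cdot>\<^sub>v z) $ i" using i z(1) c0 by (simp add: field_simps)
  qed (use S z in simp)
  hence "eigenvalue S (d / c)" using z S unfolding eigenvalue_def eigenvector_def by auto
  hence "norm (d / c) \<in> norm ` spectrum S" by (auto simp: spectrum_def)
  hence "norm (d / c) \<le> spectral_radius S" by (rule spectral_radius_mem_max(2)[OF S N])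
  moreover have "norm (d / c) = norm d * q" using q0 by (simp add: c_def norm_divide norm_mult)
  ultimately have "norm d * q < 1 * q" using q by linarith
  hence "norm d < 1" using q0 by (simp only: mult_less_cancel_right_pos)
  hence "spectral_radius (c \<cdot>\<^sub>m S) < 1" using d by simp
  then obtain B where B: "\<And>k. norm_bound ((c \<cdot>\<^sub>m S) ^\<^sub>m k) B"
    using spectral_radius_jnf_norm_bound_less_1[OF cS] jordan_nf_exists[of "c \<cdot>\<^sub>m S"]
      char_poly_factorized[OF cS] cS by blast
  have bound: "norm ((S ^\<^sub>m k) $$ (a, b)) \<le> B * q ^ k" for k
  proof -
    have Sk: "S ^\<^sub>m k \<in> carrier_mat N N" using S by simp
    have "norm (((c \<cdot>\<^sub>m S) ^\<^sub>m k) $$ (a, b)) \<le> B"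
      using B[of k] ab Sk S unfolding norm_bound_def pow by (auto split: if_splits)
    moreover have "norm (((c \<cdot>\<^sub>m S) ^\<^sub>m k) $$ (a, b)) = norm ((S ^\<^sub>m k) $$ (a, b)) / q ^ k"
    proof -
      have "((c \<cdot>\<^sub>m S) ^\<^sub>m k) $$ (a, b) = c ^ k * (S ^\<^sub>m k) $$ (a, b)"
        unfolding pow using ab Sk by (intro index_smult_mat) (metis carrier_matD)+
      moreover have "norm c = 1 / q" using q0 unfolding c_def norm_of_real by simp
      ultimately show ?thesis by (simp add: norm_mult norm_power power_one_over)
    qed
    ultimately show ?thesis using q0 by (simp add: field_simps)
  qed
  have "(\<lambda>k. q ^ k) \<longlonglongrightarrow> 0" by (rule LIMSEQ_realpow_zero) (use q q0 in simp_all)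
  from tendsto_mult_left[OF this, of B] have lim: "(\<lambda>k. B * q ^ k) \<longlonglongrightarrow> 0" by simp
  have "\<forall>\<^sub>F k in sequentially. norm ((S ^\<^sub>m k) $$ (a, b)) \<le> B * q ^ k"
    by (rule always_eventually, rule allI, rule bound)
  thus ?thesis by (rule Lim_null_comparison[OF _ lim])
qed

lemma eigenvalue_lt_1_of_power_tendsto_0:
  fixes S :: "complex mat"
  assumes S: "S \<in> carrier_mat N N" and lim: "\<And>a b. a < N \<Longrightarrow> b < N \<Longrightarrow> (\<lambda>k. (S ^\<^sub>m k) $$ (a, b)) \<longlonglongrightarrow> 0"
    and ev: "eigenvalue S c"
  shows "norm c < 1"
proof -
  obtain z where z: "z \<in> carrier_vec N" "z \<noteq> 0\<^sub>v N" "S *\<^sub>v z = c \<cdot>\<^sub>v z"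
    using S ev by (auto simp: eigenvalue_def eigenvector_def)
  have pow: "S ^\<^sub>m k *\<^sub>v z = c ^ k \<cdot>\<^sub>v z" for k
  proof (induction k)
    case 0 show ?case using S z by simp
  next
    case (Suc k)
    have Sk: "S ^\<^sub>m k \<in> carrier_mat N N" using S by simp
    have "S ^\<^sub>m Suc k *\<^sub>v z = S ^\<^sub>m k *\<^sub>v (S *\<^sub>v z)"
      using assoc_mult_mat_vec[OF Sk S z(1)] by simp
    also have "\<dots> = c \<cdot>\<^sub>v (S ^\<^sub>m k *\<^sub>v z)" unfolding z using Sk z(1) by (simp add: mult_mat_vec)
    finally show ?case using Suc z(1) by (simp add: smult_smult_assoc)
  qed
  obtain i where i: "i < N" "z $ i \<noteq> 0" using z by (metis eq_vecI carrier_vecD index_zero_vec(1,2))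
  have "c ^ k * z $ i = (\<Sum>b<N. (S ^\<^sub>m k) $$ (i, b) * z $ b)" for k
  proof -
    have Sk: "S ^\<^sub>m k \<in> carrier_mat N N" using S by simp
    have "(S ^\<^sub>m k *\<^sub>v z) $ i = (\<Sum>b<N. (S ^\<^sub>m k) $$ (i, b) * z $ b)"
      using Sk i(1) z(1) S unfolding mult_mat_vec_def scalar_prod_def atLeast0LessThan
      by (auto intro!: sum.cong split: if_splits)
    thus ?thesis using pow[of k] i(1) z(1) by simp
  qed
  moreover have "(\<lambda>k. \<Sum>b<N. (S ^\<^sub>m k) $$ (i, b) * z $ b) \<longlonglongrightarrow> 0"
    using lim i by (intro tendsto_null_sum tendsto_mult_left_zero) auto
  ultimately have "(\<lambda>k. c ^ k * z $ i) \<longlonglongrightarrow> 0" by simp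
  hence "(\<lambda>k. c ^ k * z $ i / z $ i) \<longlonglongrightarrow> 0 / z $ i" by (intro tendsto_divide) (use i in auto)
  hence lim0: "(\<lambda>k. norm (c ^ k)) \<longlonglongrightarrow> 0" using i tendsto_norm_zero by auto
  show ?thesis
  proof (rule ccontr)
    assume "\<not> norm c < 1"
    hence "norm (c ^ k) \<ge> 1" for k by (simp add: norm_power one_le_power)
    hence "(0::real) \<ge> 1" using lim0 by (intro LIMSEQ_le_const[OF lim0]) auto
    thus False by simp
  qed
qed

lemma map_mat_of_real_pow:
  fixes S :: "real mat"
  assumes S: "S \<in> carrier_mat N N"
  shows "map_mat complex_of_real S ^\<^sub>m k = map_mat complex_of_real (S ^\<^sub>m k)"
  using S by (simp add: of_real_hom.mat_hom_pow)

text \<open>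
  In this form stability is inherited by any family with \<open>A'\<^sub>s = U A\<^sub>s W\<close> for all words \<open>s\<close>.
\<close>

lemma stable_iff_words_tendsto_0:
  assumes A: "\<And>\<sigma>. A \<sigma> \<in> carrier_mat n n"
  shows "(\<forall>c. eigenvalue (map_mat complex_of_real (stability_matrix p n A)) c \<longrightarrow> norm c < 1) \<longleftrightarrow>
    (\<forall>i<n. \<forall>j<n. \<forall>k<n. \<forall>l<n.
       (\<lambda>N. \<Sum>w | length w = N. word_weight p w * word_mat n A w $$ (i, k) * word_mat n A w $$ (j, l)) \<longlonglongrightarrow> 0)"
    (is "?E \<longleftrightarrow> ?W")
proof -
  let ?R = "stability_matrix p n A"
  let ?S = "map_mat complex_of_real ?R"
  have S: "?S \<in> carrier_mat (n * n) (n * n)" by simp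
  have Rk: "?R ^\<^sub>m k \<in> carrier_mat (n * n) (n * n)" for k by (rule pow_carrier_mat) simp
  have entry: "(?S ^\<^sub>m k) $$ (a, b) = complex_of_real ((?R ^\<^sub>m k) $$ (a, b))" if "a < n * n" "b < n * n" for k a b
  proof -
    have "a < dim_row (?R ^\<^sub>m k)" "b < dim_col (?R ^\<^sub>m k)" using that Rk[of k] by (metis carrier_matD)+
    thus ?thesis using map_mat_of_real_pow[OF stability_matrix_carrier[of p n A], of k] by simp
  qed
  show ?thesis
  proof
    assume E: ?E
    show ?W
    proof (intro allI impI)
      fix i j k l assume ij: "i < n" "j < n" and kl: "k < n" "l < n"
      note idx = pair_index_less[OF ij] pair_index_less[OF kl]
      have "(\<lambda>N. (?S ^\<^sub>m N) $$ (i * n + j, k * n + l)) \<longlonglongrightarrow> 0"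
        by (rule power_tendsto_0_of_eigenvalues[OF S _ idx]) (use E in blast)
      hence "(\<lambda>N. (?R ^\<^sub>m N) $$ (i * n + j, k * n + l)) \<longlonglongrightarrow> 0"
        unfolding entry[OF idx] by (simp add: tendsto_of_real_iff[of _ 0, simplified])
      thus "(\<lambda>N. \<Sum>w | length w = N. word_weight p w * word_mat n A w $$ (i, k) * word_mat n A w $$ (j, l)) \<longlonglongrightarrow> 0"
        by (simp only: stability_matrix_power[OF A ij kl])
    qed
  next
    assume W: ?W
    show ?E
    proof (intro allI impI, rule eigenvalue_lt_1_of_power_tendsto_0[OF S])
      fix a b assume ab: "a < n * n" "b < n * n"
      hence n: "n > 0" by (cases n) auto
      have a: "a = a div n * n + a mod n" "a div n < n" "a mod n < n"
        and b: "b = b div n * n + b mod n" "b div n < n" "b mod n < n"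
        using ab n by (auto simp: less_mult_imp_div_less)
      have "(\<lambda>N. (?R ^\<^sub>m N) $$ (a, b)) \<longlonglongrightarrow> 0"
        using W a b stability_matrix_power[OF A a(2,3) b(2,3), of p] by simp
      hence "(\<lambda>N. complex_of_real ((?R ^\<^sub>m N) $$ (a, b))) \<longlonglongrightarrow> 0"
        using tendsto_of_real[of _ 0] by fastforce
      thus "(\<lambda>k. (?S ^\<^sub>m k) $$ (a, b)) \<longlonglongrightarrow> 0" by (simp add: entry[OF ab])
    qed
  qed
qed

section \<open>Square integrable random variables and closed subspaces\<close>

lemma sq_int_measurable: "f \<in> sq_int M \<Longrightarrow> f \<in> borel_measurable M"
  by (simp add: sq_int_def)

lemma sq_int_mult_integrable:
  assumes f: "f \<in> sq_int M" and g: "g \<in> sq_int M"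
  shows "integrable M (\<lambda>\<omega>. f \<omega> * g \<omega>)"
proof (rule Bochner_Integration.integrable_bound)
  show "integrable M (\<lambda>\<omega>. (f \<omega>)\<^sup>2 + (g \<omega>)\<^sup>2)" using f g by (simp add: sq_int_def)
  show "(\<lambda>\<omega>. f \<omega> * g \<omega>) \<in> borel_measurable M"
    using f g by (intro borel_measurable_times) (auto simp: sq_int_def)
  have "\<bar>a * b\<bar> \<le> a\<^sup>2 + b\<^sup>2" for a b :: real
  proof -
    have "0 \<le> (\<bar>a\<bar> - \<bar>b\<bar>)\<^sup>2" by simp
    hence "2 * \<bar>a * b\<bar> \<le> a\<^sup>2 + b\<^sup>2" by (simp add: power2_diff abs_mult)
    thus ?thesis by (smt (verit) zero_le_power2 abs_ge_zero)
  qed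
  thus "AE \<omega> in M. norm (f \<omega> * g \<omega>) \<le> norm ((f \<omega>)\<^sup>2 + (g \<omega>)\<^sup>2)" by (intro AE_I2) simp
qed

lemma sq_int_zero: "(\<lambda>_. 0) \<in> sq_int M"
  by (simp add: sq_int_def)

lemma sq_int_cmult: "f \<in> sq_int M \<Longrightarrow> (\<lambda>\<omega>. c * f \<omega>) \<in> sq_int M"
  by (auto simp: sq_int_def power_mult_distrib)

lemma sq_int_add:
  assumes f: "f \<in> sq_int M" and g: "g \<in> sq_int M"
  shows "(\<lambda>\<omega>. f \<omega> + g \<omega>) \<in> sq_int M"
proof -
  have "integrable M (\<lambda>\<omega>. (f \<omega>)\<^sup>2 + (g \<omega>)\<^sup>2 + 2 * (f \<omega> * g \<omega>))"
    using f g sq_int_mult_integrable[OF f g] by (simp add: sq_int_def)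
  moreover have "(\<lambda>\<omega>. f \<omega> + g \<omega>) \<in> borel_measurable M"
    using f g by (intro borel_measurable_add) (auto simp: sq_int_def)
  ultimately show ?thesis by (simp add: sq_int_def power2_sum mult.assoc)
qed

lemma sq_int_diff:
  assumes "f \<in> sq_int M" "g \<in> sq_int M"
  shows "(\<lambda>\<omega>. f \<omega> - g \<omega>) \<in> sq_int M"
  using sq_int_add[OF assms(1) sq_int_cmult[OF assms(2), of "-1"]] by simp

lemma sq_int_sum:
  assumes "\<And>i. i \<in> I \<Longrightarrow> f i \<in> sq_int M"
  shows "(\<lambda>\<omega>. \<Sum>i\<in>I. f i \<omega>) \<in> sq_int M"
  using assms
proof (induction I rule: infinite_finite_induct)
  case (insert a F)
  thus ?case using sq_int_add[of "f a" M "\<lambda>\<omega>. \<Sum>i\<in>F. f i \<omega>"] by simp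
qed (simp_all add: sq_int_zero)

lemma sq_int_cong_AE:
  assumes "f \<in> sq_int M" "g \<in> borel_measurable M" "AE \<omega> in M. f \<omega> = g \<omega>"
  shows "g \<in> sq_int M"
proof -
  have "integrable M (\<lambda>\<omega>. (f \<omega>)\<^sup>2) \<longleftrightarrow> integrable M (\<lambda>\<omega>. (g \<omega>)\<^sup>2)"
    using assms by (intro integrable_cong_AE) (auto simp: sq_int_def)
  thus ?thesis using assms by (simp add: sq_int_def)
qed

lemma sq_int_cauchy_schwarz:
  assumes f: "f \<in> sq_int M" and h: "h \<in> sq_int M"
  shows "(\<integral>\<omega>. f \<omega> * h \<omega> \<partial>M)\<^sup>2 \<le> (\<integral>\<omega>. (f \<omega>)\<^sup>2 \<partial>M) * (\<integral>\<omega>. (h \<omega>)\<^sup>2 \<partial>M)"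
proof -
  let ?F = "\<integral>\<omega>. (f \<omega>)\<^sup>2 \<partial>M" and ?H = "\<integral>\<omega>. (h \<omega>)\<^sup>2 \<partial>M" and ?X = "\<integral>\<omega>. f \<omega> * h \<omega> \<partial>M"
  have int: "integrable M (\<lambda>\<omega>. f \<omega> * h \<omega>)" "integrable M (\<lambda>\<omega>. (f \<omega>)\<^sup>2)" "integrable M (\<lambda>\<omega>. (h \<omega>)\<^sup>2)"
    using sq_int_mult_integrable[OF f h] f h by (auto simp: sq_int_def)
  have key: "0 \<le> ?F - 2 * t * ?X + t\<^sup>2 * ?H" for t
  proof -
    have "(\<integral>\<omega>. (f \<omega> - t * h \<omega>)\<^sup>2 \<partial>M) = (\<integral>\<omega>. (f \<omega>)\<^sup>2 - 2 * t * (f \<omega> * h \<omega>) + t\<^sup>2 * (h \<omega>)\<^sup>2 \<partial>M)"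
      by (intro Bochner_Integration.integral_cong) (auto simp: power2_diff power_mult_distrib)
    also have "\<dots> = ?F - 2 * t * ?X + t\<^sup>2 * ?H" using int by simp
    finally have eq: "(\<integral>\<omega>. (f \<omega> - t * h \<omega>)\<^sup>2 \<partial>M) = ?F - 2 * t * ?X + t\<^sup>2 * ?H" .
    show ?thesis unfolding eq[symmetric] by simp
  qed
  have H: "?H \<ge> 0" by simp
  show ?thesis
  proof (cases "?H = 0")
    case True
    have "AE \<omega> in M. (h \<omega>)\<^sup>2 = 0"
      using True h integral_nonneg_eq_0_iff_AE[of M "\<lambda>\<omega>. (h \<omega>)\<^sup>2"] by (simp add: sq_int_def)
    hence "AE \<omega> in M. f \<omega> * h \<omega> = 0" by eventually_elim simp
    hence "?X = 0" by (rule integral_eq_zero_AE)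
    thus ?thesis using True by simp
  next
    case False
    hence H: "?H > 0" using H by linarith
    have "0 \<le> ?F - ?X\<^sup>2 / ?H" using key[of "?X / ?H"] H by (simp add: field_simps power2_eq_square)
    thus ?thesis using H by (simp add: field_simps)
  qed
qed

lemma closed_sq_subspaceD:
  assumes "closed_sq_subspace M V"
  shows "V \<subseteq> sq_int M" "(\<lambda>_. 0) \<in> V" "\<And>f g. f \<in> V \<Longrightarrow> g \<in> V \<Longrightarrow> (\<lambda>\<omega>. f \<omega> + g \<omega>) \<in> V"
    "\<And>c f. f \<in> V \<Longrightarrow> (\<lambda>\<omega>. c * f \<omega>) \<in> V"
    "\<And>f g. (\<And>n::nat. f n \<in> V) \<Longrightarrow> g \<in> sq_int M \<Longrightarrow> (\<lambda>n. \<integral>\<omega>. (f n \<omega> - g \<omega>)\<^sup>2 \<partial>M) \<longlonglongrightarrow> 0 \<Longrightarrow> g \<in> V"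
  using assms unfolding closed_sq_subspace_def by blast+

lemma closed_sq_subspaceI:
  assumes "V \<subseteq> sq_int M" "(\<lambda>_. 0) \<in> V" "\<And>f g. f \<in> V \<Longrightarrow> g \<in> V \<Longrightarrow> (\<lambda>\<omega>. f \<omega> + g \<omega>) \<in> V"
    "\<And>c f. f \<in> V \<Longrightarrow> (\<lambda>\<omega>. c * f \<omega>) \<in> V"
    "\<And>f g. (\<And>n::nat. f n \<in> V) \<Longrightarrow> g \<in> sq_int M \<Longrightarrow> (\<lambda>n. \<integral>\<omega>. (f n \<omega> - g \<omega>)\<^sup>2 \<partial>M) \<longlonglongrightarrow> 0 \<Longrightarrow> g \<in> V"
  shows "closed_sq_subspace M V"
  using assms unfolding closed_sq_subspace_def by blast

lemma closed_sq_subspace_sq_int: "closed_sq_subspace M (sq_int M)"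
  by (rule closed_sq_subspaceI) (auto intro: sq_int_zero sq_int_add sq_int_cmult)

lemma closed_sq_subspace_sum:
  assumes V: "closed_sq_subspace M V" and "\<And>i. i \<in> I \<Longrightarrow> f i \<in> V"
  shows "(\<lambda>\<omega>. \<Sum>i\<in>I. f i \<omega>) \<in> V"
  using assms(2)
proof (induction I rule: infinite_finite_induct)
  case (insert a F)
  thus ?case using closed_sq_subspaceD(3)[OF V, of "f a" "\<lambda>\<omega>. \<Sum>i\<in>F. f i \<omega>"] by simp
qed (simp_all add: closed_sq_subspaceD(2)[OF V])

lemma closed_sq_subspace_diff:
  assumes V: "closed_sq_subspace M V" and "f \<in> V" "g \<in> V"
  shows "(\<lambda>\<omega>. f \<omega> - g \<omega>) \<in> V"
  using closed_sq_subspaceD(3)[OF V assms(2) closed_sq_subspaceD(4)[OF V assms(3), of "-1"]] by simp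

lemma closed_sq_subspace_cong_AE:
  assumes V: "closed_sq_subspace M V" and f: "f \<in> V" and g: "g \<in> borel_measurable M"
    and ae: "AE \<omega> in M. f \<omega> = g \<omega>"
  shows "g \<in> V"
proof (rule closed_sq_subspaceD(5)[OF V, of "\<lambda>_. f"])
  show "g \<in> sq_int M" using sq_int_cong_AE[OF _ g ae] f closed_sq_subspaceD(1)[OF V] by blast
  have "(\<integral>\<omega>. (f \<omega> - g \<omega>)\<^sup>2 \<partial>M) = 0"
    by (rule integral_eq_zero_AE) (use ae in eventually_elim, simp)
  thus "(\<lambda>n. \<integral>\<omega>. (f \<omega> - g \<omega>)\<^sup>2 \<partial>M) \<longlonglongrightarrow> 0" by simp
qed (rule f)

lemma closed_span_superset: "S \<subseteq> closed_span M S"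
  by (auto simp: closed_span_def)

lemma closed_span_least: "closed_sq_subspace M V \<Longrightarrow> S \<subseteq> V \<Longrightarrow> closed_span M S \<subseteq> V"
  by (auto simp: closed_span_def)

lemma closed_span_closed:
  assumes "S \<subseteq> sq_int M"
  shows "closed_sq_subspace M (closed_span M S)"
proof (rule closed_sq_subspaceI)
  show "closed_span M S \<subseteq> sq_int M" by (rule closed_span_least[OF closed_sq_subspace_sq_int assms])
next
  fix f :: "nat \<Rightarrow> 'a \<Rightarrow> real" and g
  assume f: "\<And>n. f n \<in> closed_span M S" and g: "g \<in> sq_int M" "(\<lambda>n. \<integral>\<omega>. (f n \<omega> - g \<omega>)\<^sup>2 \<partial>M) \<longlonglongrightarrow> 0"
  have "g \<in> V" if V: "closed_sq_subspace M V" "S \<subseteq> V" for V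
    using closed_sq_subspaceD(5)[OF V(1) _ g] f V by (auto simp: closed_span_def)
  thus "g \<in> closed_span M S" by (auto simp: closed_span_def)
next
  show "(\<lambda>_. 0) \<in> closed_span M S" by (auto simp: closed_span_def dest: closed_sq_subspaceD(2))
next
  fix f g assume "f \<in> closed_span M S" "g \<in> closed_span M S"
  thus "(\<lambda>\<omega>. f \<omega> + g \<omega>) \<in> closed_span M S"
    unfolding closed_span_def using closed_sq_subspaceD(3) by blast
next
  fix c f assume "f \<in> closed_span M S"
  thus "(\<lambda>\<omega>. c * f \<omega>) \<in> closed_span M S"
    unfolding closed_span_def using closed_sq_subspaceD(4) by blast
qed

text \<open>
  By the Cauchy-Schwarz inequality \<open>f \<mapsto> E[f h]\<close> is continuous in mean square.
\<close>

lemma closed_sq_subspace_orthogonal: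
  assumes H: "H \<subseteq> sq_int M"
  shows "closed_sq_subspace M {f \<in> sq_int M. \<forall>h\<in>H. (\<integral>\<omega>. f \<omega> * h \<omega> \<partial>M) = 0}"
proof (rule closed_sq_subspaceI)
  fix f g assume "f \<in> {f \<in> sq_int M. \<forall>h\<in>H. (\<integral>\<omega>. f \<omega> * h \<omega> \<partial>M) = 0}"
    "g \<in> {f \<in> sq_int M. \<forall>h\<in>H. (\<integral>\<omega>. f \<omega> * h \<omega> \<partial>M) = 0}"
  thus "(\<lambda>\<omega>. f \<omega> + g \<omega>) \<in> {f \<in> sq_int M. \<forall>h\<in>H. (\<integral>\<omega>. f \<omega> * h \<omega> \<partial>M) = 0}"
    using H by (auto intro!: sq_int_add simp: distrib_right subset_iff sq_int_mult_integrable)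
next
  fix c f assume "f \<in> {f \<in> sq_int M. \<forall>h\<in>H. (\<integral>\<omega>. f \<omega> * h \<omega> \<partial>M) = 0}"
  thus "(\<lambda>\<omega>. c * f \<omega>) \<in> {f \<in> sq_int M. \<forall>h\<in>H. (\<integral>\<omega>. f \<omega> * h \<omega> \<partial>M) = 0}"
    by (auto intro!: sq_int_cmult simp: mult.assoc)
next
  fix f :: "nat \<Rightarrow> 'a \<Rightarrow> real" and g
  assume f: "\<And>n. f n \<in> {f \<in> sq_int M. \<forall>h\<in>H. (\<integral>\<omega>. f \<omega> * h \<omega> \<partial>M) = 0}"
    and g: "g \<in> sq_int M" and lim: "(\<lambda>n. \<integral>\<omega>. (f n \<omega> - g \<omega>)\<^sup>2 \<partial>M) \<longlonglongrightarrow> 0"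
  have "(\<integral>\<omega>. g \<omega> * h \<omega> \<partial>M) = 0" if h: "h \<in> H" for h
  proof -
    have hs: "h \<in> sq_int M" using h H by auto
    have "(\<integral>\<omega>. g \<omega> * h \<omega> \<partial>M)\<^sup>2 \<le> (\<integral>\<omega>. (f n \<omega> - g \<omega>)\<^sup>2 \<partial>M) * (\<integral>\<omega>. (h \<omega>)\<^sup>2 \<partial>M)" for n
    proof -
      have fn: "f n \<in> sq_int M" "(\<integral>\<omega>. f n \<omega> * h \<omega> \<partial>M) = 0" using f h by auto
      have "(\<integral>\<omega>. (f n \<omega> - g \<omega>) * h \<omega> \<partial>M) = - (\<integral>\<omega>. g \<omega> * h \<omega> \<partial>M)"
        using fn sq_int_mult_integrable[OF fn(1) hs] sq_int_mult_integrable[OF g hs]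
        by (simp add: left_diff_distrib)
      thus ?thesis using sq_int_cauchy_schwarz[OF sq_int_diff[OF fn(1) g] hs] by simp
    qed
    hence "(\<integral>\<omega>. g \<omega> * h \<omega> \<partial>M)\<^sup>2 \<le> 0 * (\<integral>\<omega>. (h \<omega>)\<^sup>2 \<partial>M)"
      by (intro LIMSEQ_le_const[OF tendsto_mult_right[OF lim]]) auto
    thus ?thesis by simp
  qed
  thus "g \<in> {f \<in> sq_int M. \<forall>h\<in>H. (\<integral>\<omega>. f \<omega> * h \<omega> \<partial>M) = 0}" using g by auto
next
  show "(\<lambda>_. 0) \<in> {f \<in> sq_int M. \<forall>h\<in>H. (\<integral>\<omega>. f \<omega> * h \<omega> \<partial>M) = 0}" by (simp add: sq_int_zero)
qed blast

text \<open>
  Measurability with respect to \<open>J\<close> is required only up to a null set, since \<open>J\<close> need not contain the null sets of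
  \<open>M\<close> and limits in mean square are determined only almost surely.
\<close>

definition sq_int_mod_null :: "'a measure \<Rightarrow> 'a measure \<Rightarrow> ('a \<Rightarrow> real) set" where
  "sq_int_mod_null M J = {f \<in> sq_int M. \<exists>g\<in>borel_measurable J. AE \<omega> in M. f \<omega> = g \<omega>}"

text \<open>
  A sequence converging in mean square has a subsequence converging almost surely, and the pointwise limit of the
  \<open>J\<close>-measurable versions along it is a \<open>J\<close>-measurable version of the limit.
\<close>

lemma closed_sq_subspace_mod_null:
  assumes J: "subalgebra M J"
  shows "closed_sq_subspace M (sq_int_mod_null M J)"
proof (rule closed_sq_subspaceI)
  show "sq_int_mod_null M J \<subseteq> sq_int M" by (auto simp: sq_int_mod_null_def)
  show "(\<lambda>_. 0) \<in> sq_int_mod_null M J"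
    by (auto simp: sq_int_mod_null_def sq_int_zero intro!: bexI[of _ "\<lambda>_. 0"])
next
  fix f g assume "f \<in> sq_int_mod_null M J" "g \<in> sq_int_mod_null M J"
  then obtain f' g' where fg: "f \<in> sq_int M" "g \<in> sq_int M"
    and [measurable]: "f' \<in> borel_measurable J" "g' \<in> borel_measurable J"
    and ae: "AE \<omega> in M. f \<omega> = f' \<omega>" "AE \<omega> in M. g \<omega> = g' \<omega>"
    by (auto simp: sq_int_mod_null_def)
  have "AE \<omega> in M. f \<omega> + g \<omega> = f' \<omega> + g' \<omega>" using ae by eventually_elim simp
  moreover have "(\<lambda>\<omega>. f' \<omega> + g' \<omega>) \<in> borel_measurable J" by measurable
  ultimately show "(\<lambda>\<omega>. f \<omega> + g \<omega>) \<in> sq_int_mod_null M J"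
    using sq_int_add[OF fg] unfolding sq_int_mod_null_def
    by (intro CollectI conjI bexI[of _ "\<lambda>\<omega>. f' \<omega> + g' \<omega>"])
next
  fix c f assume "f \<in> sq_int_mod_null M J"
  then obtain f' where f: "f \<in> sq_int M" and [measurable]: "f' \<in> borel_measurable J"
    and ae: "AE \<omega> in M. f \<omega> = f' \<omega>" by (auto simp: sq_int_mod_null_def)
  have "AE \<omega> in M. c * f \<omega> = c * f' \<omega>" using ae by eventually_elim simp
  moreover have "(\<lambda>\<omega>. c * f' \<omega>) \<in> borel_measurable J" by measurable
  ultimately show "(\<lambda>\<omega>. c * f \<omega>) \<in> sq_int_mod_null M J"
    using sq_int_cmult[OF f] unfolding sq_int_mod_null_def
    by (intro CollectI conjI bexI[of _ "\<lambda>\<omega>. c * f' \<omega>"])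
next
  fix f :: "nat \<Rightarrow> 'a \<Rightarrow> real" and g
  assume f: "\<And>n. f n \<in> sq_int_mod_null M J"
    and g: "g \<in> sq_int M" and lim: "(\<lambda>n. \<integral>\<omega>. (f n \<omega> - g \<omega>)\<^sup>2 \<partial>M) \<longlonglongrightarrow> 0"
  obtain f' where f'[measurable]: "\<And>n. f' n \<in> borel_measurable J" and ae: "\<And>n. AE \<omega> in M. f n \<omega> = f' n \<omega>"
    using f unfolding sq_int_mod_null_def by (simp add: Bex_def) metis
  have fs: "f n \<in> sq_int M" for n using f by (simp add: sq_int_mod_null_def)
  have "integrable M (\<lambda>\<omega>. (f n \<omega> - g \<omega>)\<^sup>2)" for n using sq_int_diff[OF fs g] by (simp add: sq_int_def)
  then obtain r where r: "strict_mono r" "AE \<omega> in M. (\<lambda>n. (f (r n) \<omega> - g \<omega>)\<^sup>2) \<longlonglongrightarrow> 0"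
    using tendsto_L1_AE_subseq[of M "\<lambda>n \<omega>. (f n \<omega> - g \<omega>)\<^sup>2"] lim by auto
  define g' where "g' \<omega> = lim (\<lambda>n. f' (r n) \<omega>)" for \<omega>
  have [measurable]: "g' \<in> borel_measurable J" unfolding g'_def by measurable
  have "AE \<omega> in M. \<forall>n. f n \<omega> = f' n \<omega>" using ae by (simp add: AE_all_countable)
  with r(2) have "AE \<omega> in M. g \<omega> = g' \<omega>"
  proof eventually_elim
    case (elim \<omega>)
    have "(\<lambda>n. sqrt ((f (r n) \<omega> - g \<omega>)\<^sup>2)) \<longlonglongrightarrow> sqrt 0" by (intro tendsto_real_sqrt elim(1))
    hence "(\<lambda>n. f (r n) \<omega> - g \<omega>) \<longlonglongrightarrow> 0" by (simp add: tendsto_rabs_zero_iff)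
    hence "(\<lambda>n. f' (r n) \<omega>) \<longlonglongrightarrow> g \<omega>" using elim(2) by (simp add: LIM_zero_iff)
    thus ?case unfolding g'_def by (simp add: limI)
  qed
  thus "g \<in> sq_int_mod_null M J" using g by (auto simp: sq_int_mod_null_def)
qed

section \<open>Conditional independence and joint sigma-algebras\<close>

lemma generated_alg_subset:
  "{X -` B \<inter> space M |X B. X \<in> Xs \<and> B \<in> sets borel} \<subseteq> Pow (space M)"
  by auto

lemma space_generated_alg [simp]: "space (generated_alg M Xs) = space M"
  unfolding generated_alg_def by (simp add: generated_alg_subset)

lemma measurable_generated_alg: "X \<in> Xs \<Longrightarrow> X \<in> borel_measurable (generated_alg M Xs)"
proof (rule measurableI)
  fix B :: "real set" assume X: "X \<in> Xs" and B: "B \<in> sets borel"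
  have "X -` B \<inter> space M \<in> sigma_sets (space M) {X -` B \<inter> space M |X B. X \<in> Xs \<and> B \<in> sets borel}"
    by (rule sigma_sets.Basic) (use X B in blast)
  thus "X -` B \<inter> space (generated_alg M Xs) \<in> sets (generated_alg M Xs)"
    unfolding space_generated_alg unfolding generated_alg_def sets_measure_of[OF generated_alg_subset] .
qed simp

lemma generated_alg_least:
  assumes "space N = space M" "Xs \<subseteq> borel_measurable N"
  shows "sets (generated_alg M Xs) \<subseteq> sets N"
proof -
  have "{X -` B \<inter> space M |X B. X \<in> Xs \<and> B \<in> sets borel} \<subseteq> sets N"
    using assms measurable_sets[of _ N borel] by fastforce
  hence "sigma_sets (space M) {X -` B \<inter> space M |X B. X \<in> Xs \<and> B \<in> sets borel} \<subseteq> sets N"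
    using sets.sigma_sets_subset[of _ N] assms(1) by simp
  thus ?thesis by (simp add: generated_alg_def sets_measure_of[OF generated_alg_subset])
qed

lemma generated_alg_subalgebra:
  assumes "Xs \<subseteq> borel_measurable M"
  shows "subalgebra M (generated_alg M Xs)"
  using generated_alg_least[OF refl assms] by (simp add: subalgebra_def)

lemma borel_measurable_mono:
  assumes "space N = space N'" "sets N \<subseteq> sets N'" "f \<in> borel_measurable N"
  shows "f \<in> borel_measurable N'"
  using assms unfolding measurable_def by auto

definition join_alg :: "'a measure \<Rightarrow> 'a measure \<Rightarrow> 'a measure \<Rightarrow> 'a measure" where
  "join_alg M F G = sigma (space M) {A \<inter> B |A B. A \<in> sets F \<and> B \<in> sets G}"

lemma
  assumes F: "subalgebra M F" and G: "subalgebra M G"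
  shows space_join_alg: "space (join_alg M F G) = space M"
    and sets_join_alg: "sets (join_alg M F G) = sigma_sets (space M) {A \<inter> B |A B. A \<in> sets F \<and> B \<in> sets G}"
    and subalgebra_join_alg: "subalgebra M (join_alg M F G)"
    and sets_join_alg1: "sets F \<subseteq> sets (join_alg M F G)"
    and sets_join_alg2: "sets G \<subseteq> sets (join_alg M F G)"
proof -
  have sub: "sets F \<subseteq> sets M" "sets G \<subseteq> sets M" "space F = space M" "space G = space M"
    using F G by (auto simp: subalgebra_def)
  have pow: "{A \<inter> B |A B. A \<in> sets F \<and> B \<in> sets G} \<subseteq> Pow (space M)"
    using sets.sets_into_space[of _ F] sub(3) by auto
  show sp: "space (join_alg M F G) = space M" by (simp add: join_alg_def pow)
  show s: "sets (join_alg M F G) = sigma_sets (space M) {A \<inter> B |A B. A \<in> sets F \<and> B \<in> sets G}"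
    by (simp add: join_alg_def pow)
  have "{A \<inter> B |A B. A \<in> sets F \<and> B \<in> sets G} \<subseteq> sets M" using sub by auto
  hence "sets (join_alg M F G) \<subseteq> sets M" unfolding s by (rule sets.sigma_sets_subset)
  thus "subalgebra M (join_alg M F G)" by (simp add: subalgebra_def sp)
  have "A \<inter> space G = A" if "A \<in> sets F" for A using that sub sets.sets_into_space by fastforce
  hence "A \<in> {A \<inter> B |A B. A \<in> sets F \<and> B \<in> sets G}" if "A \<in> sets F" for A
    using that sets.top[of G] by (intro CollectI exI[of _ A] exI[of _ "space G"]) auto
  thus "sets F \<subseteq> sets (join_alg M F G)" unfolding s by (intro subsetI sigma_sets.Basic)
  have "space F \<inter> B = B" if "B \<in> sets G" for B using that sub sets.sets_into_space by fastforce
  hence "B \<in> {A \<inter> B |A B. A \<in> sets F \<and> B \<in> sets G}" if "B \<in> sets G" for B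
    using that sets.top[of F] by (intro CollectI exI[of _ "space F"] exI[of _ B]) auto
  thus "sets G \<subseteq> sets (join_alg M F G)" unfolding s by (intro subsetI sigma_sets.Basic)
qed

context prob_space
begin

text \<open>
  Conditional independence says that the indicator of \<open>A\<close> may be replaced by its conditional expectation given \<open>G\<close> when
  integrated over intersections of \<open>B\<close> with sets of \<open>Fu\<close>, hence also when integrated against \<open>g\<close>. Then \<open>g\<close> may be
  replaced by its own conditional expectation, which is the constant \<open>c\<close>.
\<close>

lemma cond_indep_set_integral:
  assumes F: "subalgebra M F" and Fu: "subalgebra M Fu" and G: "subalgebra M G"
    and ci: "cond_indep M F Fu G"
    and g: "g \<in> borel_measurable Fu" "\<And>\<omega>. g \<omega> \<ge> 0" "integrable M g"
    and c: "\<And>B. B \<in> sets G \<Longrightarrow> (\<integral>\<omega>. indicator B \<omega> * g \<omega> \<partial>M) = c * prob B"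
    and A: "A \<in> sets F" and B: "B \<in> sets G"
  shows "(\<integral>\<omega>. indicator (A \<inter> B) \<omega> * g \<omega> \<partial>M) = c * prob (A \<inter> B)"
proof -
  interpret Gs: finite_measure_subalgebra M G using G by unfold_locales
  have sets: "\<And>X. X \<in> sets F \<Longrightarrow> X \<in> sets M" "\<And>X. X \<in> sets Fu \<Longrightarrow> X \<in> sets M" "\<And>X. X \<in> sets G \<Longrightarrow> X \<in> sets M"
    using F Fu G by (auto simp: subalgebra_def)
  have [measurable]: "A \<in> sets M" "B \<in> sets M" "B \<in> sets G" "g \<in> borel_measurable M"
    using A B sets g(3) by auto
  define EA where "EA = real_cond_exp M G (indicator A)"
  have EAG[measurable]: "EA \<in> borel_measurable G" and [measurable]: "EA \<in> borel_measurable M"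
    by (auto simp: EA_def)
  have ind: "integrable M (indicat_real X)" if "X \<in> sets M" for X
    using that by (intro integrable_real_indicator) (simp_all add: emeasure_eq_measure)
  have EA0: "AE \<omega> in M. 0 \<le> EA \<omega>" unfolding EA_def by (rule Gs.real_cond_exp_pos) auto
  have EA1: "AE \<omega> in M. EA \<omega> \<le> 1" unfolding EA_def
    by (rule Gs.real_cond_exp_le_c) (auto intro!: AE_I2 ind simp: indicator_def)
  have pt: "(\<integral>\<omega>. indicator B \<omega> * (EA \<omega> * indicator X \<omega>) \<partial>M) = prob (A \<inter> B \<inter> X)"
    if X: "X \<in> sets Fu" for X
  proof -
    have [measurable]: "X \<in> sets M" using X sets by auto
    have bd: "integrable M (\<lambda>\<omega>. (indicator B \<omega> * EA \<omega>) * indicator X \<omega>)"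
      by (rule integrable_const_bound[of _ 1]) (use EA0 EA1 in \<open>auto simp: indicator_def elim: eventually_mono\<close>)
    have "prob (A \<inter> B \<inter> X) = (\<integral>\<omega>. indicator B \<omega> * indicator (A \<inter> X) \<omega> \<partial>M)"
      by (subst indicator_inter_arith[symmetric]) (simp add: Int_ac)
    also have "\<dots> = (\<integral>\<omega>. indicator B \<omega> * real_cond_exp M G (indicator (A \<inter> X)) \<omega> \<partial>M)"
      by (rule Gs.real_cond_exp_intg(2)[symmetric]) (auto simp: indicator_inter_arith[symmetric] intro!: ind)
    also have "\<dots> = (\<integral>\<omega>. (indicator B \<omega> * EA \<omega>) * real_cond_exp M G (indicator X) \<omega> \<partial>M)"
    proof (rule integral_cong_AE)
      have "AE \<omega> in M. real_cond_exp M G (indicator (A \<inter> X)) \<omega> = EA \<omega> * real_cond_exp M G (indicator X) \<omega>"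
        using ci A X unfolding cond_indep_def EA_def by blast
      thus "AE \<omega> in M. indicator B \<omega> * real_cond_exp M G (indicator (A \<inter> X)) \<omega> = (indicator B \<omega> * EA \<omega>) * real_cond_exp M G (indicator X) \<omega>"
        by eventually_elim simp
    qed measurable
    also have "\<dots> = (\<integral>\<omega>. (indicator B \<omega> * EA \<omega>) * indicator X \<omega> \<partial>M)"
      by (rule Gs.real_cond_exp_intg(2)[OF bd]) auto
    finally show ?thesis by (simp add: mult.assoc)
  qed
  \<comment> \<open>These two measures agree on \<open>Fu\<close>, so they give the same integral to \<open>g\<close>.\<close>
  define D1 where "D1 = density M (\<lambda>\<omega>. ennreal (indicator (A \<inter> B) \<omega>))"
  define D2 where "D2 = density M (\<lambda>\<omega>. ennreal (indicator B \<omega> * EA \<omega>))"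
  have subD: "subalgebra D1 Fu" "subalgebra D2 Fu" using Fu by (auto simp: subalgebra_def D1_def D2_def)
  have BE0: "AE \<omega> in M. 0 \<le> indicator B \<omega> * EA \<omega>" using EA0 by eventually_elim (simp add: indicator_def)
  have "restr_to_subalg D1 Fu = restr_to_subalg D2 Fu"
  proof (rule measure_eqI)
    show "sets (restr_to_subalg D1 Fu) = sets (restr_to_subalg D2 Fu)" by (simp add: sets_restr_to_subalg subD)
    fix X assume "X \<in> sets (restr_to_subalg D1 Fu)"
    hence X: "X \<in> sets Fu" by (simp add: sets_restr_to_subalg subD)
    have [measurable]: "X \<in> sets M" using X sets by auto
    have "emeasure D1 X = (\<integral>\<^sup>+\<omega>. ennreal (indicator (A \<inter> B) \<omega>) * indicator X \<omega> \<partial>M)"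
      unfolding D1_def by (rule emeasure_density) auto
    also have "\<dots> = (\<integral>\<^sup>+\<omega>. indicator (A \<inter> B \<inter> X) \<omega> \<partial>M)"
      by (intro nn_integral_cong) (auto simp: indicator_def)
    also have "\<dots> = ennreal (prob (A \<inter> B \<inter> X))" by (simp add: emeasure_eq_measure)
    also have "\<dots> = ennreal (\<integral>\<omega>. indicator B \<omega> * (EA \<omega> * indicator X \<omega>) \<partial>M)" by (simp add: pt[OF X])
    also have "\<dots> = (\<integral>\<^sup>+\<omega>. ennreal (indicator B \<omega> * (EA \<omega> * indicator X \<omega>)) \<partial>M)"
    proof (rule nn_integral_eq_integral[symmetric])
      show "integrable M (\<lambda>\<omega>. indicator B \<omega> * (EA \<omega> * indicator X \<omega>))"
        by (rule integrable_const_bound[of _ 1]) (use EA0 EA1 in \<open>auto simp: indicator_def elim: eventually_mono\<close>)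
      show "AE \<omega> in M. 0 \<le> indicator B \<omega> * (EA \<omega> * indicator X \<omega>)"
        using EA0 by eventually_elim (simp add: indicator_def)
    qed
    also have "\<dots> = (\<integral>\<^sup>+\<omega>. ennreal (indicator B \<omega> * EA \<omega>) * indicator X \<omega> \<partial>M)"
      by (intro nn_integral_cong) (auto simp: indicator_def)
    also have "\<dots> = emeasure D2 X" unfolding D2_def by (rule emeasure_density[symmetric]) auto
    finally show "emeasure (restr_to_subalg D1 Fu) X = emeasure (restr_to_subalg D2 Fu) X"
      by (simp add: emeasure_restr_to_subalg subD X)
  qed
  hence "(\<integral>\<^sup>+\<omega>. ennreal (g \<omega>) \<partial>D1) = (\<integral>\<^sup>+\<omega>. ennreal (g \<omega>) \<partial>D2)"
    using nn_integral_subalgebra2[OF subD(1), of "\<lambda>\<omega>. ennreal (g \<omega>)"]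
      nn_integral_subalgebra2[OF subD(2), of "\<lambda>\<omega>. ennreal (g \<omega>)"] g(1) by simp
  hence eq: "(\<integral>\<^sup>+\<omega>. ennreal (indicator (A \<inter> B) \<omega> * g \<omega>) \<partial>M) = (\<integral>\<^sup>+\<omega>. ennreal ((indicator B \<omega> * EA \<omega>) * g \<omega>) \<partial>M)"
    using BE0 g(2) unfolding D1_def D2_def
    by (subst (asm) (1 2) nn_integral_density) (auto simp: ennreal_mult'' )
  have i2: "integrable M (\<lambda>\<omega>. (indicator B \<omega> * EA \<omega>) * g \<omega>)"
  proof (rule Bochner_Integration.integrable_bound[OF g(3)])
    show "AE \<omega> in M. norm ((indicator B \<omega> * EA \<omega>) * g \<omega>) \<le> norm (g \<omega>)"
      using EA0 EA1
    proof eventually_elim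
      case (elim \<omega>)
      have "EA \<omega> * g \<omega> \<le> 1 * g \<omega>" by (rule mult_right_mono[OF elim(2) g(2)])
      thus ?case using elim(1) g(2)[of \<omega>] by (simp add: indicator_def)
    qed
  qed measurable
  have "(\<integral>\<omega>. indicator (A \<inter> B) \<omega> * g \<omega> \<partial>M) = (\<integral>\<omega>. (indicator B \<omega> * EA \<omega>) * g \<omega> \<partial>M)"
    using eq BE0 g(2) by (subst (1 2) integral_eq_nn_integral) auto
  also have "\<dots> = (\<integral>\<omega>. (indicator B \<omega> * EA \<omega>) * real_cond_exp M G g \<omega> \<partial>M)"
    by (rule Gs.real_cond_exp_intg(2)[OF i2, symmetric]) auto
  also have "\<dots> = (\<integral>\<omega>. (indicator B \<omega> * EA \<omega>) * c \<partial>M)"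
  proof (rule integral_cong_AE)
    have "AE \<omega> in M. real_cond_exp M G g \<omega> = c"
    proof (rule Gs.real_cond_exp_charact)
      fix X assume X: "X \<in> sets G"
      thus "(\<integral>\<omega>\<in>X. g \<omega> \<partial>M) = (\<integral>\<omega>\<in>X. c \<partial>M)"
        using c[OF X] sets(3)[OF X] by (simp add: set_lebesgue_integral_def)
    qed (use g in auto)
    thus "AE \<omega> in M. indicator B \<omega> * EA \<omega> * real_cond_exp M G g \<omega> = indicator B \<omega> * EA \<omega> * c"
      by eventually_elim simp
  qed measurable
  also have "\<dots> = c * (\<integral>\<omega>. indicator B \<omega> * EA \<omega> \<partial>M)" by simp
  also have "(\<integral>\<omega>. indicator B \<omega> * EA \<omega> \<partial>M) = prob (A \<inter> B)"
  proof -
    have "space M \<in> sets Fu" using Fu by (metis sets.top subalgebra_def)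
    moreover have "A \<inter> B \<inter> space M = A \<inter> B" using sets.sets_into_space[OF \<open>B \<in> sets M\<close>] by auto
    moreover have "(\<integral>\<omega>. indicator B \<omega> * (EA \<omega> * indicator (space M) \<omega>) \<partial>M) = (\<integral>\<omega>. indicator B \<omega> * EA \<omega> \<partial>M)"
      by (intro Bochner_Integration.integral_cong) auto
    ultimately show ?thesis using pt[of "space M"] by simp
  qed
  finally show ?thesis .
qed

text \<open>
  The measures with densities \<open>g\<close> and \<open>c\<close> agree on the sets \<open>A \<inter> B\<close> by the previous lemma. These sets are stable under
  intersection and generate the join of \<open>F\<close> and \<open>G\<close>.
\<close>

lemma cond_indep_nn_integral:
  assumes F: "subalgebra M F" and Fu: "subalgebra M Fu" and G: "subalgebra M G"
    and ci: "cond_indep M F Fu G"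
    and g: "g \<in> borel_measurable Fu" "\<And>\<omega>. g \<omega> \<ge> 0" "integrable M g"
    and c: "\<And>B. B \<in> sets G \<Longrightarrow> (\<integral>\<omega>. indicator B \<omega> * g \<omega> \<partial>M) = c * prob B" "c \<ge> 0"
    and h: "h \<in> borel_measurable (join_alg M F G)"
  shows "(\<integral>\<^sup>+\<omega>. h \<omega> * ennreal (g \<omega>) \<partial>M) = ennreal c * (\<integral>\<^sup>+\<omega>. h \<omega> \<partial>M)"
proof -
  let ?J = "join_alg M F G"
  have J: "subalgebra M ?J" by (rule subalgebra_join_alg[OF F G])
  have [measurable]: "g \<in> borel_measurable M" using g(3) by simp
  have [measurable]: "h \<in> borel_measurable M" using measurable_from_subalg[OF J h] .
  define D1 where "D1 = density M (\<lambda>\<omega>. ennreal (g \<omega>))"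
  define D2 where "D2 = density M (\<lambda>\<omega>. ennreal c)"
  have subD: "subalgebra D1 ?J" "subalgebra D2 ?J" using J by (auto simp: subalgebra_def D1_def D2_def)
  let ?E = "{A \<inter> B |A B. A \<in> sets F \<and> B \<in> sets G}"
  have FGM: "sets F \<subseteq> sets M" "sets G \<subseteq> sets M" using F G by (auto simp: subalgebra_def)
  have "restr_to_subalg D1 ?J = restr_to_subalg D2 ?J"
  proof (rule measure_eqI_generator_eq[of ?E "space M" _ _ "\<lambda>_. space M"])
    show "Int_stable ?E"
    proof (rule Int_stableI)
      fix a b assume "a \<in> ?E" "b \<in> ?E"
      then obtain A B A' B' where "a = A \<inter> B" "b = A' \<inter> B'" "A \<in> sets F" "B \<in> sets G" "A' \<in> sets F" "B' \<in> sets G"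
        by blast
      moreover from this have "a \<inter> b = (A \<inter> A') \<inter> (B \<inter> B')" "A \<inter> A' \<in> sets F" "B \<inter> B' \<in> sets G" by auto
      ultimately show "a \<inter> b \<in> ?E" by blast
    qed
    show "?E \<subseteq> Pow (space M)" using FGM sets.sets_into_space by blast
    show "sets (restr_to_subalg D1 ?J) = sigma_sets (space M) ?E" "sets (restr_to_subalg D2 ?J) = sigma_sets (space M) ?E"
      by (simp_all add: sets_restr_to_subalg subD sets_join_alg[OF F G])
    have "space M \<in> sets F" "space M \<in> sets G" using F G by (metis sets.top subalgebra_def)+
    thus "range (\<lambda>_::nat. space M) \<subseteq> ?E" by blast
    show "(\<Union>i::nat. space M) = space M" by simp
    have eqE: "emeasure D1 X = emeasure D2 X \<and> emeasure D2 X \<noteq> \<infinity> \<and> X \<in> sets ?J" if "X \<in> ?E" for X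
    proof -
      from that obtain A B where X: "X = A \<inter> B" and A: "A \<in> sets F" and B: "B \<in> sets G"
        by (elim CollectE exE conjE)
      have [measurable]: "X \<in> sets M" unfolding X using A B FGM by (intro sets.Int) auto
      have "emeasure D1 X = (\<integral>\<^sup>+\<omega>. ennreal (indicator (A \<inter> B) \<omega> * g \<omega>) \<partial>M)"
        unfolding D1_def X[symmetric] by (subst emeasure_density) (auto intro!: nn_integral_cong simp: indicator_def)
      also have "\<dots> = ennreal (\<integral>\<omega>. indicator (A \<inter> B) \<omega> * g \<omega> \<partial>M)"
      proof (rule nn_integral_eq_integral)
        have "integrable M (\<lambda>\<omega>. g \<omega> * indicator (A \<inter> B) \<omega>)"
          using \<open>X \<in> sets M\<close> g(3) unfolding X by (rule integrable_real_mult_indicator)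
        thus "integrable M (\<lambda>\<omega>. indicator (A \<inter> B) \<omega> * g \<omega>)" by (simp add: mult.commute)
      qed (use g(2) in simp)
      also have "(\<integral>\<omega>. indicator (A \<inter> B) \<omega> * g \<omega> \<partial>M) = c * prob X"
        unfolding X by (rule cond_indep_set_integral[OF F Fu G ci g c(1) A B])
      also have "ennreal (c * prob X) = ennreal c * emeasure M X"
        using c(2) by (simp add: emeasure_eq_measure ennreal_mult)
      also have "\<dots> = emeasure D2 X" unfolding D2_def by (simp add: emeasure_density nn_integral_cmult)
      finally have "emeasure D1 X = emeasure D2 X" .
      moreover have "emeasure D2 X = ennreal c * emeasure M X"
        unfolding D2_def by (simp add: emeasure_density nn_integral_cmult)
      moreover have "ennreal c * emeasure M X \<noteq> \<infinity>"
        by (simp add: ennreal_mult_eq_top_iff)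
      moreover have "X \<in> sets ?J" using that by (auto simp: sets_join_alg[OF F G])
      ultimately show ?thesis by simp
    qed
    show "emeasure (restr_to_subalg D1 ?J) X = emeasure (restr_to_subalg D2 ?J) X" if "X \<in> ?E" for X
      using eqE[OF that] by (simp add: emeasure_restr_to_subalg subD)
    show "emeasure (restr_to_subalg D1 ?J) (space M) \<noteq> \<infinity>"
      using eqE[of "space M"] \<open>range (\<lambda>_::nat. space M) \<subseteq> ?E\<close> by (simp add: emeasure_restr_to_subalg subD)
  qed
  hence "(\<integral>\<^sup>+\<omega>. h \<omega> \<partial>D1) = (\<integral>\<^sup>+\<omega>. h \<omega> \<partial>D2)"
    using nn_integral_subalgebra2[OF subD(1) h] nn_integral_subalgebra2[OF subD(2) h] by simp
  thus ?thesis unfolding D1_def D2_def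
    by (simp add: nn_integral_density nn_integral_cmult mult.commute)
qed

lemma cond_indep_sq_integral:
  assumes F: "subalgebra M F" and Fu: "subalgebra M Fu" and G: "subalgebra M G"
    and ci: "cond_indep M F Fu G"
    and g: "g \<in> borel_measurable Fu" "\<And>\<omega>. g \<omega> \<ge> 0" "integrable M g"
    and c: "\<And>B. B \<in> sets G \<Longrightarrow> (\<integral>\<omega>. indicator B \<omega> * g \<omega> \<partial>M) = c * prob B" "c \<ge> 0"
    and f: "f \<in> sq_int_mod_null M (join_alg M F G)"
  shows "integrable M (\<lambda>\<omega>. (f \<omega>)\<^sup>2 * g \<omega>) \<and> (\<integral>\<omega>. (f \<omega>)\<^sup>2 * g \<omega> \<partial>M) = c * (\<integral>\<omega>. (f \<omega>)\<^sup>2 \<partial>M)"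
proof -
  obtain f' where fs: "f \<in> sq_int M" and f'[measurable]: "f' \<in> borel_measurable (join_alg M F G)"
    and ae: "AE \<omega> in M. f \<omega> = f' \<omega>" using f by (auto simp: sq_int_mod_null_def)
  have [measurable]: "f \<in> borel_measurable M" "g \<in> borel_measurable M" using fs g(3) by (auto simp: sq_int_def)
  have fi: "integrable M (\<lambda>\<omega>. (f \<omega>)\<^sup>2)" using fs by (simp add: sq_int_def)
  have "(\<integral>\<^sup>+\<omega>. ennreal ((f \<omega>)\<^sup>2 * g \<omega>) \<partial>M) = (\<integral>\<^sup>+\<omega>. ennreal ((f' \<omega>)\<^sup>2) * ennreal (g \<omega>) \<partial>M)"
    by (rule nn_integral_cong_AE) (use ae in eventually_elim, use g(2) in \<open>simp add: ennreal_mult\<close>)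
  also have "\<dots> = ennreal c * (\<integral>\<^sup>+\<omega>. ennreal ((f' \<omega>)\<^sup>2) \<partial>M)"
  proof (rule cond_indep_nn_integral[OF F Fu G ci g c])
    show "(\<lambda>\<omega>. ennreal ((f' \<omega>)\<^sup>2)) \<in> borel_measurable (join_alg M F G)" by measurable
  qed
  also have "(\<integral>\<^sup>+\<omega>. ennreal ((f' \<omega>)\<^sup>2) \<partial>M) = (\<integral>\<^sup>+\<omega>. ennreal ((f \<omega>)\<^sup>2) \<partial>M)"
    by (rule nn_integral_cong_AE) (use ae in eventually_elim, simp)
  also have "\<dots> = ennreal (\<integral>\<omega>. (f \<omega>)\<^sup>2 \<partial>M)" using fi by (intro nn_integral_eq_integral) auto
  also have "ennreal c * \<dots> = ennreal (c * (\<integral>\<omega>. (f \<omega>)\<^sup>2 \<partial>M))" using c(2) by (simp add: ennreal_mult)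
  finally have eq: "(\<integral>\<^sup>+\<omega>. ennreal ((f \<omega>)\<^sup>2 * g \<omega>) \<partial>M) = ennreal (c * (\<integral>\<omega>. (f \<omega>)\<^sup>2 \<partial>M))" .
  have "integrable M (\<lambda>\<omega>. (f \<omega>)\<^sup>2 * g \<omega>)" by (rule integrableI_nn_integral_finite[OF _ _ eq]) (use g(2) in auto)
  moreover have "(\<integral>\<omega>. (f \<omega>)\<^sup>2 * g \<omega> \<partial>M) = c * (\<integral>\<omega>. (f \<omega>)\<^sup>2 \<partial>M)"
    by (subst integral_eq_nn_integral) (use g(2) c(2) eq in auto)
  ultimately show ?thesis by blast
qed

text \<open>
  Polarization: \<open>4 f h = (f + h)\<^sup>2 - (f - h)\<^sup>2\<close>.
\<close>

lemma cond_indep_integral: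
  assumes F: "subalgebra M F" and Fu: "subalgebra M Fu" and G: "subalgebra M G"
    and ci: "cond_indep M F Fu G"
    and g: "g \<in> borel_measurable Fu" "\<And>\<omega>. g \<omega> \<ge> 0" "integrable M g"
    and c: "\<And>B. B \<in> sets G \<Longrightarrow> (\<integral>\<omega>. indicator B \<omega> * g \<omega> \<partial>M) = c * prob B" "c \<ge> 0"
    and f: "f \<in> sq_int_mod_null M (join_alg M F G)" and h: "h \<in> sq_int_mod_null M (join_alg M F G)"
  shows "(\<integral>\<omega>. f \<omega> * h \<omega> * g \<omega> \<partial>M) = c * (\<integral>\<omega>. f \<omega> * h \<omega> \<partial>M)"
proof -
  note V = closed_sq_subspace_mod_null[OF subalgebra_join_alg[OF F G]]
  have sq: "integrable M (\<lambda>\<omega>. (z \<omega>)\<^sup>2 * g \<omega>) \<and> (\<integral>\<omega>. (z \<omega>)\<^sup>2 * g \<omega> \<partial>M) = c * (\<integral>\<omega>. (z \<omega>)\<^sup>2 \<partial>M)"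
    if "z \<in> sq_int_mod_null M (join_alg M F G)" for z
    using cond_indep_sq_integral[OF F Fu G ci g _ c(2) that] c(1) by blast
  define a where "a \<omega> = f \<omega> + h \<omega>" for \<omega>
  define b where "b \<omega> = f \<omega> - h \<omega>" for \<omega>
  have aV: "a \<in> sq_int_mod_null M (join_alg M F G)" and bV: "b \<in> sq_int_mod_null M (join_alg M F G)"
    using closed_sq_subspaceD(3)[OF V f h] closed_sq_subspace_diff[OF V f h] by (simp_all add: a_def[abs_def] b_def[abs_def])
  have ai: "integrable M (\<lambda>\<omega>. (a \<omega>)\<^sup>2)" and bi: "integrable M (\<lambda>\<omega>. (b \<omega>)\<^sup>2)"
    using aV bV by (simp_all add: sq_int_mod_null_def sq_int_def)
  have pol: "f \<omega> * h \<omega> = ((a \<omega>)\<^sup>2 - (b \<omega>)\<^sup>2) / 4" for \<omega>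
    by (simp add: a_def b_def power2_eq_square algebra_simps)
  have "(\<integral>\<omega>. f \<omega> * h \<omega> * g \<omega> \<partial>M) = (\<integral>\<omega>. ((a \<omega>)\<^sup>2 * g \<omega> - (b \<omega>)\<^sup>2 * g \<omega>) / 4 \<partial>M)"
    unfolding pol by (simp add: left_diff_distrib)
  also have "\<dots> = c * ((\<integral>\<omega>. (a \<omega>)\<^sup>2 \<partial>M) - (\<integral>\<omega>. (b \<omega>)\<^sup>2 \<partial>M)) / 4"
    using sq[OF aV] sq[OF bV] by (simp add: right_diff_distrib)
  also have "(\<integral>\<omega>. (a \<omega>)\<^sup>2 \<partial>M) - (\<integral>\<omega>. (b \<omega>)\<^sup>2 \<partial>M) = 4 * (\<integral>\<omega>. f \<omega> * h \<omega> \<partial>M)"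
    unfolding pol using ai bi by simp
  finally show ?thesis by simp
qed

end

section \<open>Scheduling processes and spans of ZMWSII processes\<close>

lemma sched_word_Nil [simp]: "sched_word \<mu> [] t \<omega> = 1"
  by (simp add: sched_word_def)

lemma sched_word_Cons: "sched_word \<mu> (\<sigma> # s) t \<omega> = \<mu> \<sigma> (t - int (length s)) \<omega> * sched_word \<mu> s t \<omega>"
  unfolding sched_word_def by (simp add: prod.lessThan_Suc_shift algebra_simps del: prod.lessThan_Suc)

lemma sched_word_snoc: "sched_word \<mu> (s @ [\<sigma>]) t \<omega> = sched_word \<mu> s (t - 1) \<omega> * \<mu> \<sigma> t \<omega>"
  unfolding sched_word_def by (simp add: nth_append algebra_simps)

lemma word_weight_Nil [simp]: "word_weight p [] = 1"
  by (simp add: word_weight_def)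

lemma word_weight_Cons [simp]: "word_weight p (\<sigma> # s) = p \<sigma> * word_weight p s"
  by (simp add: word_weight_def)

locale admissible_scheduling = prob_space M for M :: "'a measure" +
  fixes \<mu> :: "('s::finite, 'a) scheduling" and p :: "'s \<Rightarrow> real"
  assumes adm: "admissible M \<mu> p"
begin

lemma mu_measurable [measurable]: "\<mu> \<sigma> t \<in> borel_measurable M"
  using adm by (simp add: admissible_def)

lemma p_pos: "p \<sigma> > 0"
  using adm by (simp add: admissible_def)

lemma word_weight_pos: "word_weight p w > 0"
  by (induction w) (simp_all add: p_pos)

lemma sched_word_measurable [measurable]: "sched_word \<mu> w t \<in> borel_measurable M"
  unfolding sched_word_def[abs_def] by measurable

lemma sched_word_sq_int:
  assumes "w \<noteq> []"
  shows "sched_word \<mu> w t \<in> sq_int M"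
proof -
  have "\<forall>w v. w \<noteq> [] \<and> v \<noteq> [] \<longrightarrow> wide_sense_stationary M {sched_word \<mu> w, sched_word \<mu> v}"
    using adm unfolding admissible_def by (elim conjE)
  thus ?thesis using assms by (simp add: wide_sense_stationary_def)
qed

lemma mu_sq_int: "\<mu> \<sigma> t \<in> sq_int M"
proof -
  have "sched_word \<mu> [\<sigma>] t = \<mu> \<sigma> t" by (rule ext) (simp add: sched_word_Cons)
  thus ?thesis using sched_word_sq_int[of "[\<sigma>]" t] by simp
qed

lemma past_subalgebra: "subalgebra M (past_alg M \<mu> t)"
  unfolding past_alg_def by (rule generated_alg_subalgebra) auto

lemma future_subalgebra: "subalgebra M (future_alg M \<mu> t)"
  unfolding future_alg_def by (rule generated_alg_subalgebra) auto

lemma mu_future: "\<mu> \<sigma> t \<in> borel_measurable (future_alg M \<mu> t)"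
  unfolding future_alg_def by (rule measurable_generated_alg) auto

lemma mu_past: "k < t \<Longrightarrow> \<mu> \<sigma> k \<in> borel_measurable (past_alg M \<mu> t)"
  unfolding past_alg_def by (rule measurable_generated_alg) auto

lemma past_set_integral:
  assumes f: "integrable M f" and B: "B \<in> sets (past_alg M \<mu> t)"
    and ce: "AE \<omega> in M. real_cond_exp M (past_alg M \<mu> t) f \<omega> = g \<omega>" and g: "g \<in> borel_measurable M"
  shows "(\<integral>\<omega>. indicator B \<omega> * f \<omega> \<partial>M) = (\<integral>\<omega>. indicator B \<omega> * g \<omega> \<partial>M)"
proof -
  interpret P: finite_measure_subalgebra M "past_alg M \<mu> t" using past_subalgebra by unfold_locales
  have [measurable]: "B \<in> sets M" using B past_subalgebra[of t] by (auto simp: subalgebra_def)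
  have "(\<integral>\<omega>. indicator B \<omega> * f \<omega> \<partial>M) = (\<integral>\<omega>. indicator B \<omega> * real_cond_exp M (past_alg M \<mu> t) f \<omega> \<partial>M)"
    using P.real_cond_exp_intA[OF f B] by (simp add: set_lebesgue_integral_def)
  also have "\<dots> = (\<integral>\<omega>. indicator B \<omega> * g \<omega> \<partial>M)"
  proof (rule integral_cong_AE)
    show "AE \<omega> in M. indicator B \<omega> * real_cond_exp M (past_alg M \<mu> t) f \<omega> = indicator B \<omega> * g \<omega>"
      using ce by eventually_elim simp
  qed (use g in measurable)
  finally show ?thesis .
qed

lemma past_moment_diff:
  assumes "\<sigma> \<noteq> \<sigma>'" and B: "B \<in> sets (past_alg M \<mu> t)"
  shows "(\<integral>\<omega>. indicator B \<omega> * (\<mu> \<sigma> t \<omega> * \<mu> \<sigma>' t \<omega>) \<partial>M) = 0"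
proof -
  have "AE \<omega> in M. real_cond_exp M (past_alg M \<mu> t) (\<lambda>\<omega>. \<mu> \<sigma> t \<omega> * \<mu> \<sigma>' t \<omega>) \<omega> = 0"
  proof -
    have "\<forall>\<sigma> \<sigma>' t. \<sigma> \<noteq> \<sigma>' \<longrightarrow>
        (AE \<omega> in M. real_cond_exp M (past_alg M \<mu> t) (\<lambda>\<omega>. \<mu> \<sigma> t \<omega> * \<mu> \<sigma>' t \<omega>) \<omega> = 0)"
      using adm unfolding admissible_def by (elim conjE)
    thus ?thesis using assms(1) by simp
  qed
  from past_set_integral[OF sq_int_mult_integrable[OF mu_sq_int mu_sq_int] B this] show ?thesis by simp
qed

text \<open>
  The conditional second moment of \<open>\<mu>\<^sub>\<sigma>(t)\<close> is not given directly by admissibility, which prescribes those of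
  \<open>\<mu>\<^sub>a\<^sub>\<sigma>(t) \<mu>\<^sub>b\<^sub>\<sigma>(t)\<close>. Weighting these with \<open>\<alpha>\<^sub>a \<alpha>\<^sub>b\<close> and summing over \<open>a\<close> and \<open>b\<close> removes the first letters, because
  \<open>\<Sum>\<^sub>a \<alpha>\<^sub>a \<mu>\<^sub>a(t - 1) = 1\<close>.
\<close>

lemma past_moment_same:
  assumes B: "B \<in> sets (past_alg M \<mu> t)"
  shows "(\<integral>\<omega>. indicator B \<omega> * (\<mu> \<sigma> t \<omega>)\<^sup>2 \<partial>M) = p \<sigma> * prob B"
proof -
  have Bm[measurable]: "B \<in> sets M" using B past_subalgebra[of t] by (auto simp: subalgebra_def)
  obtain \<alpha> where \<alpha>: "AE \<omega> in M. (\<Sum>a\<in>UNIV. \<alpha> a * \<mu> a (t - 1) \<omega>) = 1"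
  proof -
    have "\<exists>\<alpha>. \<forall>t. AE \<omega> in M. (\<Sum>\<sigma>\<in>UNIV. \<alpha> \<sigma> * \<mu> \<sigma> t \<omega>) = 1"
      using adm unfolding admissible_def by (elim conjE)
    thus ?thesis using that by auto
  qed
  have sw: "sched_word \<mu> [a, \<sigma>] t \<omega> = \<mu> a (t - 1) \<omega> * \<mu> \<sigma> t \<omega>" "sched_word \<mu> [a] (t - 1) \<omega> = \<mu> a (t - 1) \<omega>" for a \<omega>
    by (simp_all add: sched_word_Cons)
  have int: "integrable M (\<lambda>\<omega>. indicator B \<omega> * (f \<omega> * g \<omega>))"
    if "f \<in> sq_int M" "g \<in> sq_int M" for f g
    using integrable_real_mult_indicator[OF Bm sq_int_mult_integrable[OF that]] by (simp add: mult.commute)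
  have i1: "integrable M (\<lambda>\<omega>. indicator B \<omega> * (sched_word \<mu> [a, \<sigma>] t \<omega> * sched_word \<mu> [b, \<sigma>] t \<omega>))" for a b
    by (intro int sched_word_sq_int) auto
  have i2: "integrable M (\<lambda>\<omega>. indicator B \<omega> * (\<mu> a (t - 1) \<omega> * \<mu> b (t - 1) \<omega>))" for a b
    by (intro int mu_sq_int)
  have ab: "(\<integral>\<omega>. indicator B \<omega> * (sched_word \<mu> [a, \<sigma>] t \<omega> * sched_word \<mu> [b, \<sigma>] t \<omega>) \<partial>M)
      = p \<sigma> * (\<integral>\<omega>. indicator B \<omega> * (\<mu> a (t - 1) \<omega> * \<mu> b (t - 1) \<omega>) \<partial>M)" for a b
  proof -
    have "\<forall>w v \<tau> \<tau>' t. w \<noteq> [] \<and> v \<noteq> [] \<longrightarrow> (AE \<omega> in M. real_cond_exp M (past_alg M \<mu> t)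
             (\<lambda>\<omega>. sched_word \<mu> (w @ [\<tau>]) t \<omega> * sched_word \<mu> (v @ [\<tau>']) t \<omega>) \<omega>
           = (if \<tau> = \<tau>' then p \<tau> * sched_word \<mu> w (t - 1) \<omega> * sched_word \<mu> v (t - 1) \<omega> else 0))"
      using adm unfolding admissible_def by (elim conjE)
    from this[rule_format, of "[a]" "[b]" t \<sigma> \<sigma>]
    have "AE \<omega> in M. real_cond_exp M (past_alg M \<mu> t)
             (\<lambda>\<omega>. sched_word \<mu> [a, \<sigma>] t \<omega> * sched_word \<mu> [b, \<sigma>] t \<omega>) \<omega>
           = p \<sigma> * (\<mu> a (t - 1) \<omega> * \<mu> b (t - 1) \<omega>)" by (simp add: sw mult.assoc)
    from past_set_integral[OF _ B this] show ?thesis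
      using sq_int_mult_integrable[OF sched_word_sq_int sched_word_sq_int, of "[a, \<sigma>]" "[b, \<sigma>]" t t]
      by (simp add: mult.left_commute)
  qed
  have "(\<integral>\<omega>. indicator B \<omega> * (\<mu> \<sigma> t \<omega>)\<^sup>2 \<partial>M)
      = (\<integral>\<omega>. (\<Sum>a\<in>UNIV. \<Sum>b\<in>UNIV. \<alpha> a * \<alpha> b * (indicator B \<omega> * (sched_word \<mu> [a, \<sigma>] t \<omega> * sched_word \<mu> [b, \<sigma>] t \<omega>))) \<partial>M)"
  proof (rule integral_cong_AE)
    show "AE \<omega> in M. indicator B \<omega> * (\<mu> \<sigma> t \<omega>)\<^sup>2
      = (\<Sum>a\<in>UNIV. \<Sum>b\<in>UNIV. \<alpha> a * \<alpha> b * (indicator B \<omega> * (sched_word \<mu> [a, \<sigma>] t \<omega> * sched_word \<mu> [b, \<sigma>] t \<omega>)))"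
      using \<alpha>
    proof eventually_elim
      case (elim \<omega>)
      have "(\<Sum>a\<in>UNIV. \<Sum>b\<in>UNIV. \<alpha> a * \<alpha> b * (indicator B \<omega> * (sched_word \<mu> [a, \<sigma>] t \<omega> * sched_word \<mu> [b, \<sigma>] t \<omega>)))
         = (\<Sum>a\<in>UNIV. \<Sum>b\<in>UNIV. (\<alpha> a * \<mu> a (t - 1) \<omega>) * (\<alpha> b * \<mu> b (t - 1) \<omega>)) * (indicator B \<omega> * (\<mu> \<sigma> t \<omega>)\<^sup>2)"
        unfolding sum_distrib_right by (intro sum.cong refl) (simp add: sw power2_eq_square)
      thus ?case unfolding sum_product[symmetric] elim by simp
    qed
  qed measurable
  also have "\<dots> = (\<Sum>a\<in>UNIV. \<Sum>b\<in>UNIV. \<alpha> a * \<alpha> b * (p \<sigma> * (\<integral>\<omega>. indicator B \<omega> * (\<mu> a (t - 1) \<omega> * \<mu> b (t - 1) \<omega>) \<partial>M)))"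
    using i1 by (simp add: ab)
  also have "\<dots> = p \<sigma> * (\<Sum>a\<in>UNIV. \<Sum>b\<in>UNIV. \<alpha> a * \<alpha> b * (\<integral>\<omega>. indicator B \<omega> * (\<mu> a (t - 1) \<omega> * \<mu> b (t - 1) \<omega>) \<partial>M))"
    by (simp add: sum_distrib_left mult.left_commute)
  also have "(\<Sum>a\<in>UNIV. \<Sum>b\<in>UNIV. \<alpha> a * \<alpha> b * (\<integral>\<omega>. indicator B \<omega> * (\<mu> a (t - 1) \<omega> * \<mu> b (t - 1) \<omega>) \<partial>M))
      = (\<integral>\<omega>. (\<Sum>a\<in>UNIV. \<Sum>b\<in>UNIV. \<alpha> a * \<alpha> b * (indicator B \<omega> * (\<mu> a (t - 1) \<omega> * \<mu> b (t - 1) \<omega>))) \<partial>M)"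
    using i2 by simp
  also have "\<dots> = (\<integral>\<omega>. indicator B \<omega> \<partial>M)"
  proof (rule integral_cong_AE)
    show "AE \<omega> in M. (\<Sum>a\<in>UNIV. \<Sum>b\<in>UNIV. \<alpha> a * \<alpha> b * (indicator B \<omega> * (\<mu> a (t - 1) \<omega> * \<mu> b (t - 1) \<omega>))) = indicator B \<omega>"
      using \<alpha>
    proof eventually_elim
      case (elim \<omega>)
      have "(\<Sum>a\<in>UNIV. \<Sum>b\<in>UNIV. \<alpha> a * \<alpha> b * (indicator B \<omega> * (\<mu> a (t - 1) \<omega> * \<mu> b (t - 1) \<omega>)))
         = (\<Sum>a\<in>UNIV. \<Sum>b\<in>UNIV. (\<alpha> a * \<mu> a (t - 1) \<omega>) * (\<alpha> b * \<mu> b (t - 1) \<omega>)) * indicator B \<omega>"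
        unfolding sum_distrib_right by (intro sum.cong refl) simp
      thus ?case unfolding sum_product[symmetric] elim by simp
    qed
  qed measurable
  finally show ?thesis by simp
qed

end

locale ZMWSII_process = admissible_scheduling M \<mu> p
  for M :: "'a measure" and \<mu> :: "('s::finite, 'a) scheduling" and p +
  fixes d :: nat and r :: "'a vprocess"
  assumes zmwsii: "ZMWSII M \<mu> p d r"
begin

definition hist_alg :: "int \<Rightarrow> 'a measure" where
  "hist_alg t = generated_alg M {(\<lambda>\<omega>. r k \<omega> $ i) |k i. k \<le> t \<and> i < d}"

definition nonanticipating :: "int \<Rightarrow> ('a \<Rightarrow> real) set" where
  "nonanticipating t = sq_int_mod_null M (join_alg M (hist_alg t) (past_alg M \<mu> t))"

text \<open>
  The components of \<open>zproc\<close> without the normalizing factor, which does not affect linear spans.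
\<close>

definition gen :: "'s list \<Rightarrow> nat \<Rightarrow> int \<Rightarrow> 'a \<Rightarrow> real" where
  "gen w i t \<omega> = sched_word \<mu> w (t - 1) \<omega> * r (t - int (length w)) \<omega> $ i"

text \<open>
  The spans of the products over all words and over nonempty words. Multiplication by \<open>\<mu>\<^sub>\<sigma>(t)\<close> leads from the first at
  time \<open>t\<close> to the second at time \<open>t + 1\<close>, and the noise of a realization is orthogonal to the second.
\<close>

definition present_span :: "int \<Rightarrow> ('a \<Rightarrow> real) set" where
  "present_span t = closed_span M {gen w i t |w i. i < d}"

definition past_span :: "int \<Rightarrow> ('a \<Rightarrow> real) set" where
  "past_span t = closed_span M {gen w i t |w i. w \<noteq> [] \<and> i < d}"

lemma r_carrier: "\<omega> \<in> space M \<Longrightarrow> r t \<omega> \<in> carrier_vec d"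
  using zmwsii by (simp add: ZMWSII_def vec_process_def)

lemma r_measurable: "i < d \<Longrightarrow> (\<lambda>\<omega>. r t \<omega> $ i) \<in> borel_measurable M"
  using zmwsii by (simp add: ZMWSII_def vec_process_def)

lemma r_sq_int: "i < d \<Longrightarrow> (\<lambda>\<omega>. r t \<omega> $ i) \<in> sq_int M"
  using zmwsii by (simp add: ZMWSII_def)

lemma hist_subalgebra: "subalgebra M (hist_alg t)"
  unfolding hist_alg_def by (rule generated_alg_subalgebra) (auto intro: r_measurable)

lemma nonanticipating_closed: "closed_sq_subspace M (nonanticipating t)"
  unfolding nonanticipating_def
  by (intro closed_sq_subspace_mod_null subalgebra_join_alg hist_subalgebra past_subalgebra)

lemma gen_measurable: "i < d \<Longrightarrow> gen w i t \<in> borel_measurable M"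
  unfolding gen_def[abs_def] using r_measurable[measurable] by measurable

lemma gen_sq_int:
  assumes i: "i < d"
  shows "gen w i t \<in> sq_int M"
proof (cases "w = []")
  case True
  have "gen w i t = (\<lambda>\<omega>. r t \<omega> $ i)" by (rule ext) (simp add: gen_def True)
  thus ?thesis using r_sq_int[OF i] by simp
next
  case False
  let ?c = "sqrt (word_weight p w)"
  have c: "?c > 0" using word_weight_pos by simp
  have "(\<lambda>\<omega>. zproc \<mu> p r w t \<omega> $ i) \<in> sq_int M" using zmwsii False i by (simp add: ZMWSII_def)
  hence sq: "(\<lambda>\<omega>. ?c * zproc \<mu> p r w t \<omega> $ i) \<in> sq_int M" by (rule sq_int_cmult)
  show ?thesis
  proof (rule sq_int_cong_AE[OF sq gen_measurable[OF i]], rule AE_I2)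
    fix \<omega> assume "\<omega> \<in> space M"
    hence "r (t - int (length w)) \<omega> \<in> carrier_vec d" by (rule r_carrier)
    thus "?c * zproc \<mu> p r w t \<omega> $ i = gen w i t \<omega>" using i c by (simp add: zproc_def gen_def)
  qed
qed

lemma gen_nonanticipating:
  assumes i: "i < d"
  shows "gen w i t \<in> nonanticipating t"
proof -
  let ?J = "join_alg M (hist_alg t) (past_alg M \<mu> t)"
  note sub = sets_join_alg1[OF hist_subalgebra past_subalgebra] sets_join_alg2[OF hist_subalgebra past_subalgebra]
    space_join_alg[OF hist_subalgebra past_subalgebra]
  have "(\<lambda>\<omega>. r (t - int (length w)) \<omega> $ i) \<in> borel_measurable (hist_alg t)"
    unfolding hist_alg_def
    by (rule measurable_generated_alg) (use i in \<open>intro CollectI exI[of _ "t - int (length w)"] exI[of _ i], simp\<close>)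
  hence r: "(\<lambda>\<omega>. r (t - int (length w)) \<omega> $ i) \<in> borel_measurable ?J"
    by (rule borel_measurable_mono[rotated 2, OF _ _ sub(1)]) (simp add: sub(3) hist_subalgebra[unfolded subalgebra_def])
  have "(\<lambda>\<omega>. sched_word \<mu> w (t - 1) \<omega>) \<in> borel_measurable (past_alg M \<mu> t)"
    unfolding sched_word_def by (intro borel_measurable_prod mu_past) auto
  hence s: "(\<lambda>\<omega>. sched_word \<mu> w (t - 1) \<omega>) \<in> borel_measurable ?J"
    by (rule borel_measurable_mono[rotated 2, OF _ _ sub(2)]) (simp add: sub(3) past_subalgebra[unfolded subalgebra_def])
  have "gen w i t \<in> borel_measurable ?J"
    unfolding gen_def[abs_def] by (rule borel_measurable_times[OF s r])
  thus ?thesis unfolding nonanticipating_def sq_int_mod_null_def using gen_sq_int[OF i]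
    by (intro CollectI conjI bexI[of _ "gen w i t"]) auto
qed

lemma gens_sq_int: "{gen w i t |w i. P w \<and> i < d} \<subseteq> sq_int M" "{gen w i t |w i. i < d} \<subseteq> sq_int M"
  using gen_sq_int by auto

lemma present_span_closed: "closed_sq_subspace M (present_span t)"
  unfolding present_span_def by (rule closed_span_closed) (rule gens_sq_int)

lemma past_span_closed: "closed_sq_subspace M (past_span t)"
  unfolding past_span_def by (rule closed_span_closed) (rule gens_sq_int)

lemma gen_present: "i < d \<Longrightarrow> gen w i t \<in> present_span t"
  unfolding present_span_def by (rule subsetD[OF closed_span_superset]) auto

lemma gen_past: "i < d \<Longrightarrow> w \<noteq> [] \<Longrightarrow> gen w i t \<in> past_span t"
  unfolding past_span_def by (rule subsetD[OF closed_span_superset]) auto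

lemma past_sub_present: "past_span t \<subseteq> present_span t"
  unfolding past_span_def by (rule closed_span_least[OF present_span_closed]) (auto intro: gen_present)

lemma present_sub_nonanticipating: "present_span t \<subseteq> nonanticipating t"
  unfolding present_span_def by (rule closed_span_least[OF nonanticipating_closed]) (auto intro: gen_nonanticipating)

lemma present_sq_int: "f \<in> present_span t \<Longrightarrow> f \<in> sq_int M"
  using closed_sq_subspaceD(1)[OF present_span_closed] by blast

lemma past_sq_int: "f \<in> past_span t \<Longrightarrow> f \<in> sq_int M"
  using closed_sq_subspaceD(1)[OF past_span_closed] by blast

lemma hist_cond_indep: "cond_indep M (hist_alg t) (future_alg M \<mu> t) (past_alg M \<mu> t)"
  using zmwsii by (simp add: ZMWSII_def hist_alg_def)

lemma moment_same:
  assumes f: "f \<in> nonanticipating t" and h: "h \<in> nonanticipating t"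
  shows "(\<integral>\<omega>. f \<omega> * h \<omega> * (\<mu> \<sigma> t \<omega>)\<^sup>2 \<partial>M) = p \<sigma> * (\<integral>\<omega>. f \<omega> * h \<omega> \<partial>M)"
proof (rule cond_indep_integral[OF hist_subalgebra future_subalgebra past_subalgebra hist_cond_indep])
  show "(\<lambda>\<omega>. (\<mu> \<sigma> t \<omega>)\<^sup>2) \<in> borel_measurable (future_alg M \<mu> t)" by (intro borel_measurable_power mu_future)
  show "integrable M (\<lambda>\<omega>. (\<mu> \<sigma> t \<omega>)\<^sup>2)" using mu_sq_int by (simp add: sq_int_def)
qed (use f h p_pos[of \<sigma>] past_moment_same in \<open>auto simp: nonanticipating_def\<close>)

lemma mult_sq_int:
  assumes f: "f \<in> nonanticipating t"
  shows "(\<lambda>\<omega>. f \<omega> * \<mu> \<sigma> t \<omega>) \<in> sq_int M"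
proof -
  have "integrable M (\<lambda>\<omega>. (f \<omega>)\<^sup>2 * (\<mu> \<sigma> t \<omega>)\<^sup>2) \<and> (\<integral>\<omega>. (f \<omega>)\<^sup>2 * (\<mu> \<sigma> t \<omega>)\<^sup>2 \<partial>M) = p \<sigma> * (\<integral>\<omega>. (f \<omega>)\<^sup>2 \<partial>M)"
  proof (rule cond_indep_sq_integral[OF hist_subalgebra future_subalgebra past_subalgebra hist_cond_indep])
    show "(\<lambda>\<omega>. (\<mu> \<sigma> t \<omega>)\<^sup>2) \<in> borel_measurable (future_alg M \<mu> t)" by (intro borel_measurable_power mu_future)
    show "integrable M (\<lambda>\<omega>. (\<mu> \<sigma> t \<omega>)\<^sup>2)" using mu_sq_int by (simp add: sq_int_def)
  qed (use f p_pos[of \<sigma>] past_moment_same in \<open>auto simp: nonanticipating_def\<close>)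
  moreover have [measurable]: "f \<in> borel_measurable M"
    using f by (simp add: nonanticipating_def sq_int_mod_null_def sq_int_def)
  ultimately show ?thesis by (simp add: sq_int_def power_mult_distrib)
qed

text \<open>
  The weight \<open>(\<mu>\<^sub>\<sigma>(t) + \<mu>\<^sub>\<sigma>\<^sub>'(t))\<^sup>2\<close> has conditional mean \<open>p\<^sub>\<sigma> + p\<^sub>\<sigma>\<^sub>'\<close>, which its two squares already account for. This
  weight is nonnegative, as \<open>cond_indep_integral\<close> requires, while the mixed product has no sign.
\<close>

lemma moment_diff:
  assumes f: "f \<in> nonanticipating t" and h: "h \<in> nonanticipating t" and ne: "\<sigma> \<noteq> \<sigma>'"
  shows "(\<integral>\<omega>. (f \<omega> * \<mu> \<sigma> t \<omega>) * (h \<omega> * \<mu> \<sigma>' t \<omega>) \<partial>M) = 0"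
proof -
  let ?g = "\<lambda>\<omega>. (\<mu> \<sigma> t \<omega> + \<mu> \<sigma>' t \<omega>)\<^sup>2"
  have "(\<integral>\<omega>. f \<omega> * h \<omega> * ?g \<omega> \<partial>M) = (p \<sigma> + p \<sigma>') * (\<integral>\<omega>. f \<omega> * h \<omega> \<partial>M)"
  proof (rule cond_indep_integral[OF hist_subalgebra future_subalgebra past_subalgebra hist_cond_indep])
    show "?g \<in> borel_measurable (future_alg M \<mu> t)" by (intro borel_measurable_power borel_measurable_add mu_future)
    show "integrable M ?g" using sq_int_add[OF mu_sq_int mu_sq_int] by (simp add: sq_int_def)
    fix B assume B: "B \<in> sets (past_alg M \<mu> t)"
    have Bm: "B \<in> sets M" using B past_subalgebra[of t] by (auto simp: subalgebra_def)
    have int: "integrable M (\<lambda>\<omega>. indicator B \<omega> * (\<mu> a t \<omega> * \<mu> b t \<omega>))" for a b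
      using integrable_real_mult_indicator[OF Bm sq_int_mult_integrable[OF mu_sq_int mu_sq_int]] by (simp add: mult.commute)
    have "(\<integral>\<omega>. indicator B \<omega> * ?g \<omega> \<partial>M) = (\<integral>\<omega>. indicator B \<omega> * (\<mu> \<sigma> t \<omega> * \<mu> \<sigma> t \<omega>)
        + indicator B \<omega> * (\<mu> \<sigma>' t \<omega> * \<mu> \<sigma>' t \<omega>) + 2 * (indicator B \<omega> * (\<mu> \<sigma> t \<omega> * \<mu> \<sigma>' t \<omega>)) \<partial>M)"
      by (intro Bochner_Integration.integral_cong) (auto simp: power2_eq_square algebra_simps)
    also have "\<dots> = p \<sigma> * prob B + p \<sigma>' * prob B"
      using int past_moment_same[OF B, unfolded power2_eq_square] past_moment_diff[OF ne B] by simp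
    finally show "(\<integral>\<omega>. indicator B \<omega> * ?g \<omega> \<partial>M) = (p \<sigma> + p \<sigma>') * prob B" by (simp add: distrib_right)
  qed (use f h p_pos[of \<sigma>] p_pos[of \<sigma>'] in \<open>auto simp: nonanticipating_def\<close>)
  moreover have "(\<integral>\<omega>. f \<omega> * h \<omega> * ?g \<omega> \<partial>M) = (\<integral>\<omega>. (f \<omega> * \<mu> \<sigma> t \<omega>) * (h \<omega> * \<mu> \<sigma> t \<omega>)
      + (f \<omega> * \<mu> \<sigma>' t \<omega>) * (h \<omega> * \<mu> \<sigma>' t \<omega>) + (f \<omega> * \<mu> \<sigma> t \<omega>) * (h \<omega> * \<mu> \<sigma>' t \<omega>)
      + (f \<omega> * \<mu> \<sigma>' t \<omega>) * (h \<omega> * \<mu> \<sigma> t \<omega>) \<partial>M)"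
    by (intro Bochner_Integration.integral_cong) (auto simp: power2_eq_square algebra_simps)
  moreover have "\<dots> = (\<integral>\<omega>. (f \<omega> * \<mu> \<sigma> t \<omega>) * (h \<omega> * \<mu> \<sigma> t \<omega>) \<partial>M)
      + (\<integral>\<omega>. (f \<omega> * \<mu> \<sigma>' t \<omega>) * (h \<omega> * \<mu> \<sigma>' t \<omega>) \<partial>M) + 2 * (\<integral>\<omega>. (f \<omega> * \<mu> \<sigma> t \<omega>) * (h \<omega> * \<mu> \<sigma>' t \<omega>) \<partial>M)"
    using sq_int_mult_integrable[OF mult_sq_int[OF f] mult_sq_int[OF h]]
    by (simp add: mult.left_commute[of "h _"] mult.commute mult.assoc)
  moreover have "(\<integral>\<omega>. (f \<omega> * \<mu> \<tau> t \<omega>) * (h \<omega> * \<mu> \<tau> t \<omega>) \<partial>M) = p \<tau> * (\<integral>\<omega>. f \<omega> * h \<omega> \<partial>M)" for \<tau>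
    using moment_same[OF f h, of \<tau>] by (simp add: power2_eq_square ac_simps)
  ultimately show ?thesis by (simp add: distrib_right)
qed

lemma moment:
  assumes f: "f \<in> nonanticipating t" and h: "h \<in> nonanticipating t"
  shows "(\<integral>\<omega>. (f \<omega> * \<mu> \<sigma> t \<omega>) * (h \<omega> * \<mu> \<sigma>' t \<omega>) \<partial>M) = (if \<sigma> = \<sigma>' then p \<sigma> * (\<integral>\<omega>. f \<omega> * h \<omega> \<partial>M) else 0)"
  using moment_diff[OF f h] moment_same[OF f h] by (auto simp: power2_eq_square ac_simps)

text \<open>
  By \<open>moment_same\<close> multiplication by \<open>\<mu>\<^sub>\<sigma>(t)\<close> scales mean square distances by \<open>p\<^sub>\<sigma>\<close>. So the elements it carries into the
  past span at time \<open>t + 1\<close> form a closed subspace, and the generators at time \<open>t\<close> are among them.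
\<close>

lemma mult_past_span:
  assumes f: "f \<in> present_span t"
  shows "(\<lambda>\<omega>. f \<omega> * \<mu> \<sigma> t \<omega>) \<in> past_span (t + 1)"
proof -
  \<comment> \<open>The restriction to nonanticipating elements makes the isometry available for limits.\<close>
  let ?V = "{f \<in> nonanticipating t. (\<lambda>\<omega>. f \<omega> * \<mu> \<sigma> t \<omega>) \<in> past_span (t + 1)}"
  note N = nonanticipating_closed[of t] and P = past_span_closed[of "t + 1"]
  have "closed_sq_subspace M ?V"
  proof (rule closed_sq_subspaceI)
    show "?V \<subseteq> sq_int M" using closed_sq_subspaceD(1)[OF N] by blast
    show "(\<lambda>_. 0) \<in> ?V" using closed_sq_subspaceD(2)[OF N] closed_sq_subspaceD(2)[OF P] by simp
  next
    fix f g assume "f \<in> ?V" "g \<in> ?V"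
    thus "(\<lambda>\<omega>. f \<omega> + g \<omega>) \<in> ?V"
      using closed_sq_subspaceD(3)[OF N] closed_sq_subspaceD(3)[OF P] by (simp add: distrib_right)
  next
    fix c f assume "f \<in> ?V"
    thus "(\<lambda>\<omega>. c * f \<omega>) \<in> ?V"
      using closed_sq_subspaceD(4)[OF N] closed_sq_subspaceD(4)[OF P] by (simp add: mult.assoc)
  next
    fix f :: "nat \<Rightarrow> 'a \<Rightarrow> real" and g
    assume f: "\<And>n. f n \<in> ?V" and g: "g \<in> sq_int M" and lim: "(\<lambda>n. \<integral>\<omega>. (f n \<omega> - g \<omega>)\<^sup>2 \<partial>M) \<longlonglongrightarrow> 0"
    have gN: "g \<in> nonanticipating t" using closed_sq_subspaceD(5)[OF N _ g lim] f by blast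
    have "(\<integral>\<omega>. (f n \<omega> * \<mu> \<sigma> t \<omega> - g \<omega> * \<mu> \<sigma> t \<omega>)\<^sup>2 \<partial>M) = p \<sigma> * (\<integral>\<omega>. (f n \<omega> - g \<omega>)\<^sup>2 \<partial>M)" for n
    proof -
      have "(\<lambda>\<omega>. f n \<omega> - g \<omega>) \<in> nonanticipating t" using closed_sq_subspace_diff[OF N _ gN] f by blast
      from moment_same[OF this this, of \<sigma>] show ?thesis
        by (simp add: power2_eq_square algebra_simps)
    qed
    hence "(\<lambda>n. \<integral>\<omega>. (f n \<omega> * \<mu> \<sigma> t \<omega> - g \<omega> * \<mu> \<sigma> t \<omega>)\<^sup>2 \<partial>M) \<longlonglongrightarrow> 0"
      using tendsto_mult_left[OF lim, of "p \<sigma>"] by simp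
    hence "(\<lambda>\<omega>. g \<omega> * \<mu> \<sigma> t \<omega>) \<in> past_span (t + 1)"
      using closed_sq_subspaceD(5)[OF P, of "\<lambda>n \<omega>. f n \<omega> * \<mu> \<sigma> t \<omega>"] f mult_sq_int[OF gN] by blast
    thus "g \<in> ?V" using gN by simp
  qed
  moreover have "{gen w i t |w i. i < d} \<subseteq> ?V"
  proof safe
    fix w i assume i: "i < d"
    show "gen w i t \<in> nonanticipating t" by (rule gen_nonanticipating[OF i])
    have "(\<lambda>\<omega>. gen w i t \<omega> * \<mu> \<sigma> t \<omega>) = gen (w @ [\<sigma>]) i (t + 1)"
      by (rule ext) (simp add: gen_def sched_word_snoc)
    thus "(\<lambda>\<omega>. gen w i t \<omega> * \<mu> \<sigma> t \<omega>) \<in> past_span (t + 1)" using gen_past[OF i] by simp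
  qed
  ultimately have "present_span t \<subseteq> ?V" unfolding present_span_def by (rule closed_span_least)
  thus ?thesis using f by blast
qed

lemma mult_word_present:
  "f \<in> present_span t \<Longrightarrow> (\<lambda>\<omega>. f \<omega> * sched_word \<mu> w (t + int (length w) - 1) \<omega>) \<in> present_span (t + int (length w))"
proof (induction w arbitrary: f t)
  case (Cons \<sigma> w)
  have "(\<lambda>\<omega>. f \<omega> * \<mu> \<sigma> t \<omega>) \<in> present_span (t + 1)" using mult_past_span[OF Cons.prems] past_sub_present by blast
  from Cons.IH[OF this] show ?case by (simp add: sched_word_Cons ac_simps)
qed simp

lemma mult_word_past:
  assumes "f \<in> present_span t" "w \<noteq> []"
  shows "(\<lambda>\<omega>. f \<omega> * sched_word \<mu> w (t + int (length w) - 1) \<omega>) \<in> past_span (t + int (length w))"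
proof -
  obtain s \<sigma> where w: "w = s @ [\<sigma>]" using assms(2) by (metis rev_exhaust)
  show ?thesis using mult_past_span[OF mult_word_present[OF assms(1), of s], of \<sigma>]
    by (simp add: w sched_word_snoc ac_simps)
qed

lemma mult_word_past':
  assumes "f \<in> past_span t"
  shows "(\<lambda>\<omega>. f \<omega> * sched_word \<mu> w (t + int (length w) - 1) \<omega>) \<in> past_span (t + int (length w))"
  using mult_word_past[of f t w] assms past_sub_present by (cases "w = []") auto

lemma scalar_prod_present:
  assumes c: "c \<in> carrier_vec d"
  shows "(\<lambda>\<omega>. c \<bullet> r t \<omega>) \<in> present_span t"
proof -
  have g: "(\<lambda>\<omega>. r t \<omega> $ i) \<in> present_span t" if "i < d" for i
  proof -
    have "gen [] i t = (\<lambda>\<omega>. r t \<omega> $ i)" by (rule ext) (simp add: gen_def)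
    thus ?thesis using gen_present[OF that, of "[]" t] by simp
  qed
  have "(\<lambda>\<omega>. \<Sum>i<d. c $ i * r t \<omega> $ i) \<in> present_span t"
    by (intro closed_sq_subspace_sum[OF present_span_closed] closed_sq_subspaceD(4)[OF present_span_closed] g) auto
  thus ?thesis
  proof (rule closed_sq_subspace_cong_AE[OF present_span_closed])
    have eq: "c \<bullet> r t \<omega> = (\<Sum>i<d. c $ i * r t \<omega> $ i)" if "\<omega> \<in> space M" for \<omega>
      using carrier_vecD[OF r_carrier[OF that, of t]] by (simp add: scalar_prod_def atLeast0LessThan)
    thus "AE \<omega> in M. (\<Sum>i<d. c $ i * r t \<omega> $ i) = c \<bullet> r t \<omega>" by (intro AE_I2) simp
    have "(\<lambda>\<omega>. \<Sum>i<d. c $ i * r t \<omega> $ i) \<in> borel_measurable M"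
      using r_measurable by (intro borel_measurable_sum borel_measurable_times) auto
    thus "(\<lambda>\<omega>. c \<bullet> r t \<omega>) \<in> borel_measurable M" by (subst measurable_cong[OF eq])
  qed
qed

end

section \<open>Moments of a realization\<close>

lemma scalar_prod_sq_int:
  fixes z :: "'a \<Rightarrow> real vec"
  assumes z: "\<And>\<omega>. \<omega> \<in> space M \<Longrightarrow> z \<omega> \<in> carrier_vec n" and zi: "\<And>i. i < n \<Longrightarrow> (\<lambda>\<omega>. z \<omega> $ i) \<in> sq_int M"
  shows "(\<lambda>\<omega>. c \<bullet> z \<omega>) \<in> sq_int M"
proof -
  have eq: "(\<Sum>i<n. c $ i * z \<omega> $ i) = c \<bullet> z \<omega>" if "\<omega> \<in> space M" for \<omega>
    using carrier_vecD[OF z[OF that]] by (simp add: scalar_prod_def atLeast0LessThan)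
  have sq: "(\<lambda>\<omega>. \<Sum>i<n. c $ i * z \<omega> $ i) \<in> sq_int M" by (intro sq_int_sum sq_int_cmult zi) auto
  have "(\<lambda>\<omega>. c \<bullet> z \<omega>) \<in> borel_measurable M"
    using sq_int_measurable[OF sq] by (subst measurable_cong[OF eq[symmetric]])
  thus ?thesis using sq eq by (intro sq_int_cong_AE[OF sq]) (auto intro: AE_I2)
qed

lemma integral_scalar_prod:
  fixes z :: "'a \<Rightarrow> real vec"
  assumes z: "\<And>\<omega>. \<omega> \<in> space M \<Longrightarrow> z \<omega> \<in> carrier_vec n" and zi: "\<And>i. i < n \<Longrightarrow> (\<lambda>\<omega>. z \<omega> $ i) \<in> sq_int M"
    and f: "f \<in> sq_int M"
  shows "(\<integral>\<omega>. (c \<bullet> z \<omega>) * f \<omega> \<partial>M) = (\<Sum>i<n. c $ i * (\<integral>\<omega>. z \<omega> $ i * f \<omega> \<partial>M))"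
proof -
  have "(\<integral>\<omega>. (c \<bullet> z \<omega>) * f \<omega> \<partial>M) = (\<integral>\<omega>. (\<Sum>i<n. c $ i * (z \<omega> $ i * f \<omega>)) \<partial>M)"
    by (intro Bochner_Integration.integral_cong refl)
       (simp add: carrier_vecD[OF z] scalar_prod_def atLeast0LessThan sum_distrib_right mult.assoc)
  also have "\<dots> = (\<Sum>i<n. c $ i * (\<integral>\<omega>. z \<omega> $ i * f \<omega> \<partial>M))"
    using sq_int_mult_integrable[OF zi f] by (subst Bochner_Integration.integral_sum) auto
  finally show ?thesis .
qed

locale lpv_realization = admissible_scheduling M \<mu> p
  for M :: "'a measure" and \<mu> :: "('s::finite, 'a) scheduling" and p +
  fixes nx m ny :: nat and A K :: "'s \<Rightarrow> real mat" and C F :: "real mat" and v x y :: "'a vprocess"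
  assumes sys: "asLPV_SSA M \<mu> p nx m ny A K C F v x y"
begin

lemma carriers:
  "A \<sigma> \<in> carrier_mat nx nx" "K \<sigma> \<in> carrier_mat nx m" "C \<in> carrier_mat ny nx" "F \<in> carrier_mat ny m"
  using sys by (auto simp: asLPV_SSA_def lpv_carrier_def)

lemma W_carrier: "word_mat nx A s \<in> carrier_mat nx nx"
  using carriers by (intro word_mat_carrier)

lemma x_carrier: "\<omega> \<in> space M \<Longrightarrow> x t \<omega> \<in> carrier_vec nx"
  and v_carrier: "\<omega> \<in> space M \<Longrightarrow> v t \<omega> \<in> carrier_vec m"
  and y_carrier: "\<omega> \<in> space M \<Longrightarrow> y t \<omega> \<in> carrier_vec ny"
  and y_measurable: "j < ny \<Longrightarrow> (\<lambda>\<omega>. y t \<omega> $ j) \<in> borel_measurable M"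
  using sys by (auto simp: asLPV_SSA_def vec_process_def)

sublocale joint: ZMWSII_process M \<mu> p "nx + m" "\<lambda>t \<omega>. x t \<omega> @\<^sub>v v t \<omega>"
  using sys by unfold_locales (simp add: asLPV_SSA_def)

lemma append_x: "\<omega> \<in> space M \<Longrightarrow> i < nx \<Longrightarrow> (x t \<omega> @\<^sub>v v t \<omega>) $ i = x t \<omega> $ i"
  using x_carrier[of \<omega> t] v_carrier[of \<omega> t] by (simp add: carrier_vecD)

lemma append_v: "\<omega> \<in> space M \<Longrightarrow> i < m \<Longrightarrow> (x t \<omega> @\<^sub>v v t \<omega>) $ (nx + i) = v t \<omega> $ i"
  using x_carrier[of \<omega> t] v_carrier[of \<omega> t] by (simp add: carrier_vecD)

lemma x_sq_int:
  assumes i: "i < nx"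
  shows "(\<lambda>\<omega>. x t \<omega> $ i) \<in> sq_int M"
proof (rule sq_int_cong_AE[OF joint.r_sq_int])
  show "i < nx + m" using i by simp
  show "(\<lambda>\<omega>. x t \<omega> $ i) \<in> borel_measurable M" using sys i by (simp add: asLPV_SSA_def vec_process_def)
  show "AE \<omega> in M. (x t \<omega> @\<^sub>v v t \<omega>) $ i = x t \<omega> $ i" by (rule AE_I2) (rule append_x[OF _ i])
qed

lemma v_sq_int:
  assumes i: "i < m"
  shows "(\<lambda>\<omega>. v t \<omega> $ i) \<in> sq_int M"
proof (rule sq_int_cong_AE[OF joint.r_sq_int])
  show "nx + i < nx + m" using i by simp
  show "(\<lambda>\<omega>. v t \<omega> $ i) \<in> borel_measurable M" using sys i by (simp add: asLPV_SSA_def vec_process_def)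
  show "AE \<omega> in M. (x t \<omega> @\<^sub>v v t \<omega>) $ (nx + i) = v t \<omega> $ i" by (rule AE_I2) (rule append_v[OF _ i])
qed

lemma gx_sq_int: "(\<lambda>\<omega>. g \<bullet> x t \<omega>) \<in> sq_int M"
  by (rule scalar_prod_sq_int) (auto intro: x_carrier x_sq_int)

lemma kv_sq_int: "(\<lambda>\<omega>. k \<bullet> v t \<omega>) \<in> sq_int M"
  by (rule scalar_prod_sq_int) (auto intro: v_carrier v_sq_int)

text \<open>
  Linear forms in state and noise. The state equation maps forms in the state at time \<open>t + 1\<close> to such forms at time
  \<open>t\<close>, with the transposed system matrices acting on the coefficients.
\<close>

definition lin :: "real vec \<Rightarrow> real vec \<Rightarrow> int \<Rightarrow> 'a \<Rightarrow> real" where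
  "lin g k t \<omega> = g \<bullet> x t \<omega> + k \<bullet> v t \<omega>"

lemma lin_present:
  assumes "g \<in> carrier_vec nx" "k \<in> carrier_vec m"
  shows "lin g k t \<in> joint.present_span t"
proof (rule closed_sq_subspace_cong_AE[OF joint.present_span_closed])
  show "(\<lambda>\<omega>. (g @\<^sub>v k) \<bullet> (x t \<omega> @\<^sub>v v t \<omega>)) \<in> joint.present_span t"
    by (rule joint.scalar_prod_present) (use assms in simp)
  show "AE \<omega> in M. (g @\<^sub>v k) \<bullet> (x t \<omega> @\<^sub>v v t \<omega>) = lin g k t \<omega>"
  proof (rule AE_I2)
    fix \<omega> assume "\<omega> \<in> space M"
    thus "(g @\<^sub>v k) \<bullet> (x t \<omega> @\<^sub>v v t \<omega>) = lin g k t \<omega>"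
      unfolding lin_def by (intro scalar_prod_append[OF assms] x_carrier v_carrier)
  qed
  show "lin g k t \<in> borel_measurable M"
    unfolding lin_def[abs_def] by (intro borel_measurable_add sq_int_measurable[OF gx_sq_int] sq_int_measurable[OF kv_sq_int])
qed

lemma gx_present:
  assumes g: "g \<in> carrier_vec nx"
  shows "(\<lambda>\<omega>. g \<bullet> x t \<omega>) \<in> joint.present_span t"
proof (rule closed_sq_subspace_cong_AE[OF joint.present_span_closed lin_present[OF g zero_carrier_vec]])
  show "AE \<omega> in M. lin g (0\<^sub>v m) t \<omega> = g \<bullet> x t \<omega>" by (rule AE_I2) (simp add: lin_def v_carrier)
qed (rule sq_int_measurable[OF gx_sq_int])

lemma kv_present:
  assumes k: "k \<in> carrier_vec m"
  shows "(\<lambda>\<omega>. k \<bullet> v t \<omega>) \<in> joint.present_span t"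
proof (rule closed_sq_subspace_cong_AE[OF joint.present_span_closed lin_present[OF zero_carrier_vec k]])
  show "AE \<omega> in M. lin (0\<^sub>v nx) k t \<omega> = k \<bullet> v t \<omega>" by (rule AE_I2) (simp add: lin_def x_carrier)
qed (rule sq_int_measurable[OF kv_sq_int])

lemma zproc_entry:
  assumes "\<And>t \<omega>. \<omega> \<in> space M \<Longrightarrow> z t \<omega> \<in> carrier_vec n" "\<omega> \<in> space M" "i < n"
  shows "zproc \<mu> p z w t \<omega> $ i = (1 / sqrt (word_weight p w)) * (sched_word \<mu> w (t - 1) \<omega> * z (t - int (length w)) \<omega> $ i)"
  using carrier_vecD[OF assms(1)[OF assms(2), of "t - int (length w)"]] assms(3) by (simp add: zproc_def)

lemma v_orthogonal_gen:
  assumes w: "w \<noteq> []" and i: "i < nx + m" and j: "j < m"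
  shows "(\<integral>\<omega>. joint.gen w i t \<omega> * v t \<omega> $ j \<partial>M) = 0"
proof -
  have c: "sqrt (word_weight p w) > 0" using word_weight_pos by simp
  show ?thesis
  proof (cases "i < nx")
    case True
    have "cross_moment M m nx (v t) (zproc \<mu> p x w t) $$ (j, i) = 0"
      using sys w True j by (simp add: asLPV_SSA_def)
    hence "(\<integral>\<omega>. v t \<omega> $ j * zproc \<mu> p x w t \<omega> $ i \<partial>M) = 0" using True j by (simp add: cross_moment_def)
    also have "(\<integral>\<omega>. v t \<omega> $ j * zproc \<mu> p x w t \<omega> $ i \<partial>M)
       = (\<integral>\<omega>. (1 / sqrt (word_weight p w)) * (joint.gen w i t \<omega> * v t \<omega> $ j) \<partial>M)"
      using True by (intro Bochner_Integration.integral_cong refl)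
        (simp add: zproc_entry[of x nx] x_carrier joint.gen_def append_x)
    finally show ?thesis using c by simp
  next
    case False
    then obtain i' where i': "i = nx + i'" "i' < m" using i by (metis add_diff_inverse_nat nat_add_left_cancel_less)
    have "cross_moment M m m (v t) (zproc \<mu> p v w t) $$ (j, i') = 0"
      using sys w i' j by (simp add: asLPV_SSA_def)
    hence "(\<integral>\<omega>. v t \<omega> $ j * zproc \<mu> p v w t \<omega> $ i' \<partial>M) = 0" using i' j by (simp add: cross_moment_def)
    also have "(\<integral>\<omega>. v t \<omega> $ j * zproc \<mu> p v w t \<omega> $ i' \<partial>M)
       = (\<integral>\<omega>. (1 / sqrt (word_weight p w)) * (joint.gen w i t \<omega> * v t \<omega> $ j) \<partial>M)"
      using i' by (intro Bochner_Integration.integral_cong refl)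
        (simp add: zproc_entry[of v m] v_carrier joint.gen_def append_v)
    finally show ?thesis using c by simp
  qed
qed

lemma v_orthogonal_past:
  assumes f: "f \<in> joint.past_span t"
  shows "(\<integral>\<omega>. (k \<bullet> v t \<omega>) * f \<omega> \<partial>M) = 0"
proof -
  let ?H = "{(\<lambda>\<omega>. v t \<omega> $ j) |j. j < m}"
  have "closed_sq_subspace M {f \<in> sq_int M. \<forall>h\<in>?H. (\<integral>\<omega>. f \<omega> * h \<omega> \<partial>M) = 0}"
    by (rule closed_sq_subspace_orthogonal) (auto intro: v_sq_int)
  hence "joint.past_span t \<subseteq> {f \<in> sq_int M. \<forall>h\<in>?H. (\<integral>\<omega>. f \<omega> * h \<omega> \<partial>M) = 0}"
    unfolding joint.past_span_def
    by (rule closed_span_least) (auto intro: joint.gen_sq_int v_orthogonal_gen)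
  hence "(\<integral>\<omega>. v t \<omega> $ j * f \<omega> \<partial>M) = 0" if "j < m" for j
    using f that by (auto simp: mult.commute[of "v t _ $ _"])
  thus ?thesis
    using integral_scalar_prod[of M "v t" m f k] v_carrier v_sq_int joint.past_sq_int[OF f] by simp
qed

lemma x_v_uncorrelated:
  assumes g: "g \<in> carrier_vec nx" and k: "k \<in> carrier_vec m"
  shows "(\<integral>\<omega>. (g \<bullet> x t \<omega>) * (k \<bullet> v t \<omega>) \<partial>M) = 0"
proof -
  fix \<sigma> :: 's
  have xv: "(\<integral>\<omega>. x t \<omega> $ i * v t \<omega> $ j \<partial>M) = 0" if i: "i < nx" and j: "j < m" for i j
  proof -
    have ux: "(\<lambda>\<omega>. x t \<omega> $ i) \<in> joint.nonanticipating t" and uv: "(\<lambda>\<omega>. v t \<omega> $ j) \<in> joint.nonanticipating t"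
    proof -
      have "(\<lambda>\<omega>. x t \<omega> $ i) \<in> joint.present_span t"
      proof (rule closed_sq_subspace_cong_AE[OF joint.present_span_closed joint.gen_present[of i "[]"]])
        show "AE \<omega> in M. joint.gen [] i t \<omega> = x t \<omega> $ i"
          using i by (intro AE_I2) (simp add: joint.gen_def append_x del: index_append_vec)
      qed (use i sq_int_measurable[OF x_sq_int] in auto)
      moreover have "(\<lambda>\<omega>. v t \<omega> $ j) \<in> joint.present_span t"
      proof (rule closed_sq_subspace_cong_AE[OF joint.present_span_closed joint.gen_present[of "nx + j" "[]"]])
        show "AE \<omega> in M. joint.gen [] (nx + j) t \<omega> = v t \<omega> $ j"
          using j by (intro AE_I2) (simp add: joint.gen_def append_v del: index_append_vec)
      qed (use j sq_int_measurable[OF v_sq_int] in auto)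
      ultimately show "(\<lambda>\<omega>. x t \<omega> $ i) \<in> joint.nonanticipating t" "(\<lambda>\<omega>. v t \<omega> $ j) \<in> joint.nonanticipating t"
        using joint.present_sub_nonanticipating by blast+
    qed
    have "cross_moment M nx m (zproc \<mu> p x [\<sigma>] (t + 1)) (zproc \<mu> p v [\<sigma>] (t + 1)) $$ (i, j) = 0"
      using sys i j by (simp add: asLPV_SSA_def)
    hence "(\<integral>\<omega>. zproc \<mu> p x [\<sigma>] (t + 1) \<omega> $ i * zproc \<mu> p v [\<sigma>] (t + 1) \<omega> $ j \<partial>M) = 0"
      using i j by (simp add: cross_moment_def)
    also have "(\<integral>\<omega>. zproc \<mu> p x [\<sigma>] (t + 1) \<omega> $ i * zproc \<mu> p v [\<sigma>] (t + 1) \<omega> $ j \<partial>M)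
      = (\<integral>\<omega>. (1 / p \<sigma>) * ((x t \<omega> $ i * \<mu> \<sigma> t \<omega>) * (v t \<omega> $ j * \<mu> \<sigma> t \<omega>)) \<partial>M)"
      using i j p_pos[of \<sigma>] by (intro Bochner_Integration.integral_cong refl)
        (simp add: zproc_entry[of x nx] zproc_entry[of v m] x_carrier v_carrier sched_word_Cons)
    also have "\<dots> = (1 / p \<sigma>) * (p \<sigma> * (\<integral>\<omega>. x t \<omega> $ i * v t \<omega> $ j \<partial>M))"
      using joint.moment[OF ux uv, of \<sigma> \<sigma>] by simp
    finally show ?thesis using p_pos[of \<sigma>] by simp
  qed
  have "(\<integral>\<omega>. x t \<omega> $ i * (k \<bullet> v t \<omega>) \<partial>M) = 0" if i: "i < nx" for i
    using integral_scalar_prod[of M "v t" m "\<lambda>\<omega>. x t \<omega> $ i" k] v_carrier v_sq_int x_sq_int[OF i] xv[OF i]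
    by (simp add: mult.commute)
  thus ?thesis
    using integral_scalar_prod[of M "x t" nx "\<lambda>\<omega>. k \<bullet> v t \<omega>" g] x_carrier x_sq_int kv_sq_int by simp
qed

lemma state_equation:
  assumes g: "g \<in> carrier_vec nx"
  shows "AE \<omega> in M. g \<bullet> x (t + 1) \<omega>
    = (\<Sum>\<sigma>\<in>UNIV. lin (transpose_mat (A \<sigma>) *\<^sub>v g) (transpose_mat (K \<sigma>) *\<^sub>v g) t \<omega> * \<mu> \<sigma> t \<omega>)"
proof -
  have "AE \<omega> in M. x (t + 1) \<omega> = vec nx (\<lambda>j. \<Sum>\<sigma>\<in>UNIV. (A \<sigma> *\<^sub>v x t \<omega> + K \<sigma> *\<^sub>v v t \<omega>) $ j * \<mu> \<sigma> t \<omega>)"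
    using sys by (simp add: asLPV_SSA_def)
  moreover have "AE \<omega> in M. \<omega> \<in> space M" by simp
  ultimately show ?thesis
  proof eventually_elim
    case (elim \<omega>)
    note xc = x_carrier[OF elim(2), of t] and vc = v_carrier[OF elim(2), of t]
    have z: "A \<sigma> *\<^sub>v x t \<omega> + K \<sigma> *\<^sub>v v t \<omega> \<in> carrier_vec nx" for \<sigma>
      using carriers(1,2)[of \<sigma>] xc vc by simp
    have "g \<bullet> x (t + 1) \<omega> = (\<Sum>j<nx. \<Sum>\<sigma>\<in>UNIV. g $ j * ((A \<sigma> *\<^sub>v x t \<omega> + K \<sigma> *\<^sub>v v t \<omega>) $ j * \<mu> \<sigma> t \<omega>))"
      unfolding elim(1) by (simp add: scalar_prod_def atLeast0LessThan sum_distrib_left)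
    also have "\<dots> = (\<Sum>\<sigma>\<in>UNIV. \<Sum>j<nx. g $ j * ((A \<sigma> *\<^sub>v x t \<omega> + K \<sigma> *\<^sub>v v t \<omega>) $ j * \<mu> \<sigma> t \<omega>))"
      by (rule sum.swap)
    also have "\<dots> = (\<Sum>\<sigma>\<in>UNIV. (g \<bullet> (A \<sigma> *\<^sub>v x t \<omega> + K \<sigma> *\<^sub>v v t \<omega>)) * \<mu> \<sigma> t \<omega>)"
      by (intro sum.cong refl) (simp add: scalar_prod_def carrier_vecD[OF z] atLeast0LessThan sum_distrib_right mult.assoc del: index_add_vec)
    also have "\<dots> = (\<Sum>\<sigma>\<in>UNIV. lin (transpose_mat (A \<sigma>) *\<^sub>v g) (transpose_mat (K \<sigma>) *\<^sub>v g) t \<omega> * \<mu> \<sigma> t \<omega>)"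
    proof (intro sum.cong refl)
      fix \<sigma>
      have "g \<bullet> (A \<sigma> *\<^sub>v x t \<omega> + K \<sigma> *\<^sub>v v t \<omega>) = g \<bullet> (A \<sigma> *\<^sub>v x t \<omega>) + g \<bullet> (K \<sigma> *\<^sub>v v t \<omega>)"
        using carriers(1,2)[of \<sigma>] xc vc g by (intro scalar_prod_add_distrib[of _ nx]) auto
      also have "\<dots> = lin (transpose_mat (A \<sigma>) *\<^sub>v g) (transpose_mat (K \<sigma>) *\<^sub>v g) t \<omega>"
        unfolding lin_def using transpose_vec_mult_scalar[OF carriers(1) xc g, of \<sigma>]
          transpose_vec_mult_scalar[OF carriers(2) vc g, of \<sigma>] by simp
      finally show "(g \<bullet> (A \<sigma> *\<^sub>v x t \<omega> + K \<sigma> *\<^sub>v v t \<omega>)) * \<mu> \<sigma> t \<omega>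
        = lin (transpose_mat (A \<sigma>) *\<^sub>v g) (transpose_mat (K \<sigma>) *\<^sub>v g) t \<omega> * \<mu> \<sigma> t \<omega>" by simp
    qed
    finally show ?case .
  qed
qed

lemma lin_next_present:
  assumes g: "g \<in> carrier_vec nx"
  shows "lin (transpose_mat (A \<sigma>) *\<^sub>v g) (transpose_mat (K \<sigma>) *\<^sub>v g) t \<in> joint.nonanticipating t"
  using lin_present[of "transpose_mat (A \<sigma>) *\<^sub>v g" "transpose_mat (K \<sigma>) *\<^sub>v g" t]
    joint.present_sub_nonanticipating[of t] carriers(1,2)[of \<sigma>] g by auto

text \<open>
  Of the sum over letters in the state equation only the letter \<open>\<sigma>\<close> survives, by \<open>moment\<close>.
\<close>

lemma state_moment:
  assumes g: "g \<in> carrier_vec nx" and f: "f \<in> joint.present_span t"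
  shows "(\<integral>\<omega>. (g \<bullet> x (t + 1) \<omega>) * (f \<omega> * \<mu> \<sigma> t \<omega>) \<partial>M)
    = p \<sigma> * (\<integral>\<omega>. lin (transpose_mat (A \<sigma>) *\<^sub>v g) (transpose_mat (K \<sigma>) *\<^sub>v g) t \<omega> * f \<omega> \<partial>M)"
proof -
  let ?l = "\<lambda>\<tau>. lin (transpose_mat (A \<tau>) *\<^sub>v g) (transpose_mat (K \<tau>) *\<^sub>v g) t"
  have fN: "f \<in> joint.nonanticipating t" using f joint.present_sub_nonanticipating by blast
  note lN = lin_next_present[OF g, of _ t]
  note fm = joint.mult_sq_int[OF fN, of \<sigma>] and lm = joint.mult_sq_int[OF lN]
  have "(\<integral>\<omega>. (g \<bullet> x (t + 1) \<omega>) * (f \<omega> * \<mu> \<sigma> t \<omega>) \<partial>M)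
     = (\<integral>\<omega>. (\<Sum>\<tau>\<in>UNIV. (?l \<tau> \<omega> * \<mu> \<tau> t \<omega>) * (f \<omega> * \<mu> \<sigma> t \<omega>)) \<partial>M)"
  proof (rule integral_cong_AE)
    show "AE \<omega> in M. (g \<bullet> x (t + 1) \<omega>) * (f \<omega> * \<mu> \<sigma> t \<omega>) = (\<Sum>\<tau>\<in>UNIV. (?l \<tau> \<omega> * \<mu> \<tau> t \<omega>) * (f \<omega> * \<mu> \<sigma> t \<omega>))"
      using state_equation[OF g, of t] by eventually_elim (simp add: sum_distrib_right)
  qed (use sq_int_measurable[OF gx_sq_int, of g "t + 1"] sq_int_measurable[OF fm] sq_int_measurable[OF lm] in
      \<open>auto intro!: borel_measurable_sum borel_measurable_times\<close>)
  also have "\<dots> = (\<Sum>\<tau>\<in>UNIV. \<integral>\<omega>. (?l \<tau> \<omega> * \<mu> \<tau> t \<omega>) * (f \<omega> * \<mu> \<sigma> t \<omega>) \<partial>M)"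
    by (rule Bochner_Integration.integral_sum) (rule sq_int_mult_integrable[OF lm fm])
  also have "\<dots> = (\<Sum>\<tau>\<in>UNIV. if \<tau> = \<sigma> then p \<tau> * (\<integral>\<omega>. ?l \<tau> \<omega> * f \<omega> \<partial>M) else 0)"
    by (simp only: joint.moment[OF lN fN])
  also have "\<dots> = p \<sigma> * (\<integral>\<omega>. ?l \<sigma> \<omega> * f \<omega> \<partial>M)" by simp
  finally show ?thesis .
qed

lemma integral_lin:
  assumes f: "f \<in> sq_int M"
  shows "(\<integral>\<omega>. lin g k t \<omega> * f \<omega> \<partial>M) = (\<integral>\<omega>. (g \<bullet> x t \<omega>) * f \<omega> \<partial>M) + (\<integral>\<omega>. (k \<bullet> v t \<omega>) * f \<omega> \<partial>M)"
  unfolding lin_def distrib_right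
  using sq_int_mult_integrable[OF gx_sq_int f] sq_int_mult_integrable[OF kv_sq_int f] by simp

lemma state_moment_past:
  assumes g: "g \<in> carrier_vec nx" and f: "f \<in> joint.past_span t"
  shows "(\<integral>\<omega>. (g \<bullet> x (t + 1) \<omega>) * (f \<omega> * \<mu> \<sigma> t \<omega>) \<partial>M) = p \<sigma> * (\<integral>\<omega>. ((transpose_mat (A \<sigma>) *\<^sub>v g) \<bullet> x t \<omega>) * f \<omega> \<partial>M)"
  using state_moment[OF g, of f t \<sigma>] f joint.past_sub_present[of t] v_orthogonal_past[OF f]
    integral_lin[OF joint.past_sq_int[OF f]] by auto

text \<open>
  Along a word the noise drops out at every step, because each partial product stays in the past span of the time it has
  reached.
\<close>

lemma state_moment_word:
  "g \<in> carrier_vec nx \<Longrightarrow> f \<in> joint.past_span t \<Longrightarrow>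
    (\<integral>\<omega>. (g \<bullet> x (t + int (length s)) \<omega>) * (f \<omega> * sched_word \<mu> s (t + int (length s) - 1) \<omega>) \<partial>M)
    = word_weight p s * (\<integral>\<omega>. ((transpose_mat (word_mat nx A s) *\<^sub>v g) \<bullet> x t \<omega>) * f \<omega> \<partial>M)"
proof (induction s arbitrary: f t)
  case Nil
  thus ?case by simp
next
  case (Cons \<sigma> s)
  have f1: "(\<lambda>\<omega>. f \<omega> * \<mu> \<sigma> t \<omega>) \<in> joint.past_span (t + 1)"
    using joint.mult_past_span[of f t \<sigma>] Cons.prems(2) joint.past_sub_present by blast
  let ?g = "transpose_mat (word_mat nx A s) *\<^sub>v g"
  have gc: "?g \<in> carrier_vec nx" using Cons.prems(1) W_carrier[of s] by simp
  have "(\<integral>\<omega>. (g \<bullet> x (t + int (length (\<sigma> # s))) \<omega>) * (f \<omega> * sched_word \<mu> (\<sigma> # s) (t + int (length (\<sigma> # s)) - 1) \<omega>) \<partial>M)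
      = (\<integral>\<omega>. (g \<bullet> x (t + 1 + int (length s)) \<omega>) * ((f \<omega> * \<mu> \<sigma> t \<omega>) * sched_word \<mu> s (t + 1 + int (length s) - 1) \<omega>) \<partial>M)"
    by (simp add: sched_word_Cons ac_simps)
  also have "\<dots> = word_weight p s * (\<integral>\<omega>. (?g \<bullet> x (t + 1) \<omega>) * (f \<omega> * \<mu> \<sigma> t \<omega>) \<partial>M)"
    by (rule Cons.IH[OF Cons.prems(1) f1])
  also have "\<dots> = word_weight p s * (p \<sigma> * (\<integral>\<omega>. ((transpose_mat (A \<sigma>) *\<^sub>v ?g) \<bullet> x t \<omega>) * f \<omega> \<partial>M))"
    by (simp only: state_moment_past[OF gc Cons.prems(2)])
  also have "transpose_mat (A \<sigma>) *\<^sub>v ?g = transpose_mat (word_mat nx A (\<sigma> # s)) *\<^sub>v g"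
    using carriers(1)[of \<sigma>] W_carrier[of s] Cons.prems(1) by (simp add: transpose_mult[OF W_carrier carriers(1)])
  finally show ?case by (simp add: mult.assoc mult.left_commute)
qed

lemma output_equation:
  assumes i: "i < ny"
  shows "AE \<omega> in M. y t \<omega> $ i = lin (row C i) (row F i) t \<omega>"
proof -
  have "AE \<omega> in M. y t \<omega> = C *\<^sub>v x t \<omega> + F *\<^sub>v v t \<omega>" using sys by (simp add: asLPV_SSA_def)
  thus ?thesis by eventually_elim (use i carriers(3,4) in \<open>simp add: lin_def\<close>)
qed

lemma output_present:
  assumes i: "i < ny"
  shows "(\<lambda>\<omega>. y t \<omega> $ i) \<in> joint.present_span t"
proof (rule closed_sq_subspace_cong_AE[OF joint.present_span_closed lin_present])
  show "AE \<omega> in M. lin (row C i) (row F i) t \<omega> = y t \<omega> $ i"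
    using output_equation[OF i, of t] by eventually_elim simp
  show "row C i \<in> carrier_vec nx" "row F i \<in> carrier_vec m"
    using i carriers(3,4) by (auto intro: row_carrier_vec)
qed (rule y_measurable[OF i])

lemma output_moment_word:
  assumes i: "i < ny" and f: "f \<in> joint.past_span t"
  shows "(\<integral>\<omega>. y (t + int (length s)) \<omega> $ i * (f \<omega> * sched_word \<mu> s (t + int (length s) - 1) \<omega>) \<partial>M)
    = word_weight p s * (row (C * word_mat nx A s) i \<bullet> vec nx (\<lambda>k. \<integral>\<omega>. x t \<omega> $ k * f \<omega> \<partial>M))"
proof -
  let ?f = "\<lambda>\<omega>. f \<omega> * sched_word \<mu> s (t + int (length s) - 1) \<omega>"
  note fp = joint.mult_word_past'[OF f, of s]
  have Ci: "row C i \<in> carrier_vec nx" using carriers(3) i by (intro row_carrier_vec)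
  have "(\<integral>\<omega>. y (t + int (length s)) \<omega> $ i * ?f \<omega> \<partial>M) = (\<integral>\<omega>. lin (row C i) (row F i) (t + int (length s)) \<omega> * ?f \<omega> \<partial>M)"
  proof (rule integral_cong_AE)
    show "AE \<omega> in M. y (t + int (length s)) \<omega> $ i * ?f \<omega> = lin (row C i) (row F i) (t + int (length s)) \<omega> * ?f \<omega>"
      using output_equation[OF i, of "t + int (length s)"] by eventually_elim simp
    show "(\<lambda>\<omega>. y (t + int (length s)) \<omega> $ i * ?f \<omega>) \<in> borel_measurable M"
      by (intro borel_measurable_times[OF y_measurable[OF i]] sq_int_measurable[OF joint.past_sq_int[OF fp]])
    have "lin (row C i) (row F i) (t + int (length s)) \<in> borel_measurable M"
      unfolding lin_def[abs_def] by (intro borel_measurable_add sq_int_measurable[OF gx_sq_int] sq_int_measurable[OF kv_sq_int])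
    thus "(\<lambda>\<omega>. lin (row C i) (row F i) (t + int (length s)) \<omega> * ?f \<omega>) \<in> borel_measurable M"
      by (intro borel_measurable_times sq_int_measurable[OF joint.past_sq_int[OF fp]])
  qed
  also have "\<dots> = (\<integral>\<omega>. (row C i \<bullet> x (t + int (length s)) \<omega>) * ?f \<omega> \<partial>M)"
    using integral_lin[OF joint.past_sq_int[OF fp]] v_orthogonal_past[OF fp] by simp
  also have "\<dots> = word_weight p s * (\<integral>\<omega>. ((transpose_mat (word_mat nx A s) *\<^sub>v row C i) \<bullet> x t \<omega>) * f \<omega> \<partial>M)"
    by (rule state_moment_word[OF Ci f])
  also have "transpose_mat (word_mat nx A s) *\<^sub>v row C i = row (C * word_mat nx A s) i"
    using i carriers(3) W_carrier[of s] Ci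
    by (intro eq_vecI) (auto simp: comm_scalar_prod[of _ nx])
  also have "(\<integral>\<omega>. (row (C * word_mat nx A s) i \<bullet> x t \<omega>) * f \<omega> \<partial>M)
     = row (C * word_mat nx A s) i \<bullet> vec nx (\<lambda>k. \<integral>\<omega>. x t \<omega> $ k * f \<omega> \<partial>M)"
    using integral_scalar_prod[of M "x t" nx f] x_carrier x_sq_int joint.past_sq_int[OF f]
    by (simp add: scalar_prod_def atLeast0LessThan)
  finally show ?thesis .
qed

lemma output_past:
  "{(\<lambda>\<omega>. zproc \<mu> p y w t \<omega> $ j) |w j. w \<noteq> [] \<and> j < ny} \<subseteq> joint.past_span t"
proof safe
    fix w :: "'s list" and j assume w: "w \<noteq> []" and j: "j < ny"
    let ?t = "t - int (length w)"
    have "(\<lambda>\<omega>. y ?t \<omega> $ j * sched_word \<mu> w (t - 1) \<omega>) \<in> joint.past_span t"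
      using joint.mult_word_past[OF output_present[OF j, of ?t] w] by simp
    hence P: "(\<lambda>\<omega>. (1 / sqrt (word_weight p w)) * (y ?t \<omega> $ j * sched_word \<mu> w (t - 1) \<omega>)) \<in> joint.past_span t"
      by (rule closed_sq_subspaceD(4)[OF joint.past_span_closed])
    have eq: "(1 / sqrt (word_weight p w)) * (y ?t \<omega> $ j * sched_word \<mu> w (t - 1) \<omega>) = zproc \<mu> p y w t \<omega> $ j" if "\<omega> \<in> space M" for \<omega>
      using zproc_entry[of y ny \<omega> j w t] y_carrier that j by simp
    show "(\<lambda>\<omega>. zproc \<mu> p y w t \<omega> $ j) \<in> joint.past_span t"
    proof (rule closed_sq_subspace_cong_AE[OF joint.past_span_closed P])
      show "(\<lambda>\<omega>. zproc \<mu> p y w t \<omega> $ j) \<in> borel_measurable M"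
        using sq_int_measurable[OF joint.past_sq_int[OF P]] by (subst measurable_cong[OF eq[symmetric]])
    qed (rule AE_I2[OF eq])
qed

text \<open>
  This holds in every realization of \<open>y\<close>, whatever its noise process is, since \<open>e\<close> is a limit of linear combinations of
  present and past outputs and these are linear in the state and noise of the realization.
\<close>

lemma innovation_present:
  assumes inn: "innovation_process M \<mu> p ny y e" and i: "i < ny"
  shows "(\<lambda>\<omega>. e t \<omega> $ i) \<in> joint.present_span t"
proof -
  let ?S = "{(\<lambda>\<omega>. zproc \<mu> p y w t \<omega> $ j) |w j. w \<noteq> [] \<and> j < ny}"
  have sub: "closed_span M ?S \<subseteq> joint.present_span t"
    using closed_span_least[OF joint.past_span_closed output_past] joint.past_sub_present by blast
  obtain g where g: "orth_projection M (closed_span M ?S) (\<lambda>\<omega>. y t \<omega> $ i) g"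
    and ae: "AE \<omega> in M. e t \<omega> $ i = y t \<omega> $ i - g \<omega>"
    using inn i unfolding innovation_process_def by blast
  have "g \<in> joint.present_span t" using g sub by (auto simp: orth_projection_def)
  hence "(\<lambda>\<omega>. y t \<omega> $ i - g \<omega>) \<in> joint.present_span t"
    by (rule closed_sq_subspace_diff[OF joint.present_span_closed output_present[OF i]])
  thus ?thesis
  proof (rule closed_sq_subspace_cong_AE[OF joint.present_span_closed])
    show "AE \<omega> in M. y t \<omega> $ i - g \<omega> = e t \<omega> $ i" using ae by eventually_elim simp
    show "(\<lambda>\<omega>. e t \<omega> $ i) \<in> borel_measurable M" using inn i by (simp add: innovation_process_def vec_process_def)
  qed
qed

end

section \<open>The state lies in the reachable subspace\<close>

context lpv_realization
begin

lemma innovation_unique: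
  assumes e: "innovation_process M \<mu> p ny y e" and e': "innovation_process M \<mu> p ny y e'" and i: "i < ny"
  shows "AE \<omega> in M. e t \<omega> $ i = e' t \<omega> $ i"
proof -
  let ?S = "{(\<lambda>\<omega>. zproc \<mu> p y w t \<omega> $ j) |w j. w \<noteq> [] \<and> j < ny}"
  let ?V = "closed_span M ?S"
  have V: "closed_sq_subspace M ?V"
    by (rule closed_span_closed) (use output_past joint.past_sq_int in blast)
  obtain g where g: "orth_projection M ?V (\<lambda>\<omega>. y t \<omega> $ i) g" and eg: "AE \<omega> in M. e t \<omega> $ i = y t \<omega> $ i - g \<omega>"
    using e i unfolding innovation_process_def by blast
  obtain g' where g': "orth_projection M ?V (\<lambda>\<omega>. y t \<omega> $ i) g'" and eg': "AE \<omega> in M. e' t \<omega> $ i = y t \<omega> $ i - g' \<omega>"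
    using e' i unfolding innovation_process_def by blast
  define h where "h \<omega> = g \<omega> - g' \<omega>" for \<omega>
  have gV: "g \<in> ?V" "g' \<in> ?V" using g g' by (auto simp: orth_projection_def)
  have hV: "h \<in> ?V" unfolding h_def[abs_def] by (rule closed_sq_subspace_diff[OF V gV])
  have sq: "(\<lambda>\<omega>. y t \<omega> $ i) \<in> sq_int M" "g \<in> sq_int M" "g' \<in> sq_int M" "h \<in> sq_int M"
    using joint.present_sq_int[OF output_present[OF i]] closed_sq_subspaceD(1)[OF V] gV hV by auto
  have 0: "(\<integral>\<omega>. (y t \<omega> $ i - g \<omega>) * h \<omega> \<partial>M) = 0" "(\<integral>\<omega>. (y t \<omega> $ i - g' \<omega>) * h \<omega> \<partial>M) = 0"
    using g g' hV by (auto simp: orth_projection_def)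
  have "(\<integral>\<omega>. (h \<omega>)\<^sup>2 \<partial>M) = (\<integral>\<omega>. (y t \<omega> $ i - g' \<omega>) * h \<omega> - (y t \<omega> $ i - g \<omega>) * h \<omega> \<partial>M)"
    by (intro Bochner_Integration.integral_cong refl) (simp add: h_def power2_eq_square algebra_simps)
  also have "\<dots> = 0"
    using 0 sq_int_mult_integrable[OF sq_int_diff[OF sq(1,2)] sq(4)] sq_int_mult_integrable[OF sq_int_diff[OF sq(1,3)] sq(4)]
    by simp
  finally have "AE \<omega> in M. (h \<omega>)\<^sup>2 = 0"
    using integral_nonneg_eq_0_iff_AE[of M "\<lambda>\<omega>. (h \<omega>)\<^sup>2"] sq(4) by (simp add: sq_int_def)
  with eg eg' show ?thesis by eventually_elim (simp add: h_def)
qed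

text \<open>
  The combination \<open>c\<close> isolates one noise component: it has covariance \<open>1\<close> with component \<open>j\<close> and \<open>0\<close> with the others. Carried
  along \<open>\<sigma>s\<close>, it is therefore correlated with the later state through a single column of \<open>A\<^sub>s K\<^sub>\<sigma>\<close>.
\<close>

lemma state_probe:
  assumes c: "c \<in> carrier_vec m" and j: "j < m"
    and dual: "\<And>k. k < m \<Longrightarrow> (\<integral>\<omega>. v t \<omega> $ k * (c \<bullet> v t \<omega>) \<partial>M) = (if k = j then 1 else 0)"
  shows "vec nx (\<lambda>k. \<integral>\<omega>. x (t + 1 + int (length s)) \<omega> $ k
        * ((c \<bullet> v t \<omega>) * \<mu> \<sigma> t \<omega> * sched_word \<mu> s (t + 1 + int (length s) - 1) \<omega>) \<partial>M)
     = (word_weight p s * p \<sigma>) \<cdot>\<^sub>v col (word_mat nx A s * K \<sigma>) j"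
proof (rule eq_vecI)
  let ?W = "word_mat nx A s"
  have WK: "?W * K \<sigma> \<in> carrier_mat nx m" using W_carrier[of s] carriers(2)[of \<sigma>] by simp
  fix k assume "k < dim_vec ((word_weight p s * p \<sigma>) \<cdot>\<^sub>v col (?W * K \<sigma>) j)"
  hence k: "k < nx" using WK W_carrier[of s] by simp
  let ?f = "\<lambda>\<omega>. (c \<bullet> v t \<omega>) * \<mu> \<sigma> t \<omega>"
  let ?u = "unit_vec nx k :: real vec"
  let ?g = "transpose_mat ?W *\<^sub>v ?u"
  have g: "?g \<in> carrier_vec nx" using W_carrier[of s] by simp
  note cp = kv_present[OF c, of t]
  have "(\<integral>\<omega>. x (t + 1 + int (length s)) \<omega> $ k * (?f \<omega> * sched_word \<mu> s (t + 1 + int (length s) - 1) \<omega>) \<partial>M)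
      = (\<integral>\<omega>. (?u \<bullet> x (t + 1 + int (length s)) \<omega>) * (?f \<omega> * sched_word \<mu> s (t + 1 + int (length s) - 1) \<omega>) \<partial>M)"
    by (intro Bochner_Integration.integral_cong refl) (simp add: scalar_prod_left_unit[OF x_carrier k])
  also have "\<dots> = word_weight p s * (\<integral>\<omega>. (?g \<bullet> x (t + 1) \<omega>) * ?f \<omega> \<partial>M)"
    by (rule state_moment_word[OF unit_vec_carrier joint.mult_past_span[OF cp]])
  also have "(\<integral>\<omega>. (?g \<bullet> x (t + 1) \<omega>) * ?f \<omega> \<partial>M)
      = p \<sigma> * (\<integral>\<omega>. lin (transpose_mat (A \<sigma>) *\<^sub>v ?g) (transpose_mat (K \<sigma>) *\<^sub>v ?g) t \<omega> * (c \<bullet> v t \<omega>) \<partial>M)"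
    by (rule state_moment[OF g cp])
  also have "(\<integral>\<omega>. lin (transpose_mat (A \<sigma>) *\<^sub>v ?g) (transpose_mat (K \<sigma>) *\<^sub>v ?g) t \<omega> * (c \<bullet> v t \<omega>) \<partial>M)
      = (\<integral>\<omega>. ((transpose_mat (K \<sigma>) *\<^sub>v ?g) \<bullet> v t \<omega>) * (c \<bullet> v t \<omega>) \<partial>M)"
  proof -
    have "transpose_mat (A \<sigma>) *\<^sub>v ?g \<in> carrier_vec nx" using carriers(1)[of \<sigma>] g by simp
    from x_v_uncorrelated[OF this c] show ?thesis by (simp add: integral_lin[OF kv_sq_int])
  qed
  also have "\<dots> = (\<Sum>l<m. (transpose_mat (K \<sigma>) *\<^sub>v ?g) $ l * (if l = j then 1 else 0))"
    using integral_scalar_prod[of M "v t" m "\<lambda>\<omega>. c \<bullet> v t \<omega>"] v_carrier v_sq_int kv_sq_int dual by simp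
  also have "\<dots> = (transpose_mat (K \<sigma>) *\<^sub>v ?g) $ j" using j by (simp add: if_distrib[of "\<lambda>z. _ * z"] cong: if_cong)
  also have "transpose_mat (K \<sigma>) *\<^sub>v ?g = row (?W * K \<sigma>) k"
  proof -
    have "transpose_mat (K \<sigma>) *\<^sub>v ?g = transpose_mat (?W * K \<sigma>) *\<^sub>v ?u"
      using transpose_mult[OF W_carrier carriers(2)] carriers(2)[of \<sigma>] W_carrier[of s] by simp
    also have "\<dots> = col (transpose_mat (?W * K \<sigma>)) k"
      using WK k by (intro eq_vecI) (auto simp: scalar_prod_right_unit)
    also have "\<dots> = row (?W * K \<sigma>) k"
      by (rule col_transpose) (use carrier_matD(1)[OF W_carrier] k in simp)
    finally show ?thesis .
  qed
  finally show "vec nx (\<lambda>k. \<integral>\<omega>. x (t + 1 + int (length s)) \<omega> $ k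
        * ((c \<bullet> v t \<omega>) * \<mu> \<sigma> t \<omega> * sched_word \<mu> s (t + 1 + int (length s) - 1) \<omega>) \<partial>M) $ k
     = ((word_weight p s * p \<sigma>) \<cdot>\<^sub>v col (?W * K \<sigma>) j) $ k"
    using k j WK W_carrier[of s] carriers(2)[of \<sigma>] by simp
qed (use W_carrier[of s] carriers(2)[of \<sigma>] in simp)

text \<open>
  The noise does not contribute to \<open>g \<bullet> x(t + 1)\<close>, and the contributions of different letters are orthogonal.
\<close>

lemma energy_step:
  assumes g: "g \<in> carrier_vec nx" and K0: "\<And>\<sigma>. transpose_mat (K \<sigma>) *\<^sub>v g = 0\<^sub>v m"
  shows "(\<integral>\<omega>. (g \<bullet> x (t + 1) \<omega>)\<^sup>2 \<partial>M) = (\<Sum>\<sigma>\<in>UNIV. p \<sigma> * (\<integral>\<omega>. ((transpose_mat (A \<sigma>) *\<^sub>v g) \<bullet> x t \<omega>)\<^sup>2 \<partial>M))"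
proof -
  let ?l = "\<lambda>\<sigma> \<omega>. (transpose_mat (A \<sigma>) *\<^sub>v g) \<bullet> x t \<omega>"
  have lN: "?l \<sigma> \<in> joint.nonanticipating t" for \<sigma>
    using gx_present[of "transpose_mat (A \<sigma>) *\<^sub>v g" t] carriers(1)[of \<sigma>] g joint.present_sub_nonanticipating[of t] by auto
  note lm = joint.mult_sq_int[OF lN]
  have "(\<integral>\<omega>. (g \<bullet> x (t + 1) \<omega>)\<^sup>2 \<partial>M) = (\<integral>\<omega>. (\<Sum>\<sigma>\<in>UNIV. \<Sum>\<tau>\<in>UNIV. (?l \<sigma> \<omega> * \<mu> \<sigma> t \<omega>) * (?l \<tau> \<omega> * \<mu> \<tau> t \<omega>)) \<partial>M)"
  proof (rule integral_cong_AE)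
    have "AE \<omega> in M. \<omega> \<in> space M" by simp
    with state_equation[OF g, of t]
    show "AE \<omega> in M. (g \<bullet> x (t + 1) \<omega>)\<^sup>2 = (\<Sum>\<sigma>\<in>UNIV. \<Sum>\<tau>\<in>UNIV. (?l \<sigma> \<omega> * \<mu> \<sigma> t \<omega>) * (?l \<tau> \<omega> * \<mu> \<tau> t \<omega>))"
      by eventually_elim (simp add: power2_eq_square K0 lin_def v_carrier sum_product)
  qed (use sq_int_measurable[OF gx_sq_int] sq_int_measurable[OF lm] in
      \<open>auto intro!: borel_measurable_sum borel_measurable_times borel_measurable_power\<close>)
  also have "\<dots> = (\<Sum>\<sigma>\<in>UNIV. \<Sum>\<tau>\<in>UNIV. \<integral>\<omega>. (?l \<sigma> \<omega> * \<mu> \<sigma> t \<omega>) * (?l \<tau> \<omega> * \<mu> \<tau> t \<omega>) \<partial>M)"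
    using sq_int_mult_integrable[OF lm lm] by (simp add: Bochner_Integration.integral_sum)
  also have "\<dots> = (\<Sum>\<sigma>\<in>UNIV. p \<sigma> * (\<integral>\<omega>. (?l \<sigma> \<omega>)\<^sup>2 \<partial>M))"
    by (simp add: joint.moment[OF lN lN] power2_eq_square)
  finally show ?thesis .
qed

lemma energy_words:
  assumes h: "h \<in> carrier_vec nx"
    and ker: "\<And>s \<sigma>. transpose_mat (K \<sigma>) *\<^sub>v (transpose_mat (word_mat nx A s) *\<^sub>v h) = 0\<^sub>v m"
  shows "(\<integral>\<omega>. (h \<bullet> x t \<omega>)\<^sup>2 \<partial>M) = (\<Sum>s | length s = N. word_weight p s
     * (\<integral>\<omega>. ((transpose_mat (word_mat nx A s) *\<^sub>v h) \<bullet> x (t - int N) \<omega>)\<^sup>2 \<partial>M))"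
proof (induction N)
  case 0
  have "{s :: 's list. s = []} = {[]}" by auto
  thus ?case using h by simp
next
  case (Suc N)
  let ?g = "\<lambda>s. transpose_mat (word_mat nx A s) *\<^sub>v h"
  have g: "?g s \<in> carrier_vec nx" for s using W_carrier[of s] h by simp
  have step: "(\<integral>\<omega>. (?g s \<bullet> x (t - int N) \<omega>)\<^sup>2 \<partial>M)
      = (\<Sum>\<sigma>\<in>UNIV. p \<sigma> * (\<integral>\<omega>. (?g (\<sigma> # s) \<bullet> x (t - int (Suc N)) \<omega>)\<^sup>2 \<partial>M))" for s
  proof -
    have "transpose_mat (A \<sigma>) *\<^sub>v ?g s = ?g (\<sigma> # s)" for \<sigma>
      using carriers(1)[of \<sigma>] W_carrier[of s] h by (simp add: transpose_mult[OF W_carrier carriers(1)])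
    thus ?thesis using energy_step[OF g ker, of s "t - int (Suc N)"] by (simp add: algebra_simps)
  qed
  show ?case unfolding Suc.IH sum_words_Suc step sum_distrib_left
    by (subst sum.swap) (simp add: mult.assoc mult.left_commute)
qed

lemma state_stationary:
  assumes "i < nx" "j < nx"
  shows "(\<integral>\<omega>. x t \<omega> $ i * x t \<omega> $ j \<partial>M) = (\<integral>\<omega>. x 0 \<omega> $ i * x 0 \<omega> $ j \<partial>M)"
proof -
  let ?r = "\<lambda>t \<omega>. x t \<omega> @\<^sub>v v t \<omega>"
  have "cross_moment M (nx + m) (nx + m) (?r (0 + t)) (?r (0 + t)) = cross_moment M (nx + m) (nx + m) (?r 0) (?r 0)"
    using joint.zmwsii unfolding ZMWSII_def by blast
  hence "cross_moment M (nx + m) (nx + m) (?r t) (?r t) $$ (i, j) = cross_moment M (nx + m) (nx + m) (?r 0) (?r 0) $$ (i, j)"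
    by simp
  moreover have "cross_moment M (nx + m) (nx + m) (?r s) (?r s) $$ (i, j) = (\<integral>\<omega>. x s \<omega> $ i * x s \<omega> $ j \<partial>M)" for s
  proof -
    have "(\<integral>\<omega>. ?r s \<omega> $ i * ?r s \<omega> $ j \<partial>M) = (\<integral>\<omega>. x s \<omega> $ i * x s \<omega> $ j \<partial>M)"
      using append_x assms by (intro Bochner_Integration.integral_cong refl) (simp del: index_append_vec)
    thus ?thesis using assms by (simp add: cross_moment_def del: index_append_vec)
  qed
  ultimately show ?thesis by simp
qed

text \<open>
  The vectors \<open>h\<close> considered here are those orthogonal to the reachable subspace. By \<open>energy_words\<close> the second moment of
  \<open>h \<bullet> x(t)\<close> is a weighted sum over the words of length \<open>N\<close> of second moments of the state at time \<open>t - N\<close>. The latter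
  are constant by stationarity and the weights tend to \<open>0\<close> by stability.
\<close>

lemma state_in_reachable_space:
  assumes h: "h \<in> carrier_vec nx"
    and ker: "\<And>s \<sigma>. transpose_mat (K \<sigma>) *\<^sub>v (transpose_mat (word_mat nx A s) *\<^sub>v h) = 0\<^sub>v m"
  shows "AE \<omega> in M. h \<bullet> x t \<omega> = 0"
proof -
  let ?W = "word_mat nx A"
  define R where "R i j = (\<integral>\<omega>. x 0 \<omega> $ i * x 0 \<omega> $ j \<partial>M)" for i j
  have energy: "(\<integral>\<omega>. (g \<bullet> x s \<omega>)\<^sup>2 \<partial>M) = (\<Sum>i<nx. \<Sum>j<nx. g $ i * (g $ j * R i j))" for g s
  proof -
    have "(\<integral>\<omega>. x s \<omega> $ i * (g \<bullet> x s \<omega>) \<partial>M) = (\<Sum>j<nx. g $ j * R i j)" if i: "i < nx" for i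
    proof -
      have "(\<integral>\<omega>. (g \<bullet> x s \<omega>) * x s \<omega> $ i \<partial>M) = (\<Sum>j<nx. g $ j * (\<integral>\<omega>. x s \<omega> $ j * x s \<omega> $ i \<partial>M))"
        by (rule integral_scalar_prod[OF x_carrier x_sq_int x_sq_int[OF i]])
      also have "\<dots> = (\<Sum>j<nx. g $ j * R i j)"
        by (intro sum.cong refl) (use i in \<open>simp add: state_stationary[of _ _ s] R_def mult.commute\<close>)
      finally show ?thesis by (simp add: mult.commute)
    qed
    moreover have "(\<integral>\<omega>. (g \<bullet> x s \<omega>) * (g \<bullet> x s \<omega>) \<partial>M) = (\<Sum>i<nx. g $ i * (\<integral>\<omega>. x s \<omega> $ i * (g \<bullet> x s \<omega>) \<partial>M))"
      by (rule integral_scalar_prod[OF x_carrier x_sq_int gx_sq_int])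
    ultimately show ?thesis by (simp add: power2_eq_square sum_distrib_left)
  qed
  have gi: "(transpose_mat (?W s) *\<^sub>v h) $ i = (\<Sum>k<nx. ?W s $$ (k, i) * h $ k)" if "i < nx" for s i
    using W_carrier[of s] h that by (simp add: scalar_prod_def atLeast0LessThan)
  have eq: "(\<integral>\<omega>. (h \<bullet> x t \<omega>)\<^sup>2 \<partial>M) = (\<Sum>i<nx. \<Sum>j<nx. \<Sum>k<nx. \<Sum>l<nx. (R i j * h $ k * h $ l)
      * (\<Sum>s | length s = N. word_weight p s * ?W s $$ (k, i) * ?W s $$ (l, j)))" for N
  proof -
    have "(\<integral>\<omega>. (h \<bullet> x t \<omega>)\<^sup>2 \<partial>M) = (\<Sum>s | length s = N. \<Sum>i<nx. \<Sum>j<nx. \<Sum>k<nx. \<Sum>l<nx.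
        (R i j * h $ k * h $ l) * (word_weight p s * ?W s $$ (k, i) * ?W s $$ (l, j)))"
      unfolding energy_words[OF h ker, of t N] energy
    proof (intro sum.cong refl, unfold sum_distrib_left, intro sum.cong refl)
      fix s i j assume "i \<in> {..<nx}" "j \<in> {..<nx}"
      hence ij: "i < nx" "j < nx" by auto
      have "word_weight p s * ((transpose_mat (?W s) *\<^sub>v h) $ i * ((transpose_mat (?W s) *\<^sub>v h) $ j * R i j))
        = (\<Sum>k<nx. ?W s $$ (k, i) * h $ k) * (\<Sum>l<nx. ?W s $$ (l, j) * h $ l) * (word_weight p s * R i j)"
        unfolding gi[OF ij(1)] gi[OF ij(2)] by (simp add: mult_ac)
      also have "\<dots> = (\<Sum>k<nx. \<Sum>l<nx. (R i j * h $ k * h $ l) * (word_weight p s * ?W s $$ (k, i) * ?W s $$ (l, j)))"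
        unfolding sum_product unfolding sum_distrib_right by (intro sum.cong refl) (simp add: mult_ac)
      finally show "word_weight p s * ((transpose_mat (?W s) *\<^sub>v h) $ i * ((transpose_mat (?W s) *\<^sub>v h) $ j * R i j)) = \<dots>" .
    qed
    also have "\<dots> = (\<Sum>i<nx. \<Sum>j<nx. \<Sum>k<nx. \<Sum>l<nx. \<Sum>s | length s = N.
        (R i j * h $ k * h $ l) * (word_weight p s * ?W s $$ (k, i) * ?W s $$ (l, j)))"
      by ((rule trans[OF sum.swap], rule sum.cong[OF refl])+, rule refl)
    finally show ?thesis by (simp only: sum_distrib_left)
  qed
  have stable: "(\<lambda>N. \<Sum>s | length s = N. word_weight p s * ?W s $$ (k, i) * ?W s $$ (l, j)) \<longlonglongrightarrow> 0"
    if "i < nx" "j < nx" "k < nx" "l < nx" for i j k l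
    using stable_iff_words_tendsto_0[of A nx p, OF carriers(1)] sys that by (simp add: asLPV_SSA_def)
  have "(\<lambda>N. \<Sum>i<nx. \<Sum>j<nx. \<Sum>k<nx. \<Sum>l<nx. (R i j * h $ k * h $ l)
      * (\<Sum>s | length s = N. word_weight p s * ?W s $$ (k, i) * ?W s $$ (l, j))) \<longlonglongrightarrow> 0"
    by (intro tendsto_null_sum tendsto_mult_right_zero stable) auto
  hence "(\<lambda>N::nat. \<integral>\<omega>. (h \<bullet> x t \<omega>)\<^sup>2 \<partial>M) \<longlonglongrightarrow> 0"
    by (simp only: eq[symmetric])
  hence "(\<integral>\<omega>. (h \<bullet> x t \<omega>)\<^sup>2 \<partial>M) = 0" using LIMSEQ_unique tendsto_const by blast
  hence "AE \<omega> in M. (h \<bullet> x t \<omega>)\<^sup>2 = 0"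
    using integral_nonneg_eq_0_iff_AE[of M "\<lambda>\<omega>. (h \<bullet> x t \<omega>)\<^sup>2"] gx_sq_int by (simp add: sq_int_def)
  thus ?thesis by eventually_elim simp
qed

end

section \<open>Linear images of realizations\<close>

lemma cross_moment_linear_image:
  assumes X: "\<And>\<omega>. \<omega> \<in> space M \<Longrightarrow> X \<omega> \<in> carrier_vec n" "\<And>i. i < n \<Longrightarrow> (\<lambda>\<omega>. X \<omega> $ i) \<in> sq_int M"
    and Y: "\<And>\<omega>. \<omega> \<in> space M \<Longrightarrow> Y \<omega> \<in> carrier_vec m" "\<And>j. j < m \<Longrightarrow> (\<lambda>\<omega>. Y \<omega> $ j) \<in> sq_int M"
    and B: "B \<in> carrier_mat n' n" and D: "D \<in> carrier_mat m' m"
    and X': "\<And>\<omega>. \<omega> \<in> space M \<Longrightarrow> X' \<omega> = B *\<^sub>v X \<omega>" and Y': "\<And>\<omega>. \<omega> \<in> space M \<Longrightarrow> Y' \<omega> = D *\<^sub>v Y \<omega>"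
  shows "cross_moment M n' m' X' Y' = B * cross_moment M n m X Y * transpose_mat D"
proof (rule eq_matI)
  let ?G = "cross_moment M n m X Y"
  have G: "?G \<in> carrier_mat n m" by (simp add: cross_moment_def)
  fix i j assume "i < dim_row (B * ?G * transpose_mat D)" "j < dim_col (B * ?G * transpose_mat D)"
  hence ij: "i < n'" "j < m'" using B D by auto
  have XY: "(\<integral>\<omega>. X \<omega> $ a * (row D j \<bullet> Y \<omega>) \<partial>M) = (\<Sum>b<m. D $$ (j, b) * ?G $$ (a, b))" if a: "a < n" for a
  proof -
    have "(\<integral>\<omega>. (row D j \<bullet> Y \<omega>) * X \<omega> $ a \<partial>M) = (\<Sum>b<m. row D j $ b * (\<integral>\<omega>. Y \<omega> $ b * X \<omega> $ a \<partial>M))"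
      by (rule integral_scalar_prod[OF Y X(2)[OF a]])
    also have "\<dots> = (\<Sum>b<m. D $$ (j, b) * ?G $$ (a, b))"
      using a ij D by (intro sum.cong refl) (simp add: cross_moment_def mult.commute)
    finally show ?thesis by (simp add: mult.commute)
  qed
  have "cross_moment M n' m' X' Y' $$ (i, j) = (\<integral>\<omega>. (row B i \<bullet> X \<omega>) * (row D j \<bullet> Y \<omega>) \<partial>M)"
  proof -
    have "(\<integral>\<omega>. X' \<omega> $ i * Y' \<omega> $ j \<partial>M) = (\<integral>\<omega>. (row B i \<bullet> X \<omega>) * (row D j \<bullet> Y \<omega>) \<partial>M)"
      using ij B D by (intro Bochner_Integration.integral_cong refl) (simp add: X' Y')
    thus ?thesis using ij by (simp add: cross_moment_def)
  qed
  also have "\<dots> = (\<Sum>a<n. row B i $ a * (\<integral>\<omega>. X \<omega> $ a * (row D j \<bullet> Y \<omega>) \<partial>M))"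
    by (rule integral_scalar_prod[OF X scalar_prod_sq_int[OF Y]])
  also have "\<dots> = (\<Sum>a<n. \<Sum>b<m. B $$ (i, a) * ?G $$ (a, b) * D $$ (j, b))"
    using ij B by (intro sum.cong refl) (simp add: XY sum_distrib_left mult_ac)
  also have "\<dots> = (B * ?G * transpose_mat D) $$ (i, j)"
    using ij B D G by (simp add: scalar_prod_def atLeast0LessThan sum_distrib_left mult.assoc)
  finally show "cross_moment M n' m' X' Y' $$ (i, j) = (B * ?G * transpose_mat D) $$ (i, j)" .
qed (use B D in \<open>auto simp: cross_moment_def\<close>)

lemma vec_eq_of_diff_eq_0:
  fixes a b :: "real vec"
  assumes a: "a \<in> carrier_vec n" and b: "b \<in> carrier_vec n" and 0: "a - b = 0\<^sub>v n"
  shows "a = b"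
proof (rule eq_vecI)
  fix i assume "i < dim_vec b"
  hence i: "i < n" using b by simp
  have "(a - b) $ i = 0" using 0 i by simp
  thus "a $ i = b $ i" using i a b by simp
qed (use a b in simp)

lemma cond_indep_mono:
  "cond_indep M F H G \<Longrightarrow> sets F' \<subseteq> sets F \<Longrightarrow> cond_indep M F' H G"
  unfolding cond_indep_def by blast

text \<open>
  A linear image generates a smaller history, which keeps the conditional independence, and its cross moments are linear
  images of constant ones.
\<close>

lemma (in admissible_scheduling) ZMWSII_linear_image:
  assumes Z: "ZMWSII M \<mu> p d r" and B: "B \<in> carrier_mat d' d"
    and r': "\<And>t \<omega>. \<omega> \<in> space M \<Longrightarrow> r' t \<omega> = B *\<^sub>v r t \<omega>"
  shows "ZMWSII M \<mu> p d' r'"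
proof -
  interpret R: ZMWSII_process M \<mu> p d r using Z by unfold_locales
  have zc: "zproc \<mu> p r w t \<omega> \<in> carrier_vec d" if "\<omega> \<in> space M" for w t \<omega>
    using R.r_carrier[OF that] by (simp add: zproc_def)
  have z': "zproc \<mu> p r' w t \<omega> = B *\<^sub>v zproc \<mu> p r w t \<omega>" if "\<omega> \<in> space M" for w t \<omega>
    unfolding zproc_def r'[OF that] by (rule mult_mat_vec[OF B R.r_carrier[OF that], symmetric])
  have zs: "(\<lambda>\<omega>. zproc \<mu> p r w t \<omega> $ i) \<in> sq_int M" and zm: "(\<integral>\<omega>. zproc \<mu> p r w t \<omega> $ i \<partial>M) = 0"
    if "w \<noteq> []" "i < d" for w t i
    using Z that by (auto simp: ZMWSII_def)
  have rm: "(\<integral>\<omega>. r t \<omega> $ i \<partial>M) = 0" if "i < d" for t i using Z that by (simp add: ZMWSII_def)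
  have lin: "(\<lambda>\<omega>. X' \<omega> $ i) \<in> sq_int M \<and> (\<integral>\<omega>. X' \<omega> $ i \<partial>M) = 0"
    if X: "\<And>\<omega>. \<omega> \<in> space M \<Longrightarrow> X \<omega> \<in> carrier_vec d" "\<And>i. i < d \<Longrightarrow> (\<lambda>\<omega>. X \<omega> $ i) \<in> sq_int M"
      "\<And>i. i < d \<Longrightarrow> (\<integral>\<omega>. X \<omega> $ i \<partial>M) = 0" and X': "\<And>\<omega>. \<omega> \<in> space M \<Longrightarrow> X' \<omega> = B *\<^sub>v X \<omega>" and i: "i < d'"
    for X X' i
  proof -
    have eq: "row B i \<bullet> X \<omega> = X' \<omega> $ i" if "\<omega> \<in> space M" for \<omega> using X'[OF that] i B by simp
    have sq: "(\<lambda>\<omega>. row B i \<bullet> X \<omega>) \<in> sq_int M" by (rule scalar_prod_sq_int[OF X(1,2)])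
    have "(\<lambda>\<omega>. X' \<omega> $ i) \<in> borel_measurable M"
      using sq_int_measurable[OF sq] by (subst measurable_cong[OF eq[symmetric]])
    hence "(\<lambda>\<omega>. X' \<omega> $ i) \<in> sq_int M" by (rule sq_int_cong_AE[OF sq _ AE_I2[OF eq]])
    moreover have "(\<integral>\<omega>. X' \<omega> $ i \<partial>M) = (\<integral>\<omega>. (row B i \<bullet> X \<omega>) * 1 \<partial>M)"
      by (intro Bochner_Integration.integral_cong refl) (simp add: eq)
    moreover have "\<dots> = (\<Sum>a<d. row B i $ a * (\<integral>\<omega>. X \<omega> $ a * 1 \<partial>M))"
      by (rule integral_scalar_prod[OF X(1,2)]) (auto simp: sq_int_def)
    ultimately show ?thesis using X(3) by simp
  qed
  have r'lin: "(\<lambda>\<omega>. r' t \<omega> $ i) \<in> sq_int M \<and> (\<integral>\<omega>. r' t \<omega> $ i \<partial>M) = 0" if "i < d'" for t i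
    by (rule lin[OF R.r_carrier R.r_sq_int rm r' that])
  have vp: "vec_process M d' r'"
    unfolding vec_process_def
  proof (intro allI conjI ballI impI)
    fix t \<omega> assume \<omega>: "\<omega> \<in> space M"
    show "r' t \<omega> \<in> carrier_vec d'" unfolding r'[OF \<omega>] by (rule mult_mat_vec_carrier[OF B R.r_carrier[OF \<omega>]])
  next
    fix t i assume "i < d'"
    thus "(\<lambda>\<omega>. r' t \<omega> $ i) \<in> borel_measurable M" using r'lin[of i t] sq_int_measurable by blast
  qed
  have "sets (generated_alg M {(\<lambda>\<omega>. r' k \<omega> $ i) |k i. k \<le> t \<and> i < d'}) \<subseteq> sets (R.hist_alg t)" for t
  proof (rule generated_alg_least)
    show "space (R.hist_alg t) = space M" by (simp add: R.hist_alg_def)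
    show "{(\<lambda>\<omega>. r' k \<omega> $ i) |k i. k \<le> t \<and> i < d'} \<subseteq> borel_measurable (R.hist_alg t)"
    proof safe
      fix k i assume ki: "k \<le> t" "i < d'"
      have eq: "r' k \<omega> $ i = (\<Sum>a<d. B $$ (i, a) * r k \<omega> $ a)" if "\<omega> \<in> space (R.hist_alg t)" for \<omega>
      proof -
        have "\<omega> \<in> space M" using that by (simp add: R.hist_alg_def)
        thus ?thesis using ki B carrier_vecD[OF R.r_carrier, of \<omega> k]
          by (simp add: r' scalar_prod_def atLeast0LessThan)
      qed
      have "(\<lambda>\<omega>. r k \<omega> $ a) \<in> borel_measurable (R.hist_alg t)" if "a < d" for a
        unfolding R.hist_alg_def by (rule measurable_generated_alg) (use ki that in blast)
      hence "(\<lambda>\<omega>. \<Sum>a<d. B $$ (i, a) * r k \<omega> $ a) \<in> borel_measurable (R.hist_alg t)"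
        by (intro borel_measurable_sum borel_measurable_times) auto
      thus "(\<lambda>\<omega>. r' k \<omega> $ i) \<in> borel_measurable (R.hist_alg t)" by (subst measurable_cong[OF eq])
    qed
  qed
  hence ci: "cond_indep M (generated_alg M {(\<lambda>\<omega>. r' k \<omega> $ i) |k i. k \<le> t \<and> i < d'}) (future_alg M \<mu> t) (past_alg M \<mu> t)" for t
    by (rule cond_indep_mono[OF R.hist_cond_indep])
  have crr: "cross_moment M d' d' (r' t) (r' s) = B * cross_moment M d d (r t) (r s) * transpose_mat B" for t s
    by (rule cross_moment_linear_image[OF R.r_carrier R.r_sq_int R.r_carrier R.r_sq_int B B r' r'])
  have crz: "cross_moment M d' d' (r' t) (zproc \<mu> p r' w s)
      = B * cross_moment M d d (r t) (zproc \<mu> p r w s) * transpose_mat B" if "w \<noteq> []" for t s w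
    by (rule cross_moment_linear_image[OF R.r_carrier R.r_sq_int zc zs[OF that] B B r' z'])
  have czz: "cross_moment M d' d' (zproc \<mu> p r' w t) (zproc \<mu> p r' u s)
      = B * cross_moment M d d (zproc \<mu> p r w t) (zproc \<mu> p r u s) * transpose_mat B"
    if "w \<noteq> []" "u \<noteq> []" for t s w u
    by (rule cross_moment_linear_image[OF zc zs[OF that(1)] zc zs[OF that(2)] B B z' z'])
  have st: "cross_moment M d d (r (t + k)) (zproc \<mu> p r w (s + k)) = cross_moment M d d (r t) (zproc \<mu> p r w s)"
    "cross_moment M d d (r (t + k)) (r (s + k)) = cross_moment M d d (r t) (r s)"
    "cross_moment M d d (zproc \<mu> p r w (t + k)) (zproc \<mu> p r u (s + k)) = cross_moment M d d (zproc \<mu> p r w t) (zproc \<mu> p r u s)"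
    if "w \<noteq> []" "u \<noteq> []" for t s k w u
    using Z that unfolding ZMWSII_def by blast+
  show ?thesis
    unfolding ZMWSII_def
  proof (intro conjI allI impI)
    fix t s k :: int and w u :: "'s list"
    show "cross_moment M d' d' (r' (t + k)) (r' (s + k)) = cross_moment M d' d' (r' t) (r' s)"
      using st(2)[of "[undefined]" "[undefined]"] by (simp add: crr)
    {
      fix i assume wi: "w \<noteq> []" "i < d'"
      show "(\<lambda>\<omega>. zproc \<mu> p r' w t \<omega> $ i) \<in> sq_int M" "(\<integral>\<omega>. zproc \<mu> p r' w t \<omega> $ i \<partial>M) = 0"
        using lin[OF zc zs[OF wi(1)] zm[OF wi(1)] z' wi(2)] by blast+
    }
    {
      assume w: "w \<noteq> []"
      show "cross_moment M d' d' (r' (t + k)) (zproc \<mu> p r' w (s + k)) = cross_moment M d' d' (r' t) (zproc \<mu> p r' w s)"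
        using st(1)[OF w w] by (simp only: crz[OF w])
    }
    assume w: "w \<noteq> [] \<and> u \<noteq> []"
    show "cross_moment M d' d' (zproc \<mu> p r' w (t + k)) (zproc \<mu> p r' u (s + k))
        = cross_moment M d' d' (zproc \<mu> p r' w t) (zproc \<mu> p r' u s)"
      by (simp only: czz[OF conjunct1[OF w] conjunct2[OF w]] st(3)[OF conjunct1[OF w] conjunct2[OF w]])
  qed (use vp ci r'lin in auto)
qed

lemma sum_product_pairs:
  fixes c :: real
  shows "c * (\<Sum>a\<in>S. \<Sum>b\<in>S. f a b) * (\<Sum>a\<in>S. \<Sum>b\<in>S. g a b)
    = (\<Sum>a\<in>S. \<Sum>b\<in>S. \<Sum>a'\<in>S. \<Sum>b'\<in>S. c * f a b * g a' b')"
proof -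
  have *: "c * (\<Sum>a\<in>S. \<Sum>b\<in>S. f a b) * X = (\<Sum>a\<in>S. \<Sum>b\<in>S. c * f a b * X)" for X
    by (simp only: sum_distrib_left sum_distrib_right)
  show ?thesis unfolding * by (simp only: sum_distrib_left)
qed

context lpv_realization
begin

lemma annihilates_state:
  assumes D: "D \<in> carrier_mat q nx" and 0: "\<And>s \<sigma>. D * (word_mat nx A s * K \<sigma>) = 0\<^sub>m q m"
  shows "AE \<omega> in M. D *\<^sub>v x t \<omega> = 0\<^sub>v q"
proof -
  have "AE \<omega> in M. row D i \<bullet> x t \<omega> = 0" if i: "i < q" for i
  proof (rule state_in_reachable_space)
    show h: "row D i \<in> carrier_vec nx" using D i by (intro row_carrier_vec)
    fix s \<sigma>
    let ?W = "word_mat nx A s"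
    have WK: "?W * K \<sigma> \<in> carrier_mat nx m" using W_carrier[of s] carriers(2)[of \<sigma>] by simp
    have "transpose_mat (K \<sigma>) *\<^sub>v (transpose_mat ?W *\<^sub>v row D i) = transpose_mat (?W * K \<sigma>) *\<^sub>v row D i"
      using transpose_mult[OF W_carrier carriers(2)] carriers(2)[of \<sigma>] W_carrier[of s] h by simp
    also have "\<dots> = 0\<^sub>v m"
    proof (rule eq_vecI)
      fix j assume "j < dim_vec (0\<^sub>v m :: real vec)"
      hence j: "j < m" by simp
      have "(transpose_mat (?W * K \<sigma>) *\<^sub>v row D i) $ j = col (?W * K \<sigma>) j \<bullet> row D i"
        using j carriers(2)[of \<sigma>] by simp
      also have "\<dots> = row D i \<bullet> col (?W * K \<sigma>) j"
        by (rule comm_scalar_prod[OF col_carrier_vec[OF j WK] h])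
      also have "\<dots> = (D * (?W * K \<sigma>)) $$ (i, j)" using D i j carriers(2)[of \<sigma>] by simp
      finally show "(transpose_mat (?W * K \<sigma>) *\<^sub>v row D i) $ j = 0\<^sub>v m $ j" using 0 i j by simp
    qed (use carriers(2)[of \<sigma>] in simp)
    finally show "transpose_mat (K \<sigma>) *\<^sub>v (transpose_mat ?W *\<^sub>v row D i) = 0\<^sub>v m" .
  qed
  hence "AE \<omega> in M. \<forall>i\<in>{..<q}. row D i \<bullet> x t \<omega> = 0" by (subst AE_finite_all) auto
  thus ?thesis by eventually_elim (use D in \<open>auto intro!: eq_vecI\<close>)
qed

lemma agree_on_state:
  assumes D: "D \<in> carrier_mat q nx" "D' \<in> carrier_mat q nx"
    and eq: "\<And>s \<sigma>. D * (word_mat nx A s * K \<sigma>) = D' * (word_mat nx A s * K \<sigma>)"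
  shows "AE \<omega> in M. D *\<^sub>v x t \<omega> = D' *\<^sub>v x t \<omega>"
proof -
  have diff: "D - D' \<in> carrier_mat q nx" using D by (intro minus_carrier_mat)
  have "(D - D') * (word_mat nx A s * K \<sigma>) = 0\<^sub>m q m" for s \<sigma>
  proof -
    have WK: "word_mat nx A s * K \<sigma> \<in> carrier_mat nx m"
      using W_carrier[of s] carriers(2)[of \<sigma>] by simp
    show ?thesis
      unfolding minus_mult_distrib_mat[OF D WK] eq using D(2) carriers(2)[of \<sigma>] by (intro eq_matI) auto
  qed
  from annihilates_state[OF diff this, of t]
  have "AE \<omega> in M. (D - D') *\<^sub>v x t \<omega> = 0\<^sub>v q" .
  moreover have "AE \<omega> in M. \<omega> \<in> space M" by simp
  ultimately show ?thesis
  proof eventually_elim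
    case (elim \<omega>)
    note xc = x_carrier[OF elim(2), of t]
    have "D *\<^sub>v x t \<omega> - D' *\<^sub>v x t \<omega> = 0\<^sub>v q"
      using elim(1) minus_mult_distrib_mat_vec[OF D xc] by simp
    thus ?case
      by (rule vec_eq_of_diff_eq_0[OF mult_mat_vec_carrier[OF D(1) xc] mult_mat_vec_carrier[OF D(2) xc]])
  qed
qed

text \<open>
  Only \<open>U\<close> transforms the state; \<open>W\<close> serves to transfer stability. The equations required of \<open>U x\<close> hold on the range of
  all \<open>A\<^sub>s K\<^sub>\<sigma>\<close>, which is where the state lives.
\<close>

lemma realization_reduce:
  assumes car': "lpv_carrier nx' m ny A' K' C' F"
    and U: "U \<in> carrier_mat nx' nx" and W: "W \<in> carrier_mat nx nx'"
    and inter: "\<And>s. word_mat nx' A' s = U * word_mat nx A s * W"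
    and UK: "\<And>s \<sigma>. U * (word_mat nx A s * K \<sigma>) = word_mat nx' A' s * K' \<sigma>"
    and CK: "\<And>s \<sigma>. C' * (word_mat nx' A' s * K' \<sigma>) = C * (word_mat nx A s * K \<sigma>)"
  shows "asLPV_SSA M \<mu> p nx' m ny A' K' C' F v (\<lambda>t \<omega>. U *\<^sub>v x t \<omega>) y"
proof -
  have A': "A' \<sigma> \<in> carrier_mat nx' nx'" and K': "K' \<sigma> \<in> carrier_mat nx' m" for \<sigma>
    using car' by (auto simp: lpv_carrier_def)
  have C': "C' \<in> carrier_mat ny nx'" using car' by (auto simp: lpv_carrier_def)
  have W': "word_mat nx' A' s \<in> carrier_mat nx' nx'" for s using A' by (intro word_mat_carrier)
  have WK: "word_mat nx A s * K \<sigma> \<in> carrier_mat nx m" for s \<sigma> using W_carrier[of s] carriers(2)[of \<sigma>] by simp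
  have WK': "word_mat nx' A' s * K' \<sigma> \<in> carrier_mat nx' m" for s \<sigma> using W'[of s] K'[of \<sigma>] by simp
  have AU: "AE \<omega> in M. (U * A \<sigma>) *\<^sub>v x t \<omega> = A' \<sigma> *\<^sub>v (U *\<^sub>v x t \<omega>)" for \<sigma> t
  proof -
    have "U * A \<sigma> * (word_mat nx A s * K \<tau>) = A' \<sigma> * U * (word_mat nx A s * K \<tau>)" for s \<tau>
    proof -
      have "U * A \<sigma> * (word_mat nx A s * K \<tau>) = U * (word_mat nx A (s @ [\<sigma>]) * K \<tau>)"
        using assoc_mult_mat[OF U carriers(1) WK, of \<sigma> s \<tau>] carriers(1)[of \<sigma>] carriers(2)[of \<tau>] W_carrier[of s]
        by (simp add: word_mat_append[of A nx, OF carriers(1)])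
      also have "\<dots> = word_mat nx' A' (s @ [\<sigma>]) * K' \<tau>" by (rule UK)
      also have "\<dots> = A' \<sigma> * (word_mat nx' A' s * K' \<tau>)"
        using A'[of \<sigma>] W'[of s] K'[of \<tau>] by (simp add: word_mat_append[of A' nx', OF A'])
      also have "\<dots> = A' \<sigma> * U * (word_mat nx A s * K \<tau>)"
        unfolding UK[symmetric] by (rule assoc_mult_mat[OF A' U WK, symmetric])
      finally show ?thesis .
    qed
    from agree_on_state[OF mult_carrier_mat[OF U carriers(1)] mult_carrier_mat[OF A' U] this, of t]
    have "AE \<omega> in M. (U * A \<sigma>) *\<^sub>v x t \<omega> = (A' \<sigma> * U) *\<^sub>v x t \<omega>" .
    moreover have "AE \<omega> in M. \<omega> \<in> space M" by simp
    ultimately show ?thesis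
      by eventually_elim (simp only: assoc_mult_mat_vec[OF A' U x_carrier])
  qed
  have CU: "AE \<omega> in M. C *\<^sub>v x t \<omega> = C' *\<^sub>v (U *\<^sub>v x t \<omega>)" for t
  proof -
    have "C * (word_mat nx A s * K \<tau>) = C' * U * (word_mat nx A s * K \<tau>)" for s \<tau>
      using CK[of s \<tau>] unfolding UK[symmetric] assoc_mult_mat[OF C' U WK] by simp
    from agree_on_state[OF carriers(3) mult_carrier_mat[OF C' U] this, of t]
    have "AE \<omega> in M. C *\<^sub>v x t \<omega> = (C' * U) *\<^sub>v x t \<omega>" .
    moreover have "AE \<omega> in M. \<omega> \<in> space M" by simp
    ultimately show ?thesis
      by eventually_elim (simp only: assoc_mult_mat_vec[OF C' U x_carrier])
  qed
  have U0: "U * K \<sigma> = K' \<sigma>" for \<sigma>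
    using UK[of "[]" \<sigma>] carriers(2)[of \<sigma>] K'[of \<sigma>] by simp
  have state: "AE \<omega> in M. U *\<^sub>v x (t + 1) \<omega>
      = vec nx' (\<lambda>j. \<Sum>\<sigma>\<in>UNIV. (A' \<sigma> *\<^sub>v (U *\<^sub>v x t \<omega>) + K' \<sigma> *\<^sub>v v t \<omega>) $ j * \<mu> \<sigma> t \<omega>)" for t
  proof -
    have "AE \<omega> in M. row U j \<bullet> x (t + 1) \<omega>
       = (\<Sum>\<sigma>\<in>UNIV. lin (transpose_mat (A \<sigma>) *\<^sub>v row U j) (transpose_mat (K \<sigma>) *\<^sub>v row U j) t \<omega> * \<mu> \<sigma> t \<omega>)" if "j < nx'" for j
      by (rule state_equation) (use U that in \<open>intro row_carrier_vec\<close>)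
    hence "AE \<omega> in M. \<forall>j\<in>{..<nx'}. row U j \<bullet> x (t + 1) \<omega>
       = (\<Sum>\<sigma>\<in>UNIV. lin (transpose_mat (A \<sigma>) *\<^sub>v row U j) (transpose_mat (K \<sigma>) *\<^sub>v row U j) t \<omega> * \<mu> \<sigma> t \<omega>)"
      by (subst AE_finite_all) auto
    moreover have "AE \<omega> in M. \<forall>\<sigma>\<in>UNIV. (U * A \<sigma>) *\<^sub>v x t \<omega> = A' \<sigma> *\<^sub>v (U *\<^sub>v x t \<omega>)"
      using AU[of _ t] by (subst AE_finite_all) auto
    moreover have "AE \<omega> in M. \<omega> \<in> space M" by simp
    ultimately show ?thesis
    proof eventually_elim
      case (elim \<omega>)
      note xc = x_carrier[OF elim(3), of t] and vc = v_carrier[OF elim(3), of t]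
      have tr: "transpose_mat B *\<^sub>v row U j = row (U * B) j" if "j < nx'" "B \<in> carrier_mat nx q" for j B q
        using that U row_carrier_vec[OF that(1) U]
        by (intro eq_vecI) (auto simp: comm_scalar_prod[of _ nx])
      have "(U *\<^sub>v x (t + 1) \<omega>) $ j = (\<Sum>\<sigma>\<in>UNIV. (A' \<sigma> *\<^sub>v (U *\<^sub>v x t \<omega>) + K' \<sigma> *\<^sub>v v t \<omega>) $ j * \<mu> \<sigma> t \<omega>)" if j: "j < nx'" for j
      proof -
        have "lin (transpose_mat (A \<sigma>) *\<^sub>v row U j) (transpose_mat (K \<sigma>) *\<^sub>v row U j) t \<omega>
            = (A' \<sigma> *\<^sub>v (U *\<^sub>v x t \<omega>) + K' \<sigma> *\<^sub>v v t \<omega>) $ j" for \<sigma>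
        proof -
          have "row (U * A \<sigma>) j \<bullet> x t \<omega> = ((U * A \<sigma>) *\<^sub>v x t \<omega>) $ j"
            by (rule index_mult_mat_vec[symmetric]) (use j U in simp)
          hence "row (U * A \<sigma>) j \<bullet> x t \<omega> = (A' \<sigma> *\<^sub>v (U *\<^sub>v x t \<omega>)) $ j" using elim(2) by simp
          thus ?thesis
            unfolding lin_def tr[OF j carriers(1)] tr[OF j carriers(2)] U0
            using j K'[of \<sigma>] by simp
        qed
        thus ?thesis using elim(1) j U by simp
      qed
      thus ?case using U by (intro eq_vecI) auto
    qed
  qed
  have outp: "AE \<omega> in M. y t \<omega> = C' *\<^sub>v (U *\<^sub>v x t \<omega>) + F *\<^sub>v v t \<omega>" for t
  proof -
    have "AE \<omega> in M. y t \<omega> = C *\<^sub>v x t \<omega> + F *\<^sub>v v t \<omega>" using sys by (simp add: asLPV_SSA_def)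
    with CU[of t] show ?thesis by eventually_elim simp
  qed
  have Zj: "ZMWSII M \<mu> p (nx' + m) (\<lambda>t \<omega>. U *\<^sub>v x t \<omega> @\<^sub>v v t \<omega>)"
  proof (rule ZMWSII_linear_image[OF joint.zmwsii])
    show "four_block_mat U (0\<^sub>m nx' m) (0\<^sub>m m nx) (1\<^sub>m m) \<in> carrier_mat (nx' + m) (nx + m)"
      using U by (intro four_block_carrier_mat) auto
    fix t \<omega> assume \<omega>: "\<omega> \<in> space M"
    have fb: "four_block_mat U (0\<^sub>m nx' m) (0\<^sub>m m nx) (1\<^sub>m m) *\<^sub>v (x t \<omega> @\<^sub>v v t \<omega>)
        = (U *\<^sub>v x t \<omega> + 0\<^sub>m nx' m *\<^sub>v v t \<omega>) @\<^sub>v (0\<^sub>m m nx *\<^sub>v x t \<omega> + 1\<^sub>m m *\<^sub>v v t \<omega>)"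
      by (rule four_block_mat_mult_vec[OF U _ _ _ x_carrier[OF \<omega>] v_carrier[OF \<omega>]]) auto
    show "U *\<^sub>v x t \<omega> @\<^sub>v v t \<omega> = four_block_mat U (0\<^sub>m nx' m) (0\<^sub>m m nx) (1\<^sub>m m) *\<^sub>v (x t \<omega> @\<^sub>v v t \<omega>)"
    proof -
      have "0\<^sub>m nx' m *\<^sub>v v t \<omega> = 0\<^sub>v nx'" "0\<^sub>m m nx *\<^sub>v x t \<omega> = 0\<^sub>v m"
        using x_carrier[OF \<omega>, of t] v_carrier[OF \<omega>, of t] by (auto intro!: eq_vecI)
      moreover have "U *\<^sub>v x t \<omega> \<in> carrier_vec nx'" by (rule mult_mat_vec_carrier[OF U x_carrier[OF \<omega>]])
      ultimately show ?thesis unfolding fb using v_carrier[OF \<omega>, of t] by simp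
    qed
  qed
  have Zx: "zproc \<mu> p (\<lambda>t \<omega>. U *\<^sub>v x t \<omega>) w t \<omega> = U *\<^sub>v zproc \<mu> p x w t \<omega>" if "\<omega> \<in> space M" for w t \<omega>
    unfolding zproc_def by (rule mult_mat_vec[OF U x_carrier[OF that], symmetric])
  have zxc: "zproc \<mu> p x w t \<omega> \<in> carrier_vec nx" and zvc: "zproc \<mu> p v w t \<omega> \<in> carrier_vec m"
    if "\<omega> \<in> space M" for w t \<omega> using x_carrier[OF that] v_carrier[OF that] by (auto simp: zproc_def)
  have zxs: "(\<lambda>\<omega>. zproc \<mu> p x w t \<omega> $ i) \<in> sq_int M" if "i < nx" for w t i
  proof -
    have sq: "(\<lambda>\<omega>. 1 / sqrt (word_weight p w) * joint.gen w i t \<omega>) \<in> sq_int M"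
      using that by (intro sq_int_cmult joint.gen_sq_int) simp
    have eq: "1 / sqrt (word_weight p w) * joint.gen w i t \<omega> = zproc \<mu> p x w t \<omega> $ i" if "\<omega> \<in> space M" for \<omega>
      using zproc_entry[of x nx \<omega> i w t] x_carrier that \<open>i < nx\<close> append_x[OF that \<open>i < nx\<close>]
      by (simp add: joint.gen_def del: index_append_vec)
    show ?thesis
    proof (rule sq_int_cong_AE[OF sq _ AE_I2[OF eq]])
      show "(\<lambda>\<omega>. zproc \<mu> p x w t \<omega> $ i) \<in> borel_measurable M"
        using sq_int_measurable[OF sq] by (subst measurable_cong[OF eq[symmetric]])
    qed
  qed
  have zvs: "(\<lambda>\<omega>. zproc \<mu> p v [\<sigma>] t \<omega> $ i) \<in> sq_int M" if "i < m" for \<sigma> t i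
    using sys that by (simp add: asLPV_SSA_def ZMWSII_def)
  have c1: "cross_moment M nx' m (zproc \<mu> p (\<lambda>t \<omega>. U *\<^sub>v x t \<omega>) [\<sigma>] t) (zproc \<mu> p v [\<sigma>] t) = 0\<^sub>m nx' m" for \<sigma> t
  proof -
    have "cross_moment M nx m (zproc \<mu> p x [\<sigma>] t) (zproc \<mu> p v [\<sigma>] t) = 0\<^sub>m nx m"
      using sys by (simp add: asLPV_SSA_def)
    moreover have "cross_moment M nx' m (zproc \<mu> p (\<lambda>t \<omega>. U *\<^sub>v x t \<omega>) [\<sigma>] t) (zproc \<mu> p v [\<sigma>] t)
      = U * cross_moment M nx m (zproc \<mu> p x [\<sigma>] t) (zproc \<mu> p v [\<sigma>] t) * transpose_mat (1\<^sub>m m)"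
      by (rule cross_moment_linear_image[OF zxc zxs zvc zvs U one_carrier_mat Zx]) (simp_all add: zvc[THEN one_mult_mat_vec])
    ultimately show ?thesis using U by simp
  qed
  have c2: "cross_moment M m nx' (v t) (zproc \<mu> p (\<lambda>t \<omega>. U *\<^sub>v x t \<omega>) w t) = 0\<^sub>m m nx'" if "w \<noteq> []" for w t
  proof -
    have "cross_moment M m nx (v t) (zproc \<mu> p x w t) = 0\<^sub>m m nx"
      using sys that by (simp add: asLPV_SSA_def)
    moreover have "cross_moment M m nx' (v t) (zproc \<mu> p (\<lambda>t \<omega>. U *\<^sub>v x t \<omega>) w t)
      = 1\<^sub>m m * cross_moment M m nx (v t) (zproc \<mu> p x w t) * transpose_mat U"
      by (rule cross_moment_linear_image[OF v_carrier v_sq_int zxc zxs one_carrier_mat U _ Zx]) (simp_all add: v_carrier[THEN one_mult_mat_vec])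
    ultimately show ?thesis using U by simp
  qed
  have stab: "\<forall>c. eigenvalue (map_mat complex_of_real (stability_matrix p nx' A')) c \<longrightarrow> norm c < 1"
  proof (subst stable_iff_words_tendsto_0[OF A'], intro allI impI)
    fix i j k l assume ijkl: "i < nx'" "j < nx'" "k < nx'" "l < nx'"
    let ?W = "word_mat nx A"
    have en: "word_mat nx' A' s $$ (i, k) = (\<Sum>a<nx. \<Sum>b<nx. U $$ (i, a) * ?W s $$ (a, b) * W $$ (b, k))"
      if "i < nx'" "k < nx'" for s i k
      unfolding inter using that U W W_carrier[of s]
      by (simp add: scalar_prod_def atLeast0LessThan sum_distrib_left mult.assoc)
    have stable: "(\<lambda>N. \<Sum>s | length s = N. word_weight p s * ?W s $$ (a, b) * ?W s $$ (c, d)) \<longlonglongrightarrow> 0"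
      if "a < nx" "b < nx" "c < nx" "d < nx" for a b c d
      using stable_iff_words_tendsto_0[of A nx p, OF carriers(1)] sys that by (simp add: asLPV_SSA_def)
    have eq: "(\<Sum>s | length s = N. word_weight p s * word_mat nx' A' s $$ (i, k) * word_mat nx' A' s $$ (j, l))
      = (\<Sum>a<nx. \<Sum>b<nx. \<Sum>c<nx. \<Sum>d<nx. (U $$ (i, a) * W $$ (b, k) * U $$ (j, c) * W $$ (d, l))
         * (\<Sum>s | length s = N. word_weight p s * ?W s $$ (a, b) * ?W s $$ (c, d)))" for N
    proof -
      have "(\<Sum>s | length s = N. word_weight p s * word_mat nx' A' s $$ (i, k) * word_mat nx' A' s $$ (j, l))
        = (\<Sum>s | length s = N. \<Sum>a<nx. \<Sum>b<nx. \<Sum>c<nx. \<Sum>d<nx.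
            (U $$ (i, a) * W $$ (b, k) * U $$ (j, c) * W $$ (d, l)) * (word_weight p s * ?W s $$ (a, b) * ?W s $$ (c, d)))"
        unfolding en[OF ijkl(1,3)] en[OF ijkl(2,4)]
        unfolding sum_product_pairs by (intro sum.cong refl) (simp only: mult_ac)
      also have "\<dots> = (\<Sum>a<nx. \<Sum>b<nx. \<Sum>c<nx. \<Sum>d<nx. \<Sum>s | length s = N.
            (U $$ (i, a) * W $$ (b, k) * U $$ (j, c) * W $$ (d, l)) * (word_weight p s * ?W s $$ (a, b) * ?W s $$ (c, d)))"
        by ((rule trans[OF sum.swap], rule sum.cong[OF refl])+, rule refl)
      finally show ?thesis by (simp only: sum_distrib_left)
    qed
    show "(\<lambda>N. \<Sum>s | length s = N. word_weight p s * word_mat nx' A' s $$ (i, k) * word_mat nx' A' s $$ (j, l)) \<longlonglongrightarrow> 0"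
      unfolding eq by (intro tendsto_null_sum tendsto_mult_right_zero stable) auto
  qed
  have vpx: "vec_process M nx' (\<lambda>t \<omega>. U *\<^sub>v x t \<omega>)"
    unfolding vec_process_def
  proof (intro allI conjI ballI impI)
    fix t \<omega> assume "\<omega> \<in> space M"
    thus "U *\<^sub>v x t \<omega> \<in> carrier_vec nx'" by (intro mult_mat_vec_carrier[OF U] x_carrier)
  next
    fix t i assume "i < nx'"
    hence "(\<lambda>\<omega>. (U *\<^sub>v x t \<omega>) $ i) = (\<lambda>\<omega>. row U i \<bullet> x t \<omega>)" using U by auto
    thus "(\<lambda>\<omega>. (U *\<^sub>v x t \<omega>) $ i) \<in> borel_measurable M" using sq_int_measurable[OF gx_sq_int] by simp
  qed
  have v: "vec_process M m v" "vec_process M ny y" "ZMWSII M \<mu> p m v"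
    and vw: "\<And>w t. w \<noteq> [] \<Longrightarrow> cross_moment M m m (v t) (zproc \<mu> p v w t) = 0\<^sub>m m m"
    using sys by (simp_all add: asLPV_SSA_def)
  show ?thesis
    unfolding asLPV_SSA_def
    by (intro conjI allI impI)
       (rule car' vpx v state outp Zj c1 | erule c2 vw | rule stab[rule_format], assumption)+
qed

end

section \<open>Minimality\<close>

context lpv_realization
begin

text \<open>
  The block of the Hankel matrix picked out by an input basis \<open>T\<close> and an output basis \<open>P\<close> of the minimal system is the
  product \<open>P T\<close>, which is invertible. In terms of the competing realization it is \<open>P' X'\<close> with inner dimension \<open>nx'\<close>.
\<close>

lemma dim_le_of_minimal_dLPV:
  assumes m: "m = ny" and inn: "innovation_process M \<mu> p ny y v" and fr: "full_rank M \<mu> p ny y"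
    and min: "minimal_dLPV_SSA nx m ny A K C F"
    and comp: "asLPV_SSA M \<mu> p nx' m' ny A' K' C' F' v' x' y"
  shows "nx \<le> nx'"
proof -
  interpret R: lpv_realization M \<mu> p nx' m' ny A' K' C' F' v' x' y
    using comp by unfold_locales
  let ?W = "word_mat nx A" and ?W' = "word_mat nx' A'"
  have dual: "\<exists>c\<in>carrier_vec m. \<forall>k<m. (\<integral>\<omega>. v t \<omega> $ k * (c \<bullet> v t \<omega>) \<partial>M) = (if k = j then 1 else 0)"
    if j: "j < m" for t j
  proof -
    fix \<sigma> :: 's
    obtain e where e: "innovation_process M \<mu> p ny y e"
      and inv: "invertible_mat (mat ny ny (\<lambda>(i, j). \<integral>\<omega>. e t \<omega> $ i * e t \<omega> $ j * (\<mu> \<sigma> t \<omega>)\<^sup>2 \<partial>M))" (is "invertible_mat ?Q")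
      using fr unfolding full_rank_def by blast
    obtain B where B: "?Q * B = 1\<^sub>m ny" "B * ?Q = 1\<^sub>m (dim_row B)"
      using inv unfolding invertible_mat_def inverts_mat_def by auto
    have Bc: "B \<in> carrier_mat ny ny"
    proof -
      have "dim_col B = ny" using arg_cong[OF B(1), of dim_col] by simp
      moreover have "dim_row B = ny" using arg_cong[OF B(2), of dim_col] by simp
      ultimately show ?thesis by (intro carrier_matI)
    qed
    have Qe: "?Q $$ (k, l) = p \<sigma> * (\<integral>\<omega>. v t \<omega> $ k * v t \<omega> $ l \<partial>M)" if kl: "k < ny" "l < ny" for k l
    proof -
      have N: "(\<lambda>\<omega>. v t \<omega> $ i) \<in> joint.nonanticipating t" if "i < ny" for i
        using innovation_present[OF inn that] joint.present_sub_nonanticipating by blast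
      have ae: "AE \<omega> in M. e t \<omega> $ i = v t \<omega> $ i" if "i < ny" for i
        by (rule innovation_unique[OF e inn that])
      have em: "(\<lambda>\<omega>. e t \<omega> $ i) \<in> borel_measurable M" if "i < ny" for i
        using e that by (simp add: innovation_process_def vec_process_def)
      have vm: "(\<lambda>\<omega>. v t \<omega> $ i) \<in> borel_measurable M" if "i < ny" for i
        using v_sq_int that m sq_int_measurable by blast
      have "(\<integral>\<omega>. e t \<omega> $ k * e t \<omega> $ l * (\<mu> \<sigma> t \<omega>)\<^sup>2 \<partial>M) = (\<integral>\<omega>. v t \<omega> $ k * v t \<omega> $ l * (\<mu> \<sigma> t \<omega>)\<^sup>2 \<partial>M)"
      proof (rule integral_cong_AE)
        show "AE \<omega> in M. e t \<omega> $ k * e t \<omega> $ l * (\<mu> \<sigma> t \<omega>)\<^sup>2 = v t \<omega> $ k * v t \<omega> $ l * (\<mu> \<sigma> t \<omega>)\<^sup>2"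
          using ae[OF kl(1)] ae[OF kl(2)] by eventually_elim simp
      qed (intro borel_measurable_times borel_measurable_power em vm kl mu_measurable)+
      thus ?thesis using joint.moment_same[OF N[OF kl(1)] N[OF kl(2)], of \<sigma>] kl by simp
    qed
    let ?c = "p \<sigma> \<cdot>\<^sub>v col B j"
    have c: "?c \<in> carrier_vec m" using Bc m by (simp add: carrier_vecI)
    have "(\<integral>\<omega>. v t \<omega> $ k * (?c \<bullet> v t \<omega>) \<partial>M) = (if k = j then 1 else 0)" if k: "k < m" for k
    proof -
      have "(\<integral>\<omega>. (?c \<bullet> v t \<omega>) * v t \<omega> $ k \<partial>M) = (\<Sum>l<m. ?c $ l * (\<integral>\<omega>. v t \<omega> $ l * v t \<omega> $ k \<partial>M))"
        by (rule integral_scalar_prod[OF v_carrier v_sq_int v_sq_int[OF k]])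
      also have "\<dots> = (\<Sum>l<m. ?Q $$ (k, l) * B $$ (l, j))"
        using k j Bc m Qe by (intro sum.cong refl) (simp add: mult_ac del: index_mat)
      also have "\<dots> = (?Q * B) $$ (k, j)"
        using k j Bc m by (simp add: scalar_prod_def atLeast0LessThan)
      also have "\<dots> = (if k = j then 1 else 0)" unfolding B(1) using k j m by simp
      finally show ?thesis by (simp add: mult.commute)
    qed
    thus ?thesis using c by blast
  qed
  have factor: "\<exists>X\<in>carrier_vec nx'. \<forall>u i. i < ny \<longrightarrow>
      row (C * ?W u) i \<bullet> col (?W s * K \<sigma>) j = row (C' * ?W' u) i \<bullet> X" if j: "j < m" for s \<sigma> j
  proof -
    \<comment> \<open>Noise is injected at time \<open>0\<close>, the state is compared at \<open>?T\<close>, and outputs are read after a further word \<open>u\<close>.\<close>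
    let ?t = "0 :: int"
    let ?T = "?t + 1 + int (length s)"
    obtain c where c: "c \<in> carrier_vec m"
      and cd: "\<And>k. k < m \<Longrightarrow> (\<integral>\<omega>. v ?t \<omega> $ k * (c \<bullet> v ?t \<omega>) \<partial>M) = (if k = j then 1 else 0)"
      using dual[OF j, of ?t] by blast
    let ?f = "\<lambda>\<omega>. (c \<bullet> v ?t \<omega>) * \<mu> \<sigma> ?t \<omega> * sched_word \<mu> s (?t + 1 + int (length s) - 1) \<omega>"
    have fp: "?f \<in> joint.past_span ?T"
      by (rule joint.mult_word_past'[OF joint.mult_past_span[OF kv_present[OF c]]])
    have "(\<lambda>\<omega>. c \<bullet> v ?t \<omega>) \<in> R.joint.present_span ?t"
    proof (rule closed_sq_subspace_cong_AE[OF R.joint.present_span_closed])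
      show "(\<lambda>\<omega>. \<Sum>i<m. c $ i * v ?t \<omega> $ i) \<in> R.joint.present_span ?t"
        by (intro closed_sq_subspace_sum[OF R.joint.present_span_closed] closed_sq_subspaceD(4)[OF R.joint.present_span_closed]
            R.innovation_present[OF inn]) (simp add: m)
      show "AE \<omega> in M. (\<Sum>i<m. c $ i * v ?t \<omega> $ i) = c \<bullet> v ?t \<omega>"
        by (rule AE_I2) (simp add: scalar_prod_def carrier_vecD[OF v_carrier] atLeast0LessThan)
    qed (rule sq_int_measurable[OF kv_sq_int])
    hence fp': "?f \<in> R.joint.past_span ?T"
      by (intro R.joint.mult_word_past' R.joint.mult_past_span)
    define X where "X = vec nx' (\<lambda>k. \<integral>\<omega>. x' ?T \<omega> $ k * ?f \<omega> \<partial>M)"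
    let ?a = "word_weight p s * p \<sigma>"
    have a: "?a > 0" using word_weight_pos p_pos by simp
    have XS: "vec nx (\<lambda>k. \<integral>\<omega>. x ?T \<omega> $ k * ?f \<omega> \<partial>M) = ?a \<cdot>\<^sub>v col (?W s * K \<sigma>) j"
      by (rule state_probe[OF c j cd])
    have WK: "?W s * K \<sigma> \<in> carrier_mat nx m" using W_carrier[of s] carriers(2)[of \<sigma>] by simp
    have "row (C * ?W u) i \<bullet> col (?W s * K \<sigma>) j = row (C' * ?W' u) i \<bullet> ((1 / ?a) \<cdot>\<^sub>v X)" if i: "i < ny" for u i
    proof -
      have rc: "row (C * ?W u) i \<in> carrier_vec nx"
        using i carriers(3) W_carrier[of u] by (intro row_carrier_vec[OF i]) simp
      have rc': "row (C' * ?W' u) i \<in> carrier_vec nx'"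
        using i R.carriers(3) R.W_carrier[of u] by (intro row_carrier_vec[OF i]) simp
      have "word_weight p u * (row (C * ?W u) i \<bullet> (?a \<cdot>\<^sub>v col (?W s * K \<sigma>) j)) = word_weight p u * (row (C' * ?W' u) i \<bullet> X)"
        using output_moment_word[OF i fp, of u] R.output_moment_word[OF i fp', of u]
        unfolding XS X_def[symmetric] by simp
      hence "row (C * ?W u) i \<bullet> (?a \<cdot>\<^sub>v col (?W s * K \<sigma>) j) = row (C' * ?W' u) i \<bullet> X"
        using word_weight_pos[of u] by simp
      hence "?a * (row (C * ?W u) i \<bullet> col (?W s * K \<sigma>) j) = row (C' * ?W' u) i \<bullet> X"
        using scalar_prod_smult_distrib[OF rc col_carrier_vec[OF j WK]] by simp
      moreover have "row (C' * ?W' u) i \<bullet> ((1 / ?a) \<cdot>\<^sub>v X) = (1 / ?a) * (row (C' * ?W' u) i \<bullet> X)"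
        by (rule scalar_prod_smult_distrib[OF rc']) (simp add: X_def)
      moreover have "z = (1 / c) * q" if "c * z = q" "c > 0" for c z q :: real
        using that by (auto simp: field_simps)
      ultimately show ?thesis using a by metis
    qed
    moreover have "(1 / ?a) \<cdot>\<^sub>v X \<in> carrier_vec nx'" by (simp add: X_def)
    ultimately show ?thesis by blast
  qed
  obtain T Ti sg wd ix where T: "T \<in> carrier_mat nx nx" "Ti \<in> carrier_mat nx nx" "T * Ti = 1\<^sub>m nx"
    and ix: "\<And>k. k < nx \<Longrightarrow> ix k < m"
    and colT: "\<And>k. k < nx \<Longrightarrow> col T k = col (?W (wd k) * K (sg k)) (ix k)"
    using minimal_dLPV_reachable[OF min] by metis
  obtain P Pi wo io where P: "P \<in> carrier_mat nx nx" "Pi \<in> carrier_mat nx nx" "Pi * P = 1\<^sub>m nx"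
    and io: "\<And>k. k < nx \<Longrightarrow> io k < ny"
    and rowP: "\<And>k. k < nx \<Longrightarrow> row P k = row (C * ?W (wo k)) (io k)"
    using minimal_dLPV_observable[OF min] by metis
  have "\<forall>l. \<exists>X. l < nx \<longrightarrow> X \<in> carrier_vec nx' \<and> (\<forall>u i. i < ny \<longrightarrow>
      row (C * ?W u) i \<bullet> col (?W (wd l) * K (sg l)) (ix l) = row (C' * ?W' u) i \<bullet> X)"
    using factor ix by blast
  then obtain X where X: "\<And>l. l < nx \<Longrightarrow> X l \<in> carrier_vec nx'"
    and Xeq: "\<And>l u i. l < nx \<Longrightarrow> i < ny \<Longrightarrow>
      row (C * ?W u) i \<bullet> col (?W (wd l) * K (sg l)) (ix l) = row (C' * ?W' u) i \<bullet> X l" by metis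
  define P' where "P' = mat nx nx' (\<lambda>(k, a). (C' * ?W' (wo k)) $$ (io k, a))"
  define X' where "X' = mat nx' nx (\<lambda>(a, l). X l $ a)"
  have P'X': "P' \<in> carrier_mat nx nx'" "X' \<in> carrier_mat nx' nx" by (simp_all add: P'_def X'_def)
  have PT: "P * T = P' * X'"
  proof (rule eq_matI)
    fix k l assume "k < dim_row (P' * X')" "l < dim_col (P' * X')"
    hence kl: "k < nx" "l < nx" by (simp_all add: P'_def X'_def)
    have "(P * T) $$ (k, l) = row (C * ?W (wo k)) (io k) \<bullet> col (?W (wd l) * K (sg l)) (ix l)"
      using kl P T rowP[OF kl(1)] colT[OF kl(2)] by simp
    also have "\<dots> = row (C' * ?W' (wo k)) (io k) \<bullet> X l" by (rule Xeq[OF kl(2) io[OF kl(1)]])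
    also have "row (C' * ?W' (wo k)) (io k) = row P' k"
      using kl io[OF kl(1)] R.carriers(3) R.W_carrier[of "wo k"] by (intro eq_vecI) (auto simp: P'_def)
    also have "X l = col X' l" using kl X[OF kl(2)] by (intro eq_vecI) (auto simp: X'_def)
    finally show "(P * T) $$ (k, l) = (P' * X') $$ (k, l)" using kl by (simp add: P'_def X'_def)
  qed (use P T in \<open>auto simp: P'_def X'_def\<close>)
  have "(Pi * P') * (X' * Ti) = Pi * (P' * X') * Ti" using P T P'X'
    by (simp add: assoc_mult_mat[of _ nx nx _ nx' _ nx] assoc_mult_mat[of _ nx nx' _ nx _ nx] assoc_mult_mat[of _ nx nx _ nx _ nx])
  also have "\<dots> = (Pi * P) * (T * Ti)" unfolding PT[symmetric] using P T
    by (simp add: assoc_mult_mat[of _ nx nx _ nx _ nx] del: T(3) P(3))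
  also have "\<dots> = 1\<^sub>m nx" using P T by simp
  finally show "nx \<le> nx'"
    by (rule dim_le_of_left_inverse[rotated 2]) (use P T P'X' in auto)
qed

text \<open>
  The words that form bases in the minimal system define matrices of rows and columns in the given one. Since Markov
  parameters coincide, the products of such rows, words and columns are the same in both systems.
\<close>

lemma realization_of_minimal_dLPV:
  assumes min: "minimal_dLPV_SSA nx' m ny A' K' C' F'"
    and markov: "sub_markov nx' A' K' C' F' = sub_markov nx A K C F"
  obtains x' where "asLPV_SSA M \<mu> p nx' m ny A' K' C' F v x' y"
proof -
  have F': "F' = F" using fun_cong[OF markov, of "[]"] by simp
  have car': "lpv_carrier nx' m ny A' K' C' F" using min by (simp add: minimal_dLPV_SSA_def F')
  have A': "A' \<sigma> \<in> carrier_mat nx' nx'" and K': "K' \<sigma> \<in> carrier_mat nx' m" for \<sigma>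
    using car' by (auto simp: lpv_carrier_def)
  have C': "C' \<in> carrier_mat ny nx'" using car' by (auto simp: lpv_carrier_def)
  let ?W = "word_mat nx A" and ?W' = "word_mat nx' A'"
  have W': "?W' s \<in> carrier_mat nx' nx'" for s using A' by (intro word_mat_carrier)
  have WK: "?W s * K \<sigma> \<in> carrier_mat nx m" for s \<sigma> using W_carrier[of s] carriers(2)[of \<sigma>] by simp
  have WK': "?W' s * K' \<sigma> \<in> carrier_mat nx' m" for s \<sigma> using W'[of s] K'[of \<sigma>] by simp
  have mk: "C' * ?W' u * (?W' s * K' \<sigma>) = C * ?W u * (?W s * K \<sigma>)" for u s \<sigma>
  proof -
    have "C' * ?W' u * (?W' s * K' \<sigma>) = C' * ?W' (s @ u) * K' \<sigma>"
      using C' W'[of u] W'[of s] K'[of \<sigma>]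
      by (simp add: word_mat_append[of A' nx', OF A'] assoc_mult_mat[of _ ny nx' _ nx' _ m] assoc_mult_mat[of _ nx' nx' _ nx' _ m])
    also have "\<dots> = C * ?W (s @ u) * K \<sigma>" using fun_cong[OF markov, of "\<sigma> # s @ u"] by simp
    also have "\<dots> = C * ?W u * (?W s * K \<sigma>)"
      using carriers(3) W_carrier[of u] W_carrier[of s] carriers(2)[of \<sigma>]
      by (simp add: word_mat_append[of A nx, OF carriers(1)] assoc_mult_mat[of _ ny nx _ nx _ m] assoc_mult_mat[of _ nx nx _ nx _ m])
    finally show ?thesis .
  qed
  obtain T Ti sg wd ix where T: "T \<in> carrier_mat nx' nx'" "Ti \<in> carrier_mat nx' nx'" "T * Ti = 1\<^sub>m nx'"
    and ix: "\<And>k. k < nx' \<Longrightarrow> ix k < m"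
    and colT: "\<And>k. k < nx' \<Longrightarrow> col T k = col (?W' (wd k) * K' (sg k)) (ix k)"
    using minimal_dLPV_reachable[OF min] by metis
  obtain P Pi wo io where P: "P \<in> carrier_mat nx' nx'" "Pi \<in> carrier_mat nx' nx'" "Pi * P = 1\<^sub>m nx'"
    and io: "\<And>k. k < nx' \<Longrightarrow> io k < ny"
    and rowP: "\<And>k. k < nx' \<Longrightarrow> row P k = row (C' * ?W' (wo k)) (io k)"
    using minimal_dLPV_observable[OF min] by metis
  define PS where "PS = mat nx' nx (\<lambda>(k, a). (C * ?W (wo k)) $$ (io k, a))"
  define TS where "TS = mat nx nx' (\<lambda>(a, l). (?W (wd l) * K (sg l)) $$ (a, ix l))"
  \<comment> \<open>\<open>PS\<close> observes a state of the given system through the chosen words and \<open>Pi\<close> decodes the result as a state of the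
  minimal one. Dually, \<open>Ti\<close> encodes a state by inputs and \<open>TS\<close> feeds them to the given system.\<close>
  define U where "U = Pi * PS"
  define W where "W = TS * Ti"
  have PS: "PS \<in> carrier_mat nx' nx" and TS: "TS \<in> carrier_mat nx nx'" by (simp_all add: PS_def TS_def)
  have U: "U \<in> carrier_mat nx' nx" and W: "W \<in> carrier_mat nx nx'" using P T PS TS by (simp_all add: U_def W_def)
  have UK: "U * (?W s * K \<sigma>) = ?W' s * K' \<sigma>" for s \<sigma>
  proof -
    have "PS * (?W s * K \<sigma>) = P * (?W' s * K' \<sigma>)"
    proof (rule eq_matI)
      fix k j assume "k < dim_row (P * (?W' s * K' \<sigma>))" "j < dim_col (P * (?W' s * K' \<sigma>))"
      hence kj: "k < nx'" "j < m" using P K'[of \<sigma>] by auto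
      have CWc: "C * ?W (wo k) \<in> carrier_mat ny nx" using carriers(3) W_carrier[of "wo k"] by simp
      have CWc': "C' * ?W' (wo k) \<in> carrier_mat ny nx'" using C' W'[of "wo k"] by simp
      have rowPS: "row PS k = row (C * ?W (wo k)) (io k)"
        using kj io[OF kj(1)] carriers(3) W_carrier[of "wo k"] by (intro eq_vecI) (auto simp: PS_def)
      have "(PS * (?W s * K \<sigma>)) $$ (k, j) = row PS k \<bullet> col (?W s * K \<sigma>) j"
        using kj PS carriers(2)[of \<sigma>] by simp
      also have "\<dots> = (C * ?W (wo k) * (?W s * K \<sigma>)) $$ (io k, j)"
        unfolding rowPS using io[OF kj(1)] kj carriers(2)[of \<sigma>] carriers(3) by simp
      also have "\<dots> = (C' * ?W' (wo k) * (?W' s * K' \<sigma>)) $$ (io k, j)" by (simp only: mk)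
      also have "\<dots> = row P k \<bullet> col (?W' s * K' \<sigma>) j"
        unfolding rowP[OF kj(1)] using io[OF kj(1)] kj K'[of \<sigma>] C' by simp
      also have "\<dots> = (P * (?W' s * K' \<sigma>)) $$ (k, j)" using kj P K'[of \<sigma>] by simp
      finally show "(PS * (?W s * K \<sigma>)) $$ (k, j) = (P * (?W' s * K' \<sigma>)) $$ (k, j)" .
    qed (use PS P K'[of \<sigma>] carriers(2)[of \<sigma>] in auto)
    hence "Pi * (PS * (?W s * K \<sigma>)) = (Pi * P) * (?W' s * K' \<sigma>)"
      using assoc_mult_mat[OF P(2) P(1) WK', of s \<sigma>] by simp
    thus ?thesis unfolding U_def P(3) using assoc_mult_mat[OF P(2) PS WK, of s \<sigma>] left_mult_one_mat[OF WK', of s \<sigma>] by simp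
  qed
  have inter: "?W' s = U * ?W s * W" for s
  proof -
    have "?W' s * T = U * ?W s * TS"
    proof (rule eq_matI)
      fix k l assume "k < dim_row (U * ?W s * TS)" "l < dim_col (U * ?W s * TS)"
      hence kl: "k < nx'" "l < nx'" using U TS by auto
      let ?V = "?W (wd l) * K (sg l)" and ?V' = "?W' (wd l) * K' (sg l)"
      have "?W' s * ?V' = ?W' (wd l @ s) * K' (sg l)"
        using W'[of s] W'[of "wd l"] K'[of "sg l"] by (simp add: word_mat_append[of A' nx', OF A'])
      also have "\<dots> = U * (?W (wd l @ s) * K (sg l))" by (rule UK[symmetric])
      also have "?W (wd l @ s) * K (sg l) = ?W s * ?V"
        using W_carrier[of s] W_carrier[of "wd l"] carriers(2)[of "sg l"] by (simp add: word_mat_append[of A nx, OF carriers(1)])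
      also have "U * (?W s * ?V) = U * ?W s * ?V" by (rule assoc_mult_mat[OF U W_carrier WK, symmetric])
      finally have eq: "?W' s * ?V' = U * ?W s * ?V" .
      have colTS: "col TS l = col ?V (ix l)"
        using kl ix[OF kl(2)] W_carrier[of "wd l"] carriers(2)[of "sg l"] by (intro eq_vecI) (auto simp: TS_def)
      have "(?W' s * T) $$ (k, l) = row (?W' s) k \<bullet> col ?V' (ix l)"
        using kl T W'[of s] colT[OF kl(2)] by simp
      also have "\<dots> = (?W' s * ?V') $$ (k, ix l)" using kl ix[OF kl(2)] W'[of s] K'[of "sg l"] by simp
      also have "\<dots> = (U * ?W s * ?V) $$ (k, ix l)" by (simp only: eq)
      also have "\<dots> = row (U * ?W s) k \<bullet> col TS l"
        unfolding colTS using kl ix[OF kl(2)] U carriers(2)[of "sg l"] by simp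
      also have "\<dots> = (U * ?W s * TS) $$ (k, l)" using kl U TS by simp
      finally show "(?W' s * T) $$ (k, l) = (U * ?W s * TS) $$ (k, l)" .
    qed (use W'[of s] T U TS in auto)
    hence "?W' s * T * Ti = U * ?W s * TS * Ti" by simp
    moreover have "?W' s * T * Ti = ?W' s" using W'[of s] T by simp
    moreover have "U * ?W s * TS * Ti = U * ?W s * W" unfolding W_def
      by (rule assoc_mult_mat[OF mult_carrier_mat[OF U W_carrier] TS T(2)])
    ultimately show ?thesis by simp
  qed
  have CK: "C' * (?W' s * K' \<sigma>) = C * (?W s * K \<sigma>)" for s \<sigma>
    using mk[of "[]" s \<sigma>] C' carriers(3) by simp
  show ?thesis by (rule that[OF realization_reduce[OF car' U W inter UK CK]])
qed

end

theorem theorem4: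
  fixes M :: "'a measure"
    and \<mu> :: "('s::finite, 'a) scheduling"
    and p :: "'s \<Rightarrow> real"
    and y e :: "'a vprocess"
    and nx ny :: nat
    and A K :: "'s \<Rightarrow> real mat"
    and C :: "real mat"
  assumes "prob_space M"
    and "admissible M \<mu> p"
    and "vec_process M ny y"
    and "innovation_form M \<mu> p ny y nx ny A K C (1\<^sub>m ny) e"
    and "full_rank M \<mu> p ny y"
    and "SII M \<mu> p ny y"
  shows "minimal_asLPV_realization M \<mu> p ny y nx ny A K C (1\<^sub>m ny) e
     \<longleftrightarrow> minimal_dLPV_SSA nx ny ny A K C (1\<^sub>m ny)"
proof -
  have inn: "innovation_process M \<mu> p ny y e" using assms(4) by (simp add: innovation_form_def)
  obtain x where sys: "asLPV_SSA M \<mu> p nx ny ny A K C (1\<^sub>m ny) e x y"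
    using assms(4) by (auto simp: innovation_form_def asLPV_realization_def)
  interpret admissible_scheduling M \<mu> p
    using assms(1,2) by (simp add: admissible_scheduling_def admissible_scheduling_axioms_def)
  interpret lpv_realization M \<mu> p nx ny ny A K C "1\<^sub>m ny" e x y
    using sys by unfold_locales
  show ?thesis
  proof
    assume min: "minimal_asLPV_realization M \<mu> p ny y nx ny A K C (1\<^sub>m ny) e"
    \<comment> \<open>A system of least dimension exists because the given one is a candidate.\<close>
    define same where "same n \<longleftrightarrow> (\<exists>A' K' C' D'. lpv_carrier n ny ny A' K' C' D' \<and>
      sub_markov n A' K' C' D' = sub_markov nx A K C (1\<^sub>m ny))" for n
    have car: "lpv_carrier nx ny ny A K C (1\<^sub>m ny)" using sys by (simp add: asLPV_SSA_def)
    hence "same nx" unfolding same_def by blast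
    hence "same (LEAST n. same n)" by (rule LeastI)
    then obtain n A' K' C' D' where n: "n = (LEAST n. same n)" and c': "lpv_carrier n ny ny A' K' C' D'"
      and s': "sub_markov n A' K' C' D' = sub_markov nx A K C (1\<^sub>m ny)" unfolding same_def by blast
    have least: "n \<le> n'" if "same n'" for n' unfolding n using that by (rule Least_le)
    have "minimal_dLPV_SSA n ny ny A' K' C' D'"
      unfolding minimal_dLPV_SSA_def using c' s' least unfolding same_def by metis
    then obtain x' where "asLPV_SSA M \<mu> p n ny ny A' K' C' (1\<^sub>m ny) e x' y"
      using realization_of_minimal_dLPV[OF _ s'] by blast
    hence "asLPV_realization M \<mu> p ny y n ny A' K' C' (1\<^sub>m ny) e" by (auto simp: asLPV_realization_def)
    hence "nx \<le> n" using min unfolding minimal_asLPV_realization_def by blast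
    thus "minimal_dLPV_SSA nx ny ny A K C (1\<^sub>m ny)"
      unfolding minimal_dLPV_SSA_def using car least order_trans unfolding same_def by metis
  next
    assume min: "minimal_dLPV_SSA nx ny ny A K C (1\<^sub>m ny)"
    show "minimal_asLPV_realization M \<mu> p ny y nx ny A K C (1\<^sub>m ny) e"
      unfolding minimal_asLPV_realization_def
    proof (intro conjI allI impI)
      show "asLPV_realization M \<mu> p ny y nx ny A K C (1\<^sub>m ny) e" using sys by (auto simp: asLPV_realization_def)
      fix nx' m' A' K' C' F' v'
      assume "asLPV_realization M \<mu> p ny y nx' m' A' K' C' F' v'"
      then obtain x' where "asLPV_SSA M \<mu> p nx' m' ny A' K' C' F' v' x' y" by (auto simp: asLPV_realization_def)
      thus "nx \<le> nx'" by (rule dim_le_of_minimal_dLPV[OF refl inn assms(5) min])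
    qed
  qed
qed

end
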